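(* Let $0<\lambda<d$ and $1\le p_-<p_+\le\infty$. Let $p_1\in[p_-,p_+]$ with $p_1<\infty$, and let $w_1\in A_{p_1/p_-}(\mathbb{R}^d)\cap RH_{(p_+/p_1)'}(\mathbb{R}^d)$. Let $T$ be a linear operator simultaneously defined and bounded on $\mathcal{L}^{p,\lambda}(w)$ for all $p\in(p_-,p_+)$ and all $w\in A_{p/p_-}(\mathbb{R}^d)\cap RH_{(p_+/p)'}(\mathbb{R}^d)$. Suppose in addition that $T$ is (defined and) compact on $\mathcal{L}^{p_1,\lambda}(w_1)$. Then $T$ is compact on $\mathcal{L}^{p,\lambda}(w)$ for all $p\in(p_-,p_+)$ and all $w\in A_{p/p_-}(\mathbb{R}^d)\cap RH_{(p_+/p)'}(\mathbb{R}^d)$.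
   Context: A weight on $\mathbb{R}^d$ is a locally integrable function $w$ that is positive almost everywhere. Cubes are cubes $Q\subset\mathbb{R}^d$, $|Q|$ is Lebesgue measure, and $\langle w\rangle_Q:=|Q|^{-1}\int_Q w$. The conjugate exponent is $p'=p/(p-1)$, with $1'=\infty$ and $\infty'=1$. For $1\le p<\infty$, $0<\lambda<d$ and a weight $w$, the (Samko type) weighted Morrey space $\mathcal{L}^{p,\lambda}(w)$ is the space of $f\in L^p_{\mathrm{loc}}(w)$ (complex valued, on $\mathbb{R}^d$) with $\|f\|_{\mathcal{L}^{p,\lambda}(w)}:=\sup_Q |Q|^{-\frac{\lambda}{dp}}\big(\int_Q |f|^p w\big)^{1/p}<\infty$, the supremum being over all cubes $Q\subset\mathbb{R}^d$. For $1<p<\infty$, $w\in A_p(\mathbb{R}^d)$ means $\sup_Q\langle w\rangle_Q\langle w^{-1/(p-1)}\rangle_Q^{p-1}<\infty$; $w\in A_1(\mathbb{R}^d)$ means $\sup_Q\langle w\rangle_Q\|w^{-1}\|_{L^\infty(Q)}<\infty$. For $1<\sigma<\infty$, $w\in RH_\sigma(\mathbb{R}^d)$ means $\sup_Q\langle w^\sigma\rangle_Q^{1/\sigma}\langle w\rangle_Q^{-1}<\infty$; $w\in RH_\infty(\mathbb{R}^d)$ means $\sup_Q\|w\|_{L^\infty(Q)}\langle w\rangle_Q^{-1}<\infty$. When $p_+=\infty$ the reverse Hölder conditions (with index $(p_+/p)'=1$) are vacuous, i.e. $RH_1(\mathbb{R}^d)$ consists of all weights. "Simultaneously defined" means that $T$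 is one linear map, defined on a linear space of measurable functions containing all the Morrey spaces in question, whose restriction to each of them has the stated property. "Bounded (compact) on $X$" means bounded (compact) as an operator $X\to X$. *)

theory Defs
  imports "HOL-Analysis.Analysis" "HOL-Probability.Essential_Supremum"
begin

text \<open>
  The ambient space is \<open>real ^ 'n\<close>, so that \<open>d = CARD('n)\<close>. Measurability is with respect to
  Lebesgue measure. Functions are not quotiented by almost everywhere equality; wherever the
  mathematics speaks about equality of functions, the definitions below use equality almost
  everywhere.
\<close>

text \<open>Cubes are closed, nondegenerate and have sides parallel to the coordinate axes.\<close>

definition cubes :: "(real ^ 'n) set set" where
  "cubes = {cbox a (\<chi> i. a $ i + l) |a l. 0 < l}"

definition weight :: "(real ^ 'n \<Rightarrow> real) \<Rightarrow> bool" where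
  "weight w \<longleftrightarrow>
     (\<forall>K. compact K \<longrightarrow> set_integrable lebesgue K w) \<and> (AE x in lebesgue. 0 < w x)"

text \<open>Powers of extended nonnegative reals; only used with exponents \<open>a > 0\<close>.\<close>

definition ennreal_powr :: "ennreal \<Rightarrow> real \<Rightarrow> ennreal" where
  "ennreal_powr x a = (if x = \<infinity> then \<infinity> else ennreal (enn2real x powr a))"

text \<open>
  The mean value of a function that is nonnegative almost everywhere; it is \<open>\<infinity>\<close> if the function
  is not integrable over \<open>Q\<close>.
\<close>

definition average :: "(real ^ 'n) set \<Rightarrow> (real ^ 'n \<Rightarrow> real) \<Rightarrow> ennreal" where
  "average Q w = (\<integral>\<^sup>+x\<in>Q. ennreal (w x) \<partial>lebesgue) / emeasure lebesgue Q"

definition Linfty_norm :: "(real ^ 'n) set \<Rightarrow> (real ^ 'n \<Rightarrow> real) \<Rightarrow> ennreal" where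
  "Linfty_norm Q w = esssup (restrict_space lebesgue Q) (\<lambda>x. ennreal \<bar>w x\<bar>)"

definition conjugate_exponent :: "ereal \<Rightarrow> ereal" where
  "conjugate_exponent p = (if p = 1 then \<infinity> else if p = \<infinity> then 1 else p / (p - 1))"

definition Muckenhoupt :: "real \<Rightarrow> (real ^ 'n \<Rightarrow> real) set" where
  "Muckenhoupt p = {w. weight w \<and>
     (if p = 1
      then (SUP Q\<in>cubes. average Q w * Linfty_norm Q (\<lambda>x. 1 / w x)) < \<infinity>
      else (SUP Q\<in>cubes. average Q w *
              ennreal_powr (average Q (\<lambda>x. w x powr (- 1 / (p - 1)))) (p - 1)) < \<infinity>)}"

definition reverse_Hoelder :: "ereal \<Rightarrow> (real ^ 'n \<Rightarrow> real) set" where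
  "reverse_Hoelder \<sigma> = {w. weight w \<and>
     (if \<sigma> = 1 then True
      else if \<sigma> = \<infinity>
      then (SUP Q\<in>cubes. Linfty_norm Q w / average Q w) < \<infinity>
      else (SUP Q\<in>cubes.
              ennreal_powr (average Q (\<lambda>x. w x powr real_of_ereal \<sigma>)) (1 / real_of_ereal \<sigma>)
                / average Q w) < \<infinity>)}"

definition Lp_loc :: "real \<Rightarrow> (real ^ 'n \<Rightarrow> real) \<Rightarrow> (real ^ 'n \<Rightarrow> complex) set" where
  "Lp_loc p w = {f \<in> borel_measurable lebesgue.
     \<forall>K. compact K \<longrightarrow> (\<integral>\<^sup>+x\<in>K. ennreal (norm (f x) powr p * w x) \<partial>lebesgue) < \<infinity>}"

definition Morrey_norm ::
    "real \<Rightarrow> real \<Rightarrow> (real ^ 'n \<Rightarrow> real) \<Rightarrow> (real ^ 'n \<Rightarrow> complex) \<Rightarrow> ennreal" where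
  "Morrey_norm p \<mu> w f = (SUP Q\<in>cubes.
     ennreal (measure lebesgue Q powr (- (\<mu> / (real CARD('n) * p)))) *
     ennreal_powr (\<integral>\<^sup>+x\<in>Q. ennreal (norm (f x) powr p * w x) \<partial>lebesgue) (1 / p))"

definition Morrey :: "real \<Rightarrow> real \<Rightarrow> (real ^ 'n \<Rightarrow> real) \<Rightarrow> (real ^ 'n \<Rightarrow> complex) set" where
  "Morrey p \<mu> w = {f \<in> Lp_loc p w. Morrey_norm p \<mu> w f < \<infinity>}"

text \<open>
  A linear space of (almost everywhere classes of) measurable functions, given by the set of all
  representatives of its elements.
\<close>

definition measurable_function_space :: "(real ^ 'n \<Rightarrow> complex) set \<Rightarrow> bool" where
  "measurable_function_space V \<longleftrightarrow>
     V \<subseteq> borel_measurable lebesgue \<and>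
     (\<lambda>x. 0) \<in> V \<and>
     (\<forall>f\<in>V. \<forall>g\<in>V. (\<lambda>x. f x + g x) \<in> V) \<and>
     (\<forall>c. \<forall>f\<in>V. (\<lambda>x. c * f x) \<in> V) \<and>
     (\<forall>f\<in>V. \<forall>g\<in>borel_measurable lebesgue. (AE x in lebesgue. f x = g x) \<longrightarrow> g \<in> V)"

definition linear_operator_on ::
    "(real ^ 'n \<Rightarrow> complex) set \<Rightarrow> ((real ^ 'n \<Rightarrow> complex) \<Rightarrow> real ^ 'n \<Rightarrow> complex) \<Rightarrow> bool" where
  "linear_operator_on V T \<longleftrightarrow>
     measurable_function_space V \<and>
     (\<forall>f\<in>V. T f \<in> borel_measurable lebesgue) \<and>
     (\<forall>f\<in>V. \<forall>g\<in>V. (AE x in lebesgue. f x = g x) \<longrightarrow> (AE x in lebesgue. T f x = T g x)) \<and>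
     (\<forall>f\<in>V. \<forall>g\<in>V. AE x in lebesgue. T (\<lambda>y. f y + g y) x = T f x + T g x) \<and>
     (\<forall>c. \<forall>f\<in>V. AE x in lebesgue. T (\<lambda>y. c * f y) x = c * T f x)"

text \<open>
  In the following definitions \<open>X\<close> is a space of functions with norm \<open>N\<close> (a seminorm on
  representatives).
\<close>

definition bounded_operator_on ::
    "('a \<Rightarrow> complex) set \<Rightarrow> (('a \<Rightarrow> complex) \<Rightarrow> ennreal) \<Rightarrow>
     (('a \<Rightarrow> complex) \<Rightarrow> 'a \<Rightarrow> complex) \<Rightarrow> bool" where
  "bounded_operator_on X N T \<longleftrightarrow>
     (\<forall>f\<in>X. T f \<in> X) \<and> (\<exists>C::real. \<forall>f\<in>X. N (T f) \<le> ennreal C * N f)"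

text \<open>
  Since \<open>N\<close> induces a metric on classes, relative compactness is expressed by sequences: every
  sequence in \<open>S\<close> has a subsequence that converges in \<open>X\<close>.
\<close>

definition relatively_compact_in ::
    "('a \<Rightarrow> complex) set \<Rightarrow> (('a \<Rightarrow> complex) \<Rightarrow> ennreal) \<Rightarrow> ('a \<Rightarrow> complex) set \<Rightarrow> bool" where
  "relatively_compact_in X N S \<longleftrightarrow>
     S \<subseteq> X \<and>
     (\<forall>s :: nat \<Rightarrow> 'a \<Rightarrow> complex. range s \<subseteq> S \<longrightarrow>
        (\<exists>g\<in>X. \<exists>r :: nat \<Rightarrow> nat. strict_mono r \<and> (\<lambda>n. N (\<lambda>x. s (r n) x - g x)) \<longlonglongrightarrow> 0))"

definition compact_operator_on ::
    "('a \<Rightarrow> complex) set \<Rightarrow> (('a \<Rightarrow> complex) \<Rightarrow> ennreal) \<Rightarrow>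
     (('a \<Rightarrow> complex) \<Rightarrow> 'a \<Rightarrow> complex) \<Rightarrow> bool" where
  "compact_operator_on X N T \<longleftrightarrow>
     (\<forall>f\<in>X. T f \<in> X) \<and>
     (\<forall>B\<subseteq>X. (\<exists>C::real. \<forall>f\<in>B. N f \<le> ennreal C) \<longrightarrow> relatively_compact_in X N (T ` B))"

end

theory Submission
  imports Defs "HOL-Library.Diagonal_Subsequence"
begin

text \<open>
  Write \<open>\<Phi>(F) = sup |Q| powr (- \<mu> / d) * \<integral>\<^sub>Q F\<close>, so that the
  norm of \<open>f\<close> in the Morrey space with parameters \<open>p, w\<close> is
  \<open>\<Phi>(|f|^p w) powr (1 / p)\<close>. By the self-improvement of the weight classes (a
  reverse Hoelder inequality, from a good-lambda argument on dyadic cubes), the target space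
  \<open>X\<close> lies strictly between the space \<open>X\<^sub>1\<close> on which
  \<open>T\<close> is compact and a space \<open>X\<^sub>0\<close> on which \<open>T\<close> is
  bounded: \<open>p = (1 - t) p0 + t p1\<close> and \<open>w = w0 powr (1 - t) * w1 powr
  t\<close>.

  A function \<open>f\<close> in the unit ball of \<open>X\<close> is cut into the pieces \<open>f\<^sub>k\<close> on which
  \<open>|f|^p0 w0 / (|f|^p w)\<close> is about \<open>2^k\<close>. Averaging \<open>T (\<Sum> \<plusminus> c\<^sub>k f\<^sub>k)\<close> over all choices of signs yields
  functions \<open>M\<^sub>0, M\<^sub>1\<close>, bounded in \<open>\<Phi>\<close>, that dominate all \<open>2^(-k) |T f\<^sub>k|^p0 w0\<close> and all
  \<open>2^(k \<gamma>) |T f\<^sub>k|^p1 w1\<close>, and summing two geometric series gives the pointwise bound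
  \<open>|\<Sum> T f\<^sub>k|^p w \<le> C M\<^sub>0 powr (1 - t) * M\<^sub>1 powr t\<close>. For \<open>k \<rightarrow> -\<infinity>\<close> the signed sums tend to \<open>0\<close> in
  \<open>X\<^sub>0\<close>, so compactness makes their images small in \<open>X\<^sub>1\<close>. For \<open>k \<rightarrow> \<infinity>\<close> a finite net in \<open>X\<^sub>1\<close> made
  of images of elements of \<open>X\<^sub>0 \<inter> X\<^sub>1\<close> replaces \<open>M\<^sub>1\<close> by a small function plus a fixed one, whose
  contribution decays geometrically in \<open>k\<close>. The middle part is bounded in \<open>X\<^sub>0\<close> and relatively
  compact in \<open>X\<^sub>1\<close>, hence relatively compact in \<open>X\<close>.
\<close>


section \<open>Fatou norms\<close>

text \<open>Separate norm bounds for the images of the pieces are only uniform in \<open>k\<close>,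
  so the triangle inequality in the target space is useless. The two-sided decay is visible only at
  a fixed point: the index-0 bound is good for very negative \<open>k\<close>, the index-1 bound for
  large \<open>k\<close>, and the two geometric series meet where the bounds cross. This requires
  one majorant per index that serves all \<open>k\<close> at once and whose size does not see the
  number of pieces; as \<open>T\<close> is merely linear, random signs are the device that supplies
  it. The three spaces share the parameter \<mu>, hence one functional acting on densities measures
  all of them, and a pointwise inequality between densities of different exponents and weights
  passes to the norms as it stands. Among its axioms the Fatou property replaces density arguments:
  in a Morrey space \<open>f\<close> need not be the norm limit of its finite cuts, and
  \<open>T\<close> is additive on finite sums only. Estimates are therefore proved for finitely many
  levels, with constants independent of their number, and infinite tails are reached as almost
  everywhere limits.\<close>

locale fatou_norm =
  fixes M :: "'a measure" and Phi :: "('a \<Rightarrow> ennreal) \<Rightarrow> ennreal"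
  assumes Phi_mono: "\<lbrakk>F \<in> borel_measurable M; G \<in> borel_measurable M; AE x in M. F x \<le> G x\<rbrakk>
      \<Longrightarrow> Phi F \<le> Phi G"
    and Phi_add: "\<lbrakk>F \<in> borel_measurable M; G \<in> borel_measurable M\<rbrakk>
      \<Longrightarrow> Phi (\<lambda>x. F x + G x) \<le> Phi F + Phi G"
    and Phi_cmult: "F \<in> borel_measurable M \<Longrightarrow> Phi (\<lambda>x. c * F x) = c * Phi F"
    and Phi_fatou: "(\<And>n::nat. F' n \<in> borel_measurable M)
      \<Longrightarrow> Phi (\<lambda>x. liminf (\<lambda>n. F' n x)) \<le> liminf (\<lambda>n. Phi (F' n))"
    and Phi_finite_AE: "\<lbrakk>F \<in> borel_measurable M; Phi F < \<infinity>\<rbrakk> \<Longrightarrow> AE x in M. F x < \<infinity>"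
begin

lemma Phi_zero: "Phi (\<lambda>x. 0) = 0"
  using Phi_cmult[of "\<lambda>x. 0" 0] by simp

lemma Phi_sum:
  assumes "finite I" "\<And>i. i \<in> I \<Longrightarrow> F i \<in> borel_measurable M"
  shows "Phi (\<lambda>x. \<Sum>i\<in>I. F i x) \<le> (\<Sum>i\<in>I. Phi (F i))"
  using assms
proof (induction I rule: finite_induct)
  case empty
  then show ?case by (simp add: Phi_zero)
next
  case (insert i I)
  have "Phi (\<lambda>x. F i x + (\<Sum>i\<in>I. F i x)) \<le> Phi (F i) + Phi (\<lambda>x. \<Sum>i\<in>I. F i x)"
    using insert.prems by (intro Phi_add) auto
  also have "\<dots> \<le> Phi (F i) + (\<Sum>i\<in>I. Phi (F i))"
    using insert by (intro add_left_mono) auto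
  finally show ?case using insert.hyps by simp
qed

text \<open>The form in which the Fatou property is used: a uniform bound survives almost everywhere
  limits. Infinite sums, completeness and infinite tails all rest on it.\<close>

lemma Phi_limit_le:
  assumes [measurable]: "\<And>n::nat. F n \<in> borel_measurable M" "G \<in> borel_measurable M"
    and lim: "AE x in M. (\<lambda>n. F n x) \<longlonglongrightarrow> G x"
    and bnd: "\<And>n. Phi (F n) \<le> c"
  shows "Phi G \<le> c"
proof -
  have "Phi G \<le> Phi (\<lambda>x. liminf (\<lambda>n. F n x))"
    by (rule Phi_mono) (use lim in \<open>auto elim!: eventually_mono simp: lim_imp_Liminf\<close>)
  also have "\<dots> \<le> liminf (\<lambda>n. Phi (F n))"
    by (rule Phi_fatou) simp
  also have "\<dots> \<le> liminf (\<lambda>n. c)"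
    by (intro Liminf_mono always_eventually allI bnd)
  finally show ?thesis by (simp add: Liminf_const)
qed

text \<open>Along a subsequence with geometrically small values the total sum has finite
  \<open>Phi\<close>, by subadditivity and the Fatou property. It is therefore finite almost
  everywhere, and the terms of a convergent series tend to 0.\<close>

lemma Phi_tendsto_zero_AE:
  assumes [measurable]: "\<And>n::nat. F n \<in> borel_measurable M"
    and lim: "(\<lambda>n. Phi (F n)) \<longlonglongrightarrow> 0"
  obtains r :: "nat \<Rightarrow> nat" where "strict_mono r" "AE x in M. (\<lambda>n. F (r n) x) \<longlonglongrightarrow> 0"
proof -
  have ex: "\<exists>n>m. Phi (F n) < ennreal ((1/2)^k)" for m k
  proof -
    have "\<forall>\<^sub>F n in sequentially. Phi (F n) < ennreal ((1/2)^k)"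
      using lim by (rule order_tendstoD) simp
    moreover have "\<forall>\<^sub>F n in sequentially. n > m" by (rule eventually_gt_at_top)
    ultimately have "\<forall>\<^sub>F n in sequentially. Phi (F n) < ennreal ((1/2)^k) \<and> n > m"
      by eventually_elim auto
    then show ?thesis by (auto dest!: eventually_happens)
  qed
  obtain r :: "nat \<Rightarrow> nat" where r': "\<And>k. Phi (F (r k)) < ennreal ((1/2)^k)" "\<And>k. r k < r (Suc k)"
    using dependent_nat_choice[of "\<lambda>k n. Phi (F n) < ennreal ((1/2)^k)" "\<lambda>k m n. m < n"] ex
    by (metis (no_types, lifting))
  have r: "Phi (F (r k)) \<le> ennreal ((1/2)^k)" for k
    using r' by (intro less_imp_le)
  have part: "Phi (\<lambda>x. \<Sum>n<N. F (r n) x) \<le> 2" for N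
  proof -
    have "Phi (\<lambda>x. \<Sum>n<N. F (r n) x) \<le> (\<Sum>n<N. Phi (F (r n)))"
      by (rule Phi_sum) auto
    also have "\<dots> \<le> (\<Sum>n<N. ennreal ((1/2)^n))" by (intro sum_mono r)
    also have "\<dots> = ennreal (\<Sum>n<N. (1/2)^n)" by (rule sum_ennreal) simp
    also have "(\<Sum>n<N. (1/2::real)^n) \<le> 2"
      by (subst sum_gp_strict) (simp add: field_simps)
    finally show ?thesis by (simp add: ennreal_leI)
  qed
  have "Phi (\<lambda>x. \<Sum>n. F (r n) x) \<le> 2"
    by (rule Phi_limit_le[where F="\<lambda>N x. \<Sum>n<N. F (r n) x"])
       (auto intro!: part summable_LIMSEQ)
  then have "Phi (\<lambda>x. \<Sum>n. F (r n) x) < \<infinity>"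
    by (rule le_less_trans) (simp add: ennreal_numeral_less_top[unfolded top_ennreal.abs_eq])
  then have "AE x in M. (\<Sum>n. F (r n) x) < \<infinity>"
    by (intro Phi_finite_AE) auto
  then have "AE x in M. (\<lambda>n. F (r n) x) \<longlonglongrightarrow> 0"
  proof eventually_elim
    case (elim x)
    have fin: "F (r n) x < \<infinity>" for n
      using elim ennreal_suminf_lessD by blast
    have "summable (\<lambda>n. enn2real (F (r n) x))"
      using elim fin by (intro summable_suminf_not_top) (auto simp: less_top)
    then have "(\<lambda>n. enn2real (F (r n) x)) \<longlonglongrightarrow> 0" by (rule summable_LIMSEQ_zero)
    then have "(\<lambda>n. ennreal (enn2real (F (r n) x))) \<longlonglongrightarrow> ennreal 0"
      by (rule tendsto_ennrealI)
    then show ?case using fin by (simp add: less_top)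
  qed
  moreover have "strict_mono r" using r' by (simp add: strict_mono_Suc_iff)
  ultimately show ?thesis using that by blast
qed

end

text \<open>Working with this density instead of a norm avoids roots: \<open>Phi\<close> is
  homogeneous of degree one and knows neither the exponent nor the weight, so densities of different
  spaces can be compared point by point.\<close>

definition pdens :: "real \<Rightarrow> ('a \<Rightarrow> real) \<Rightarrow> ('a \<Rightarrow> complex) \<Rightarrow> 'a \<Rightarrow> ennreal" where
  "pdens p w f x = ennreal (norm (f x) powr p * w x)"

lemma measurable_pdens [measurable]:
  "\<lbrakk>w \<in> borel_measurable M; f \<in> borel_measurable M\<rbrakk> \<Longrightarrow> pdens p w f \<in> borel_measurable M"
  unfolding pdens_def by measurable

lemma norm_add_powr_le:
  fixes a b :: "'a::real_normed_vector"
  assumes "0 < p"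
  shows "norm (a + b) powr p \<le> 2 powr p * (norm a powr p + norm b powr p)"
proof -
  have "norm (a + b) \<le> 2 * max (norm a) (norm b)"
    using norm_triangle_ineq[of a b] by linarith
  then have "norm (a + b) powr p \<le> (2 * max (norm a) (norm b)) powr p"
    using assms by (intro powr_mono2) auto
  also have "\<dots> = 2 powr p * max (norm a) (norm b) powr p"
    by (simp add: powr_mult max_def)
  also have "max (norm a) (norm b) powr p \<le> norm a powr p + norm b powr p"
    by (simp add: max_def)
  finally show ?thesis by simp
qed

lemma pdens_add_le:
  assumes "0 < p" "0 \<le> w x"
  shows "pdens p w (\<lambda>x. f x + g x) x \<le> ennreal (2 powr p) * (pdens p w f x + pdens p w g x)"
proof -
  have "norm (f x + g x) powr p * w x \<le> (2 powr p * (norm (f x) powr p + norm (g x) powr p)) * w x"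
    using assms by (intro mult_right_mono norm_add_powr_le) auto
  also have "\<dots> = 2 powr p * (norm (f x) powr p * w x + norm (g x) powr p * w x)"
    by (simp add: algebra_simps)
  finally have "ennreal (norm (f x + g x) powr p * w x)
      \<le> ennreal (2 powr p * (norm (f x) powr p * w x + norm (g x) powr p * w x))"
    by (rule ennreal_leI)
  then show ?thesis
    using assms by (simp add: pdens_def ennreal_mult ennreal_plus del: ennreal_plus[symmetric])
qed

lemma pdens_cmult:
  assumes "0 \<le> w x"
  shows "pdens p w (\<lambda>x. c * f x) x = ennreal (norm c powr p) * pdens p w f x"
  using assms by (simp add: pdens_def norm_mult powr_mult ennreal_mult[symmetric] mult.assoc)

text \<open>The two terms on the right agree exactly when \<open>B = d powr (1/t) * A\<close>; on
  either side of this threshold the larger one alone dominates the left side. The free parameter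
  \<open>d\<close> is later made small to spend an arbitrarily small share of a merely bounded term
  \<open>A\<close>.\<close>

lemma powr_weighted_young:
  fixes A B t d :: real
  assumes "0 \<le> A" "0 \<le> B" "0 < t" "t < 1" "0 < d"
  shows "A powr (1 - t) * B powr t \<le> d * A + d powr (- ((1 - t) / t)) * B"
proof (cases "A = 0 \<or> B = 0")
  case True
  then show ?thesis using assms by auto
next
  case False
  then have pos: "A > 0" "B > 0" using assms by auto
  show ?thesis
  proof (cases "B \<le> d powr (1/t) * A")
    case True
    have "B powr t \<le> (d powr (1/t) * A) powr t"
      using True pos assms by (intro powr_mono2) auto
    also have "\<dots> = d * A powr t" using pos assms by (simp add: powr_mult powr_powr)
    finally have "A powr (1 - t) * B powr t \<le> A powr (1 - t) * (d * A powr t)"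
      by (intro mult_left_mono) auto
    also have "\<dots> = d * (A powr (1 - t) * A powr t)" by simp
    also have "\<dots> = d * A" using pos by (simp add: powr_add[symmetric])
    finally show ?thesis using pos assms by (simp add: add_increasing2)
  next
    case False
    then have "A \<le> d powr (- (1/t)) * B"
      using pos assms by (simp add: powr_minus field_simps)
    then have "A powr (1 - t) \<le> (d powr (- (1/t)) * B) powr (1 - t)"
      using pos assms by (intro powr_mono2) auto
    also have "\<dots> = d powr (- ((1 - t)/t)) * B powr (1 - t)"
      using pos assms by (simp add: powr_mult powr_powr)
    finally have "A powr (1 - t) * B powr t \<le> (d powr (- ((1 - t)/t)) * B powr (1 - t)) * B powr t"
      by (intro mult_right_mono) auto
    also have "\<dots> = d powr (- ((1 - t)/t)) * (B powr (1 - t) * B powr t)" by simp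
    also have "\<dots> = d powr (- ((1 - t)/t)) * B" using pos by (simp add: powr_add[symmetric])
    finally show ?thesis using pos assms by (simp add: add_increasing)
  qed
qed

text \<open>For each \<open>S\<close> the two sign patterns that differ only at \<open>j\<close> give sums whose difference is
  \<open>2 a\<^sub>j\<close>.\<close>

lemma sum_signs_powr:
  fixes a :: "'i \<Rightarrow> complex"
  assumes "finite K" "j \<in> K" "0 < p"
  shows "2 ^ card K * norm (a j) powr p
     \<le> 2 * (\<Sum>S\<in>Pow K. norm (\<Sum>k\<in>K. (if k \<in> S then 1 else -1) * a k) powr p)"
proof -
  define K' where "K' = K - {j}"
  have K: "K = insert j K'" "j \<notin> K'" "finite K'" using assms by (auto simp: K'_def)
  define s where "s S = (\<Sum>k\<in>K'. (if k \<in> S then 1 else -1) * a k)" for S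
  define h where "h S = norm (\<Sum>k\<in>K. (if k \<in> S then 1 else -1) * a k) powr p" for S
  have h1: "h S = norm (s S - a j) powr p" if "S \<in> Pow K'" for S
  proof -
    have "j \<notin> S" using that K by auto
    then show ?thesis using K by (simp add: h_def s_def add.commute)
  qed
  have h2: "h (insert j S) = norm (s S + a j) powr p" if "S \<in> Pow K'" for S
  proof -
    have "(\<Sum>k\<in>K'. (if k \<in> insert j S then 1 else -1) * a k) = s S"
      unfolding s_def using K by (intro sum.cong) auto
    then show ?thesis using K by (simp add: h_def add.commute)
  qed
  have pair: "norm (a j) powr p \<le> h S + h (insert j S)" if "S \<in> Pow K'" for S
  proof -
    have "2 * norm (a j) = norm ((s S + a j) - (s S - a j))"
      by (simp flip: mult_2 add: norm_mult)
    also have "\<dots> \<le> norm (s S + a j) + norm (s S - a j)" by (rule norm_triangle_ineq4)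
    finally have "norm (a j) \<le> norm (s S + a j) \<or> norm (a j) \<le> norm (s S - a j)" by linarith
    then have "norm (a j) powr p \<le> norm (s S + a j) powr p
        \<or> norm (a j) powr p \<le> norm (s S - a j) powr p"
      using \<open>0 < p\<close> powr_mono2 by fastforce
    then show ?thesis unfolding h1[OF that] h2[OF that] by (auto simp: add_increasing add_increasing2)
  qed
  have "(\<Sum>S\<in>Pow K. h S) = (\<Sum>S\<in>Pow K'. h S) + (\<Sum>S\<in>insert j ` Pow K'. h S)"
    unfolding K(1) Pow_insert using K by (intro sum.union_disjoint) auto
  also have "(\<Sum>S\<in>insert j ` Pow K'. h S) = (\<Sum>S\<in>Pow K'. h (insert j S))"
    using K by (subst sum.reindex) (auto simp: inj_on_def)
  also have "(\<Sum>S\<in>Pow K'. h S) + \<dots> = (\<Sum>S\<in>Pow K'. h S + h (insert j S))"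
    by (rule sum.distrib[symmetric])
  also have "\<dots> \<ge> (\<Sum>S\<in>Pow K'. norm (a j) powr p)" by (intro sum_mono pair)
  also have "(\<Sum>S\<in>Pow K'. norm (a j) powr p) = 2 ^ card K' * norm (a j) powr p"
    using K by (simp add: card_Pow)
  finally show ?thesis using K by (simp add: h_def)
qed

text \<open>Each distance from \<open>n\<close> occurs at most once on either side of
  \<open>n\<close>, so two geometric series suffice.\<close>

lemma sum_powr_abs_diff_le:
  fixes c :: real and K :: "int set"
  assumes "0 < c" "c < 1" "finite K"
  shows "(\<Sum>k\<in>K. c ^ nat \<bar>k - n\<bar>) \<le> 2 / (1 - c)"
proof -
  have half: "(\<Sum>k\<in>L. c ^ nat \<bar>k - n\<bar>) \<le> 1 / (1 - c)"
    if "finite L" "inj_on (\<lambda>k. nat \<bar>k - n\<bar>) L" for L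
  proof -
    have "(\<Sum>k\<in>L. c ^ nat \<bar>k - n\<bar>) = (\<Sum>m\<in>(\<lambda>k. nat \<bar>k - n\<bar>) ` L. c ^ m)"
      using that by (simp add: sum.reindex)
    also have "\<dots> \<le> (\<Sum>m. c ^ m)"
      using assms that by (intro sum_le_suminf) (auto intro: summable_geometric)
    also have "\<dots> = 1 / (1 - c)" using assms by (intro suminf_geometric) auto
    finally show ?thesis .
  qed
  have "(\<Sum>k\<in>K. c ^ nat \<bar>k - n\<bar>)
      = (\<Sum>k\<in>K \<inter> {n..}. c ^ nat \<bar>k - n\<bar>) + (\<Sum>k\<in>K - {n..}. c ^ nat \<bar>k - n\<bar>)"
    using assms(3) by (rule sum.Int_Diff)
  also have "\<dots> \<le> 1 / (1 - c) + 1 / (1 - c)"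
    using assms by (intro add_mono half) (auto simp: inj_on_def)
  finally show ?thesis by simp
qed

section \<open>Level decomposition and pointwise interpolation\<close>

text \<open>The increasing bound \<open>a powr k * \<alpha>\<close> and the decreasing bound
  \<open>b powr (- k) * \<beta>\<close> cross at a real point \<kappa>, with common value
  \<open>\<alpha> powr (1 - \<theta>) * \<beta> powr \<theta>\<close>. Away from \<kappa> the
  smaller of the two decays at rate \<open>c\<close> at least.\<close>

lemma sum_le_geometric_interpolation:
  fixes h :: "int \<Rightarrow> real"
  assumes ab: "1 < a" "1 < b" and fin: "finite K" and nn: "0 \<le> \<alpha>" "0 \<le> \<beta>"
    and h1: "\<And>k. k \<in> K \<Longrightarrow> h k \<le> a powr k * \<alpha>"
    and h2: "\<And>k. k \<in> K \<Longrightarrow> h k \<le> b powr (- k) * \<beta>"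
    and c: "c = 1 / min a b" and th: "\<theta> = ln a / (ln a + ln b)"
  shows "(\<Sum>k\<in>K. h k) \<le> 2 / (c * (1 - c)) * (\<alpha> powr (1 - \<theta>) * \<beta> powr \<theta>)"
proof -
  have c01: "0 < c" "c < 1" using ab by (auto simp: c min_def)
  show ?thesis
  proof (cases "\<alpha> = 0 \<or> \<beta> = 0")
    case True
    then have "(\<Sum>k\<in>K. h k) \<le> (\<Sum>k\<in>K. 0)"
      by (intro sum_mono) (use h1 h2 in force)
    then show ?thesis using True by auto
  next
    case False
    then have pos: "\<alpha> > 0" "\<beta> > 0" using nn by auto
    have lpos: "ln a > 0" "ln b > 0" using ab by auto
    define \<kappa> where "\<kappa> = ln (\<beta> / \<alpha>) / (ln a + ln b)"
    define m where "m = \<alpha> powr (1 - \<theta>) * \<beta> powr \<theta>"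
    have k1: "\<kappa> * ln a = \<theta> * (ln \<beta> - ln \<alpha>)"
      using pos by (simp add: \<kappa>_def th ln_div)
    have k2: "\<kappa> * ln b = (1 - \<theta>) * (ln \<beta> - ln \<alpha>)"
    proof -
      have "1 - \<theta> = ln b / (ln a + ln b)" using lpos by (simp add: th field_simps)
      then show ?thesis using pos by (simp add: \<kappa>_def ln_div)
    qed
    have m1: "a powr \<kappa> * \<alpha> = m"
    proof -
      have "a powr \<kappa> * \<alpha> = exp (\<kappa> * ln a + ln \<alpha>)"
        using ab pos by (simp add: powr_def exp_add)
      also have "\<kappa> * ln a + ln \<alpha> = (1 - \<theta>) * ln \<alpha> + \<theta> * ln \<beta>"
        by (simp add: k1 algebra_simps)
      finally show ?thesis using pos by (simp add: m_def powr_def exp_add)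
    qed
    have m2: "b powr (- \<kappa>) * \<beta> = m"
    proof -
      have "b powr (- \<kappa>) * \<beta> = exp (- (\<kappa> * ln b) + ln \<beta>)"
        using ab pos by (simp add: powr_def exp_diff exp_minus divide_inverse mult.commute)
      also have "- (\<kappa> * ln b) + ln \<beta> = (1 - \<theta>) * ln \<alpha> + \<theta> * ln \<beta>"
        by (simp add: k2 algebra_simps)
      finally show ?thesis using pos by (simp add: m_def powr_def exp_add)
    qed
    have mpos: "m > 0" using pos by (simp add: m_def)
    define n where "n = \<lfloor>\<kappa>\<rfloor>"
    have inv: "(1 / u) powr r = u powr (- r)" if "1 < u" for u r :: real
      using that by (simp add: powr_def ln_div)
    have main: "h k \<le> m / c * c ^ nat \<bar>k - n\<bar>" if "k \<in> K" for k
    proof -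
      have le: "h k \<le> m * c powr \<bar>k - \<kappa>\<bar>"
      proof (cases "\<kappa> \<le> k")
        case True
        have "b powr (- k) * \<beta> = (b powr (- \<kappa>) * \<beta>) * b powr (- (k - \<kappa>))"
        proof -
          have "b powr (- k) = b powr (- \<kappa>) * b powr (- (k - \<kappa>))"
            by (simp only: powr_add[symmetric]) simp
          then show ?thesis by (simp only: mult_ac)
        qed
        also have "\<dots> = m * (1 / b) powr (k - \<kappa>)"
          unfolding m2 inv[OF ab(2)] ..
        also have "\<dots> \<le> m * c powr (k - \<kappa>)"
        proof (intro mult_left_mono powr_mono2)
          show "1 / b \<le> c" using ab unfolding c by (intro divide_left_mono) auto
        qed (use True ab mpos in auto)
        finally show ?thesis using True h2[OF that] by simp
      next
        case False
        have "a powr k * \<alpha> = (a powr \<kappa> * \<alpha>) * a powr (- (\<kappa> - k))"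
        proof -
          have "a powr k = a powr \<kappa> * a powr (- (\<kappa> - k))"
            by (simp only: powr_add[symmetric]) simp
          then show ?thesis by (simp only: mult_ac)
        qed
        also have "\<dots> = m * (1 / a) powr (\<kappa> - k)"
          unfolding m1 inv[OF ab(1)] ..
        also have "\<dots> \<le> m * c powr (\<kappa> - k)"
        proof (intro mult_left_mono powr_mono2)
          show "1 / a \<le> c" using ab unfolding c by (intro divide_left_mono) auto
        qed (use False ab mpos in auto)
        finally show ?thesis using False h1[OF that] by simp
      qed
      \<comment> \<open>Rounding \<kappa> down to the integer \<open>n\<close> changes distances by
        at most one, which costs the factor \<open>1 / c\<close>.\<close>
      have "c powr \<bar>k - \<kappa>\<bar> \<le> c powr (real (nat \<bar>k - n\<bar>) - 1)"
      proof (rule powr_mono')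
        show "real (nat \<bar>k - n\<bar>) - 1 \<le> \<bar>k - \<kappa>\<bar>" unfolding n_def by linarith
      qed (use c01 in auto)
      also have "\<dots> = c ^ nat \<bar>k - n\<bar> / c"
        using c01 by (simp only: powr_diff powr_realpow powr_one)
      finally have "m * c powr \<bar>k - \<kappa>\<bar> \<le> m * (c ^ nat \<bar>k - n\<bar> / c)"
        using mpos by (intro mult_left_mono) auto
      with le show ?thesis by simp
    qed
    have "(\<Sum>k\<in>K. h k) \<le> (\<Sum>k\<in>K. m / c * c ^ nat \<bar>k - n\<bar>)" by (intro sum_mono main)
    also have "\<dots> = m / c * (\<Sum>k\<in>K. c ^ nat \<bar>k - n\<bar>)" by (rule sum_distrib_left[symmetric])
    also have "\<dots> \<le> m / c * (2 / (1 - c))"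
      using mpos c01 fin by (intro mult_left_mono sum_powr_abs_diff_le) auto
    finally show ?thesis by (simp add: m_def mult_ac)
  qed
qed

lemma pdens_tendsto_zero:
  assumes "0 < p" "0 < w x" "(\<lambda>n. pdens p w (h n) x) \<longlonglongrightarrow> 0"
  shows "(\<lambda>n. h n x) \<longlonglongrightarrow> 0"
proof -
  have "(\<lambda>n. norm (h n x) powr p * w x) \<longlonglongrightarrow> 0"
    using assms unfolding pdens_def by (subst (asm) tendsto_ennreal_iff[of _ _ 0, simplified]) auto
  then have "(\<lambda>n. norm (h n x) powr p * w x / w x) \<longlonglongrightarrow> 0 / w x"
    using assms by (intro tendsto_divide) auto
  then have "(\<lambda>n. norm (h n x) powr p) \<longlonglongrightarrow> 0" using assms by simp
  then have "(\<lambda>n. (norm (h n x) powr p) powr (1/p)) \<longlonglongrightarrow> 0 powr (1/p)"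
    using assms by (intro tendsto_powr2 tendsto_const) auto
  then show ?thesis using assms by (simp add: powr_powr tendsto_norm_zero_iff)
qed

text \<open>The exponent is a convex combination and the weight a geometric mean with the same
  \<open>t\<close>, so that the density of index \<open>p\<close> is exactly the geometric mean of
  the two endpoint densities at every point.\<close>

locale interpolation_couple = fatou_norm M Phi
  for M :: "'a measure" and Phi +
  fixes p0 p1 p t :: real and w0 w1 w :: "'a \<Rightarrow> real"
  assumes exponents: "0 < p0" "0 < p1" "0 < t" "t < 1" "p = (1 - t) * p0 + t * p1"
    and w_meas [measurable]: "w0 \<in> borel_measurable M" "w1 \<in> borel_measurable M"
    and w_pos: "\<And>x. 0 < w0 x" "\<And>x. 0 < w1 x"
    and w_eq: "w = (\<lambda>x. w0 x powr (1 - t) * w1 x powr t)"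
begin

definition gam :: real where "gam = (1 - t) / t"

lemma gam_pos: "0 < gam" using exponents by (simp add: gam_def)

lemma p_pos: "0 < p" using exponents by (simp add: add_pos_pos)

lemma wp_pos: "0 < w x"
  unfolding w_eq using w_pos[of x] by simp

lemma wp_meas [measurable]: "w \<in> borel_measurable M"
  unfolding w_eq by measurable

text \<open>The dyadic size of the quotient of the densities of index 0 and \<open>p\<close>. At
  zeros of \<open>f\<close> the value is a default without effect, because \<open>lmult\<close>
  multiplies by \<open>f x\<close>.\<close>

definition lev :: "('a \<Rightarrow> complex) \<Rightarrow> 'a \<Rightarrow> int" where
  "lev f x = \<lfloor>log 2 (norm (f x) powr (p0 - p) * w0 x / w x)\<rfloor>"

text \<open>One notion for single pieces, for cuts to a set of levels and for signed sums with
  coefficients.\<close>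

definition lmult :: "(int \<Rightarrow> real) \<Rightarrow> ('a \<Rightarrow> complex) \<Rightarrow> 'a \<Rightarrow> complex" where
  "lmult c f x = complex_of_real (c (lev f x)) * f x"

lemma lmult_meas [measurable]:
  assumes [measurable]: "f \<in> borel_measurable M"
  shows "lmult c f \<in> borel_measurable M"
proof -
  have [measurable]: "lev f \<in> M \<rightarrow>\<^sub>M count_space UNIV" unfolding lev_def by measurable
  show ?thesis unfolding lmult_def by measurable
qed

text \<open>Let \<rho> and \<rho>' be the quotients of the two endpoint densities by that of index
  \<open>p\<close>. The geometric mean relation says
  \<open>\<rho> powr (1 - t) * \<rho>' powr t = 1\<close>, that is,
  \<open>\<rho>' = \<rho> powr (- gam)\<close>.\<close>

lemma dens_relations:
  fixes z :: complex and x :: 'a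
  assumes "z \<noteq> 0"
  defines "\<rho> \<equiv> norm z powr (p0 - p) * w0 x / w x"
  shows "0 < \<rho>" "norm z powr p0 * w0 x = \<rho> * (norm z powr p * w x)"
    "norm z powr p1 * w1 x = \<rho> powr (- gam) * (norm z powr p * w x)"
proof -
  have z: "norm z > 0" using assms by simp
  have pos: "w0 x > 0" "w1 x > 0" "w x > 0" using w_pos wp_pos by auto
  show rho: "0 < \<rho>" using z pos by (simp add: \<rho>_def)
  show "norm z powr p0 * w0 x = \<rho> * (norm z powr p * w x)"
    using z pos by (simp add: \<rho>_def powr_diff)
  have lw: "ln (w x) = (1 - t) * ln (w0 x) + t * ln (w1 x)"
    unfolding w_eq using pos by (simp add: ln_mult ln_powr)
  have lr: "ln \<rho> = (p0 - p) * ln (norm z) + ln (w0 x) - ln (w x)"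
    using z pos by (simp add: \<rho>_def ln_div ln_mult ln_powr)
  have "t * (p1 * ln (norm z) + ln (w1 x))
      = - (1 - t) * ln \<rho> + t * (p * ln (norm z) + ln (w x))"
    unfolding lr lw exponents(5) by (simp add: algebra_simps)
  moreover have gen: "(- (1 - t) * L + t * Z) / t = - gam * L + Z" for L Z
    using exponents(3) by (simp add: gam_def field_simps)
  ultimately have "p1 * ln (norm z) + ln (w1 x) = (- (1 - t) * ln \<rho> + t * (p * ln (norm z) + ln (w x))) / t"
    using exponents(3) by (metis less_irrefl nonzero_mult_div_cancel_left)
  also have "\<dots> = - gam * ln \<rho> + (p * ln (norm z) + ln (w x))"
    by (rule gen)
  finally have "p1 * ln (norm z) + ln (w1 x) = - gam * ln \<rho> + (p * ln (norm z) + ln (w x))" .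
  then have "exp (p1 * ln (norm z) + ln (w1 x)) = exp (- gam * ln \<rho> + (p * ln (norm z) + ln (w x)))"
    by simp
  then show "norm z powr p1 * w1 x = \<rho> powr (- gam) * (norm z powr p * w x)"
    using z pos rho assms(1) by (simp only: exp_add) (simp add: powr_def)
qed

text \<open>On level \<open>k\<close> the quotient lies between \<open>2 powr k\<close> and
  \<open>2 powr (k + 1)\<close>. The upper end enters here; \<open>lmult_le1\<close> uses the lower
  end, since \<open>- gam\<close> is negative. This explains the asymmetric exponents in everything
  that follows.\<close>

lemma lmult_le0:
  fixes c :: "int \<Rightarrow> real"
  assumes "\<And>k. \<bar>c k\<bar> powr p0 * 2 powr (k + 1) \<le> D"
  shows "pdens p0 w0 (lmult c f) x \<le> ennreal D * pdens p w f x"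
proof (cases "f x = 0")
  case True
  then show ?thesis by (simp add: pdens_def lmult_def)
next
  case False
  define \<rho> where "\<rho> = norm (f x) powr (p0 - p) * w0 x / w x"
  note rel = dens_relations[OF False, of x, folded \<rho>_def]
  define k where "k = lev f x"
  have "log 2 \<rho> \<le> k + 1" unfolding k_def lev_def \<rho>_def by linarith
  then have "\<rho> \<le> 2 powr (k + 1)" using rel(1) by (simp add: log_le_iff)
  have D: "0 \<le> D" using assms[of 0] by (smt (verit) mult_nonneg_nonneg powr_ge_zero)
  have "norm (lmult c f x) powr p0 * w0 x = \<bar>c k\<bar> powr p0 * (norm (f x) powr p0 * w0 x)"
    by (simp add: lmult_def norm_mult powr_mult k_def)
  also have "\<dots> = (\<bar>c k\<bar> powr p0 * \<rho>) * (norm (f x) powr p * w x)"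
    by (simp add: rel(2))
  also have "\<dots> \<le> D * (norm (f x) powr p * w x)"
  proof (intro mult_right_mono)
    have "\<bar>c k\<bar> powr p0 * \<rho> \<le> \<bar>c k\<bar> powr p0 * 2 powr (k + 1)"
      using \<open>\<rho> \<le> _\<close> by (intro mult_left_mono) auto
    then show "\<bar>c k\<bar> powr p0 * \<rho> \<le> D" using assms[of k] by simp
  qed (use wp_pos[of x] in auto)
  finally show ?thesis
    using D wp_pos[of x] by (simp add: pdens_def ennreal_mult[symmetric] ennreal_leI)
qed

lemma lmult_le1:
  fixes c :: "int \<Rightarrow> real"
  assumes "\<And>k. \<bar>c k\<bar> powr p1 * 2 powr (- gam * k) \<le> D"
  shows "pdens p1 w1 (lmult c f) x \<le> ennreal D * pdens p w f x"
proof (cases "f x = 0")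
  case True
  then show ?thesis by (simp add: pdens_def lmult_def)
next
  case False
  define \<rho> where "\<rho> = norm (f x) powr (p0 - p) * w0 x / w x"
  note rel = dens_relations[OF False, of x, folded \<rho>_def]
  define k where "k = lev f x"
  have "k \<le> log 2 \<rho>" unfolding k_def lev_def \<rho>_def by linarith
  then have "2 powr k \<le> \<rho>" using rel(1) by (simp add: le_log_iff)
  then have "\<rho> powr (- gam) \<le> (2 powr k) powr (- gam)"
    using gam_pos by (intro powr_mono2') auto
  then have rg: "\<rho> powr (- gam) \<le> 2 powr (- gam * k)" by (simp add: powr_powr mult.commute)
  have D: "0 \<le> D" using assms[of 0] by (smt (verit) mult_nonneg_nonneg powr_ge_zero)
  have "norm (lmult c f x) powr p1 * w1 x = \<bar>c k\<bar> powr p1 * (norm (f x) powr p1 * w1 x)"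
    by (simp add: lmult_def norm_mult powr_mult k_def)
  also have "\<dots> = (\<bar>c k\<bar> powr p1 * \<rho> powr (- gam)) * (norm (f x) powr p * w x)"
    by (simp add: rel(3))
  also have "\<dots> \<le> D * (norm (f x) powr p * w x)"
  proof (intro mult_right_mono)
    have "\<bar>c k\<bar> powr p1 * \<rho> powr (- gam) \<le> \<bar>c k\<bar> powr p1 * 2 powr (- gam * k)"
      using rg by (intro mult_left_mono) auto
    then show "\<bar>c k\<bar> powr p1 * \<rho> powr (- gam) \<le> D" using assms[of k] by simp
  qed (use wp_pos[of x] in auto)
  finally show ?thesis
    using D wp_pos[of x] by (simp add: pdens_def ennreal_mult[symmetric] ennreal_leI)
qed

lemma pdens_interpolate:
  assumes "0 < d"
  shows "pdens p w g x \<le> ennreal d * pdens p0 w0 g x + ennreal (d powr (- gam)) * pdens p1 w1 g x"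
proof -
  define z where "z = norm (g x)"
  have pos: "w0 x > 0" "w1 x > 0" using w_pos by auto
  have "z powr p * w x = (z powr p0 * w0 x) powr (1 - t) * (z powr p1 * w1 x) powr t"
    using pos by (simp add: w_eq powr_mult powr_powr z_def exponents(5) powr_add mult_ac)
  also have "\<dots> \<le> d * (z powr p0 * w0 x) + d powr (- ((1 - t) / t)) * (z powr p1 * w1 x)"
    using pos assms exponents by (intro powr_weighted_young) auto
  finally have "ennreal (z powr p * w x)
      \<le> ennreal (d * (z powr p0 * w0 x) + d powr (- gam) * (z powr p1 * w1 x))"
    by (intro ennreal_leI) (simp add: gam_def)
  then show ?thesis
    using pos assms by (simp add: pdens_def z_def ennreal_mult[symmetric])
qed

text \<open>The summation over levels, carried out at a single point. After division by the weights
  the moduli of the summands satisfy the hypotheses of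
  \<open>sum_le_geometric_interpolation\<close>. The constant depends on the exponents alone, which
  makes the tail estimates uniform in the function and in the set of levels.\<close>

lemma pdens_sum_interpolate:
  obtains C where "0 < C"
    "\<And>d K h x F0 F1. \<lbrakk>0 < d; finite K;
       \<And>k. k \<in> K \<Longrightarrow> pdens p0 w0 (h k) x \<le> ennreal (2 powr (k + 1)) * F0;
       \<And>k. k \<in> K \<Longrightarrow> pdens p1 w1 (h k) x \<le> ennreal (2 powr (- gam * k)) * F1\<rbrakk>
     \<Longrightarrow> pdens p w (\<lambda>x. \<Sum>k\<in>K. h (k::int) x) x
          \<le> ennreal C * (ennreal d * F0 + ennreal (d powr (- gam)) * F1)"
proof -
  define a where "a = 2 powr (1 / p0)"
  define b where "b = 2 powr (gam / p1)"
  have ab: "1 < a" "1 < b" using exponents gam_pos by (auto simp: a_def b_def)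
  define c where "c = 1 / min a b"
  have c01: "0 < c" "c < 1" using ab by (auto simp: c_def min_def)
  define \<theta> where "\<theta> = ln a / (ln a + ln b)"
  have ppos: "p > 0" by (rule p_pos)
  \<comment> \<open>With this value the \<open>p\<close>-th power of the crossing value carries the
    exponents \<open>1 - t\<close> and \<open>t\<close> on the two densities, so that
    \<open>powr_weighted_young\<close> applies to it.\<close>
  have th: "\<theta> = t * p1 / p"
  proof -
    have "ln a = ln 2 * (1 / p0)" "ln b = ln 2 * (gam / p1)" by (simp_all add: a_def b_def ln_powr)
    then have "\<theta> = (ln 2 * (1 / p0)) / (ln 2 * (1 / p0 + gam / p1))"
      unfolding \<theta>_def by (simp only: distrib_left)
    also have "\<dots> = (1 / p0) / (1 / p0 + gam / p1)"
      by (rule mult_divide_mult_cancel_left) simp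
    also have "1 / p0 + gam / p1 = p / (p0 * p1 * t)"
      unfolding gam_def exponents(5) using exponents(1-3) by (simp add: field_simps)
    also have "(1 / p0) / (p / (p0 * p1 * t)) = t * p1 / p"
      using exponents(1-3) ppos by simp
    finally show ?thesis .
  qed
  have th': "1 - \<theta> = (1 - t) * p0 / p"
  proof -
    have "1 - \<theta> = (p - t * p1) / p" using ppos by (simp add: th diff_divide_distrib)
    then show ?thesis by (simp add: exponents(5))
  qed
  define C1 where "C1 = 2 / (c * (1 - c))"
  have C1: "C1 > 0" using c01 by (simp add: C1_def)
  define C where "C = C1 powr p * 2 powr (1 - t)"
  have Cpos: "C > 0" using C1 by (simp add: C_def)
  show ?thesis
  proof (rule that[OF Cpos])
    fix d :: real and K :: "int set" and h :: "int \<Rightarrow> 'a \<Rightarrow> complex" and x and F0 F1 :: ennreal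
    assume d: "0 < d" and K: "finite K"
      and h0: "\<And>k. k \<in> K \<Longrightarrow> pdens p0 w0 (h k) x \<le> ennreal (2 powr (k + 1)) * F0"
      and h1: "\<And>k. k \<in> K \<Longrightarrow> pdens p1 w1 (h k) x \<le> ennreal (2 powr (- gam * k)) * F1"
    show "pdens p w (\<lambda>x. \<Sum>k\<in>K. h k x) x
        \<le> ennreal C * (ennreal d * F0 + ennreal (d powr (- gam)) * F1)"
    proof (cases "F0 = \<infinity> \<or> F1 = \<infinity>")
      case True
      then show ?thesis using Cpos d by (auto simp: ennreal_mult_eq_top_iff ennreal_mult_top)
    next
      case False
      then obtain u v where uv: "F0 = ennreal u" "F1 = ennreal v" "0 \<le> u" "0 \<le> v"
        by (metis ennreal_cases infinity_ennreal_def)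
      have pos: "w0 x > 0" "w1 x > 0" "w x > 0" using w_pos wp_pos by auto
      define y where "y = 2 * u / w0 x"
      define z where "z = v / w1 x"
      have yz: "0 \<le> y" "0 \<le> z" using uv pos by (auto simp: y_def z_def)
      define \<alpha> where "\<alpha> = y powr (1 / p0)"
      define \<beta> where "\<beta> = z powr (1 / p1)"
      have b0: "norm (h k x) \<le> a powr k * \<alpha>" if "k \<in> K" for k
      proof -
        have "norm (h k x) powr p0 * w0 x \<le> 2 powr (k + 1) * u"
          using h0[OF that] uv pos by (simp add: pdens_def ennreal_mult[symmetric])
        then have "norm (h k x) powr p0 \<le> 2 powr k * y"
          using pos by (simp add: y_def pos_le_divide_eq powr_add mult_ac)
        then have "(norm (h k x) powr p0) powr (1/p0) \<le> (2 powr k * y) powr (1/p0)"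
          using exponents(1) by (intro powr_mono2) auto
        moreover have "(norm (h k x) powr p0) powr (1/p0) = norm (h k x)"
          using exponents(1) by (simp add: powr_powr)
        moreover have "(2 powr k * y) powr (1/p0) = a powr k * \<alpha>"
          by (simp add: powr_mult powr_powr a_def \<alpha>_def)
        ultimately show ?thesis by simp
      qed
      have b1: "norm (h k x) \<le> b powr (- k) * \<beta>" if "k \<in> K" for k
      proof -
        have "norm (h k x) powr p1 * w1 x \<le> 2 powr (- gam * k) * v"
          using h1[OF that] uv pos by (simp add: pdens_def ennreal_mult[symmetric])
        then have "norm (h k x) powr p1 \<le> 2 powr (- gam * k) * z"
          using pos by (simp add: z_def pos_le_divide_eq)
        then have "(norm (h k x) powr p1) powr (1/p1) \<le> (2 powr (- gam * k) * z) powr (1/p1)"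
          using exponents(2) by (intro powr_mono2) auto
        moreover have "(norm (h k x) powr p1) powr (1/p1) = norm (h k x)"
          using exponents(2) by (simp add: powr_powr)
        moreover have "(2 powr (- gam * k) * z) powr (1/p1) = b powr (- k) * \<beta>"
          by (simp add: powr_mult powr_powr b_def \<beta>_def)
        ultimately show ?thesis by simp
      qed
      have "norm (\<Sum>k\<in>K. h k x) \<le> (\<Sum>k\<in>K. norm (h k x))" by (rule norm_sum)
      also have "\<dots> \<le> 2 / (c * (1 - c)) * (\<alpha> powr (1 - \<theta>) * \<beta> powr \<theta>)"
        by (rule sum_le_geometric_interpolation[OF ab K _ _ _ _ c_def \<theta>_def])
           (use b0 b1 in \<open>auto simp: \<alpha>_def \<beta>_def\<close>)
      finally have "norm (\<Sum>k\<in>K. h k x) powr p \<le> (C1 * (\<alpha> powr (1 - \<theta>) * \<beta> powr \<theta>)) powr p"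
        using ppos by (intro powr_mono2) (auto simp: C1_def)
      also have "\<dots> = C1 powr p * (y powr (1 - t) * z powr t)"
      proof -
        have "\<alpha> powr ((1 - \<theta>) * p) = y powr (1 - t)"
          using exponents(1) ppos by (simp add: \<alpha>_def powr_powr th')
        moreover have "\<beta> powr (\<theta> * p) = z powr t"
          using exponents(2) ppos by (simp add: \<beta>_def powr_powr th)
        ultimately show ?thesis
          using C1 by (simp add: powr_mult powr_powr)
      qed
      finally have "norm (\<Sum>k\<in>K. h k x) powr p * w x
          \<le> C1 powr p * (y powr (1 - t) * z powr t) * w x"
        using pos by (intro mult_right_mono) auto
      also have "\<dots> = C * (u powr (1 - t) * v powr t)"
        using pos uv by (simp add: C_def y_def z_def w_eq powr_mult powr_divide)
      also have "\<dots> \<le> C * (d * u + d powr (- ((1 - t) / t)) * v)"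
        using uv d exponents Cpos by (intro mult_left_mono powr_weighted_young) auto
      finally have "ennreal (norm (\<Sum>k\<in>K. h k x) powr p * w x)
          \<le> ennreal (C * (d * u + d powr (- gam) * v))"
        by (intro ennreal_leI) (simp add: gam_def)
      then show ?thesis
        using uv d Cpos by (simp add: pdens_def ennreal_mult)
    qed
  qed
qed

end

lemma pdens_nonneg_tendsto:
  assumes "0 < p" "(\<lambda>n. h n x) \<longlonglongrightarrow> g x"
  shows "(\<lambda>n. pdens p w (h n) x) \<longlonglongrightarrow> pdens p w g x"
  unfolding pdens_def
  by (intro tendsto_ennrealI tendsto_mult tendsto_const tendsto_powr2 tendsto_norm)
     (use assms in auto)

lemma two_powr_minus: "2 powr (- real k) = (1/2)^k"
proof -
  have "2 powr (- real k) = inverse (2 ^ k)" by (subst powr_minus, subst powr_realpow) auto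
  then show ?thesis by (simp add: power_one_over inverse_eq_divide)
qed

section \<open>The spaces defined by a Fatou norm and their completeness\<close>

context fatou_norm
begin

definition mspace :: "real \<Rightarrow> ('a \<Rightarrow> real) \<Rightarrow> ('a \<Rightarrow> complex) set" where
  "mspace q u = {f \<in> borel_measurable M. Phi (pdens q u f) < \<infinity>}"

lemma mspace_meas: "f \<in> mspace q u \<Longrightarrow> f \<in> borel_measurable M"
  by (simp add: mspace_def)

lemma Phi_pdens_add_le:
  assumes [measurable]: "f \<in> borel_measurable M" "g \<in> borel_measurable M" "u \<in> borel_measurable M"
    and "0 < q" "\<And>x. 0 < u x"
  shows "Phi (pdens q u (\<lambda>x. f x + g x)) \<le> ennreal (2 powr q) * (Phi (pdens q u f) + Phi (pdens q u g))"
proof -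
  have "Phi (pdens q u (\<lambda>x. f x + g x)) \<le> Phi (\<lambda>x. ennreal (2 powr q) * (pdens q u f x + pdens q u g x))"
    using assms by (intro Phi_mono AE_I2 pdens_add_le) (auto intro: less_imp_le)
  also have "\<dots> = ennreal (2 powr q) * Phi (\<lambda>x. pdens q u f x + pdens q u g x)"
    by (rule Phi_cmult) measurable
  also have "\<dots> \<le> ennreal (2 powr q) * (Phi (pdens q u f) + Phi (pdens q u g))"
    by (intro mult_left_mono Phi_add) auto
  finally show ?thesis .
qed

lemma Phi_pdens_minus: "Phi (pdens q u (\<lambda>x. - f x)) = Phi (pdens q u f)"
  by (simp add: pdens_def[abs_def])

lemma Phi_pdens_diff_le:
  assumes [measurable]: "f \<in> borel_measurable M" "g \<in> borel_measurable M" "u \<in> borel_measurable M"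
    and "0 < q" "\<And>x. 0 < u x"
  shows "Phi (pdens q u (\<lambda>x. f x - g x)) \<le> ennreal (2 powr q) * (Phi (pdens q u f) + Phi (pdens q u g))"
  using Phi_pdens_add_le[of f "\<lambda>x. - g x" u q] assms by (simp add: Phi_pdens_minus)

lemma Phi_pdens_cong:
  assumes [measurable]: "f \<in> borel_measurable M" "g \<in> borel_measurable M" "u \<in> borel_measurable M"
    and "AE x in M. f x = g x"
  shows "Phi (pdens q u f) = Phi (pdens q u g)"
  by (intro antisym Phi_mono) (use assms in \<open>auto simp: pdens_def elim!: eventually_mono\<close>)

text \<open>The Riesz-Fischer argument: a rapidly Cauchy subsequence converges almost everywhere,
  and the Fatou property turns the Cauchy bounds into bounds for the distance to the limit.\<close>

lemma mspace_complete:
  assumes q: "0 < q" and u [measurable]: "u \<in> borel_measurable M" "\<And>x. 0 < u x"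
    and s: "\<And>n::nat. s n \<in> mspace q u"
    and cauchy: "\<And>e::real. 0 < e \<Longrightarrow> \<exists>N. \<forall>m\<ge>N. \<forall>n\<ge>N. Phi (pdens q u (\<lambda>x. s m x - s n x)) \<le> ennreal e"
  shows "\<exists>g\<in>mspace q u. (\<lambda>n. Phi (pdens q u (\<lambda>x. s n x - g x))) \<longlonglongrightarrow> 0"
proof -
  have sm [measurable]: "s n \<in> borel_measurable M" for n using s by (simp add: mspace_def)
  \<comment> \<open>One factor \<open>2 powr (- k)\<close> makes the sum of the \<open>F k\<close>
    finite. The other, \<open>2 powr (- q * k)\<close>, is passed to \<open>F k\<close> and becomes
    the pointwise decay \<open>2 powr (- k)\<close> of the differences after the \<open>q\<close>-th
    root.\<close>
  define e where "e k = 2 powr (- (q + 1) * real k)" for k :: nat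
  have epos: "0 < e k" for k by (simp add: e_def)
  obtain r :: "nat \<Rightarrow> nat" where
    r: "\<And>k. \<forall>m\<ge>r k. \<forall>n\<ge>r k. Phi (pdens q u (\<lambda>x. s m x - s n x)) \<le> ennreal (e k)" and
    rS: "\<And>k. r k < r (Suc k)"
  proof -
    have "\<exists>f. \<forall>k. (\<forall>m\<ge>f k. \<forall>n\<ge>f k. Phi (pdens q u (\<lambda>x. s m x - s n x)) \<le> ennreal (e k)) \<and> f k < f (Suc k)"
    proof (rule dependent_nat_choice)
      show "\<exists>x. \<forall>m\<ge>x. \<forall>n\<ge>x. Phi (pdens q u (\<lambda>x. s m x - s n x)) \<le> ennreal (e 0)"
        using cauchy[OF epos] by blast
      fix x k
      obtain N where N: "\<forall>m\<ge>N. \<forall>n\<ge>N. Phi (pdens q u (\<lambda>x. s m x - s n x)) \<le> ennreal (e (Suc k))"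
        using cauchy[OF epos] by blast
      show "\<exists>y. (\<forall>m\<ge>y. \<forall>n\<ge>y. Phi (pdens q u (\<lambda>x. s m x - s n x)) \<le> ennreal (e (Suc k))) \<and> x < y"
        by (rule exI[of _ "max N (Suc x)"]) (use N in auto)
    qed
    then show ?thesis using that by blast
  qed
  have rmono: "strict_mono r" using rS by (simp add: strict_mono_Suc_iff)
  define d where "d k x = s (r (Suc k)) x - s (r k) x" for k x
  have [measurable]: "d k \<in> borel_measurable M" for k unfolding d_def by measurable
  define F where "F k x = ennreal (2 powr (q * real k)) * pdens q u (d k) x" for k x
  have [measurable]: "F k \<in> borel_measurable M" for k unfolding F_def by measurable
  have F: "Phi (F k) \<le> ennreal ((1/2)^k)" for k
  proof -
    have "Phi (F k) = ennreal (2 powr (q * real k)) * Phi (pdens q u (d k))"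
      unfolding F_def by (rule Phi_cmult) measurable
    also have "\<dots> \<le> ennreal (2 powr (q * real k)) * ennreal (e k)"
      unfolding d_def by (intro mult_left_mono r[rule_format]) (auto intro: less_imp_le rS)
    also have "\<dots> = ennreal (2 powr (- real k))"
    proof -
      have "2 powr (q * real k) * e k = 2 powr (- real k)"
        unfolding e_def powr_add[symmetric] by (simp add: algebra_simps)
      then show ?thesis by (simp add: ennreal_mult[symmetric] e_def)
    qed
    also have "2 powr (- real k) = (1/2)^k"
      by (rule two_powr_minus)
    finally show ?thesis .
  qed
  have part: "Phi (\<lambda>x. \<Sum>k<N. F k x) \<le> 2" for N
  proof -
    have "Phi (\<lambda>x. \<Sum>k<N. F k x) \<le> (\<Sum>k<N. Phi (F k))" by (rule Phi_sum) auto
    also have "\<dots> \<le> (\<Sum>k<N. ennreal ((1/2)^k))" by (intro sum_mono F)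
    also have "\<dots> = ennreal (\<Sum>k<N. (1/2)^k)" by (rule sum_ennreal) simp
    also have "(\<Sum>k<N. (1/2::real)^k) \<le> 2" by (subst sum_gp_strict) (simp add: field_simps)
    finally show ?thesis by (simp add: ennreal_leI)
  qed
  have "Phi (\<lambda>x. \<Sum>k. F k x) \<le> 2"
    by (rule Phi_limit_le[where F="\<lambda>N x. \<Sum>k<N. F k x"])
       (auto intro!: part summable_LIMSEQ)
  then have "Phi (\<lambda>x. \<Sum>k. F k x) < \<infinity>"
    by (rule le_less_trans) (simp add: ennreal_numeral_less_top[unfolded top_ennreal.abs_eq])
  then have "AE x in M. (\<Sum>k. F k x) < \<infinity>" by (intro Phi_finite_AE) auto
  then have conv: "AE x in M. (\<lambda>k. s (r k) x) \<longlonglongrightarrow> lim (\<lambda>k. s (r k) x)"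
  proof eventually_elim
    case (elim x)
    obtain c where c: "(\<Sum>k. F k x) = ennreal c" "0 \<le> c"
      using elim by (cases "\<Sum>k. F k x") auto
    have bound: "norm (d k x) \<le> (c / u x) powr (1/q) * (1/2)^k" for k
    proof -
      have "F k x \<le> ennreal c" unfolding c(1)[symmetric]
        using sum_le_suminf[of "\<lambda>k. F k x" "{k}"] by simp
      then have "2 powr (q * real k) * (norm (d k x) powr q * u x) \<le> c"
        using c u(2)[of x] by (simp add: F_def pdens_def ennreal_mult[symmetric])
      then have "norm (d k x) powr q \<le> (c / u x) * 2 powr (- (q * real k))"
        using u(2)[of x] by (simp add: powr_minus field_simps)
      then have "(norm (d k x) powr q) powr (1/q) \<le> ((c / u x) * 2 powr (- (q * real k))) powr (1/q)"
        using q by (intro powr_mono2) auto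
      moreover have "(norm (d k x) powr q) powr (1/q) = norm (d k x)"
        using q by (simp add: powr_powr)
      moreover have "((c / u x) * 2 powr (- (q * real k))) powr (1/q)
          = (c / u x) powr (1/q) * 2 powr (- real k)"
        using q by (simp only: powr_mult powr_powr) simp
      moreover have "2 powr (- real k) = (1/2)^k"
        by (rule two_powr_minus)
      ultimately show ?thesis by simp
    qed
    have "summable (\<lambda>k. d k x)"
    proof (rule summable_comparison_test)
      show "\<exists>N. \<forall>k\<ge>N. norm (d k x) \<le> (c / u x) powr (1/q) * (1/2)^k" using bound by blast
    qed (auto intro!: summable_mult summable_geometric)
    then have "convergent (\<lambda>n. \<Sum>k<n. d k x)" by (simp add: summable_iff_convergent)
    moreover have "(\<Sum>k<n. d k x) = s (r n) x - s (r 0) x" for n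
      unfolding d_def by (rule sum_lessThan_telescope)
    ultimately have "convergent (\<lambda>n. s (r n) x - s (r 0) x + s (r 0) x)"
      by (intro convergent_add convergent_const) simp
    then show ?case by (simp add: convergent_LIMSEQ_iff)
  qed
  define g where "g x = lim (\<lambda>k. s (r k) x)" for x
  have gm [measurable]: "g \<in> borel_measurable M" unfolding g_def by measurable
  have tail: "Phi (pdens q u (\<lambda>x. s n x - g x)) \<le> ennreal e"
    if N: "\<forall>m\<ge>N. \<forall>n\<ge>N. Phi (pdens q u (\<lambda>x. s m x - s n x)) \<le> ennreal e" and n: "n \<ge> N" for N n e
  proof (rule Phi_limit_le[where F="\<lambda>k. pdens q u (\<lambda>x. s n x - s (r (k + N)) x)"])
    show "AE x in M. (\<lambda>k. pdens q u (\<lambda>x. s n x - s (r (k + N)) x) x) \<longlonglongrightarrow> pdens q u (\<lambda>x. s n x - g x) x"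
      using conv
    proof eventually_elim
      case (elim x)
      then have "(\<lambda>k. s (r (k + N)) x) \<longlonglongrightarrow> g x" unfolding g_def by (rule LIMSEQ_ignore_initial_segment)
      then show ?case by (intro pdens_nonneg_tendsto[OF q] tendsto_diff tendsto_const)
    qed
    fix k
    have "N \<le> r (k + N)" using seq_suble[OF rmono, of "k + N"] by linarith
    then show "Phi (pdens q u (\<lambda>x. s n x - s (r (k + N)) x)) \<le> ennreal e" using N n by blast
  qed measurable
  have lim: "(\<lambda>n. Phi (pdens q u (\<lambda>x. s n x - g x))) \<longlonglongrightarrow> 0"
  proof (rule order_tendstoI)
    fix a :: ennreal assume "0 < a"
    then obtain e where e: "0 < e" "ennreal e < a"
      using dense[of 0 a] by (metis ennreal_cases ennreal_less_zero_iff less_top_ennreal not_less_iff_gr_or_eq order.strict_trans)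
    obtain N where "\<forall>m\<ge>N. \<forall>n\<ge>N. Phi (pdens q u (\<lambda>x. s m x - s n x)) \<le> ennreal e"
      using cauchy[OF e(1)] by blast
    from tail[OF this] e(2) show "\<forall>\<^sub>F n in sequentially. Phi (pdens q u (\<lambda>x. s n x - g x)) < a"
      unfolding eventually_sequentially by (meson le_less_trans)
  qed simp
  obtain N where N: "\<forall>m\<ge>N. \<forall>n\<ge>N. Phi (pdens q u (\<lambda>x. s m x - s n x)) \<le> ennreal 1"
    using cauchy[of 1] by auto
  have "Phi (pdens q u (\<lambda>x. s N x - (s N x - g x)))
      \<le> ennreal (2 powr q) * (Phi (pdens q u (s N)) + Phi (pdens q u (\<lambda>x. s N x - g x)))"
    using q u by (intro Phi_pdens_diff_le) auto
  also have "\<dots> < \<infinity>"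
    using s[of N] tail[OF N, of N] le_less_trans[of _ 1 "\<infinity>::ennreal"]
    by (auto simp: mspace_def ennreal_mult_less_top ennreal_add_less_top)
  finally have "g \<in> mspace q u" by (simp add: mspace_def)
  with lim show ?thesis by blast
qed

end

section \<open>Interpolation of one-sided compactness\<close>

text \<open>Boundedness is assumed at index 0 and compactness at index 1, the latter for sequences
  bounded in \<open>Phi\<close>; boundedness at index 1 follows in \<open>T_bound1\<close>. Since
  \<open>V\<close> also contains the space of index \<open>p\<close>, \<open>T\<close> is defined on
  cuts to infinitely many levels.\<close>

locale compact_interpolation = interpolation_couple +
  fixes V :: "('a \<Rightarrow> complex) set" and T :: "('a \<Rightarrow> complex) \<Rightarrow> 'a \<Rightarrow> complex" and C0 :: real
  assumes V_sub: "mspace p0 w0 \<subseteq> V" "mspace p1 w1 \<subseteq> V" "mspace p w \<subseteq> V"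
    and V_add: "\<And>f g. \<lbrakk>f \<in> V; g \<in> V\<rbrakk> \<Longrightarrow> (\<lambda>x. f x + g x) \<in> V"
    and V_scale: "\<And>c f. f \<in> V \<Longrightarrow> (\<lambda>x. c * f x) \<in> V"
    and T_meas: "\<And>f. f \<in> V \<Longrightarrow> T f \<in> borel_measurable M"
    and T_add: "\<And>f g. \<lbrakk>f \<in> V; g \<in> V\<rbrakk> \<Longrightarrow> AE x in M. T (\<lambda>y. f y + g y) x = T f x + T g x"
    and T_scale: "\<And>c f. f \<in> V \<Longrightarrow> AE x in M. T (\<lambda>y. c * f y) x = c * T f x"
    and T_space1: "\<And>f. f \<in> mspace p1 w1 \<Longrightarrow> T f \<in> mspace p1 w1"
    and C0: "0 \<le> C0"
    and T_bound0: "\<And>f. f \<in> mspace p0 w0 \<Longrightarrow> Phi (pdens p0 w0 (T f)) \<le> ennreal C0 * Phi (pdens p0 w0 f)"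
    and T_compact1: "\<And>s C. \<lbrakk>\<And>n::nat. s n \<in> mspace p1 w1; \<And>n. Phi (pdens p1 w1 (s n)) \<le> ennreal C\<rbrakk>
      \<Longrightarrow> \<exists>g\<in>mspace p1 w1. \<exists>r :: nat \<Rightarrow> nat. strict_mono r \<and>
            (\<lambda>n. Phi (pdens p1 w1 (\<lambda>x. T (s (r n)) x - g x))) \<longlonglongrightarrow> 0"
begin

lemma T_space0: "f \<in> mspace p0 w0 \<Longrightarrow> T f \<in> mspace p0 w0"
  using T_bound0[of f] T_meas[of f] V_sub
  by (auto simp: mspace_def ennreal_mult_less_top intro: le_less_trans)

lemma T_sum:
  assumes "finite K" "\<And>k. k \<in> K \<Longrightarrow> f k \<in> V" "K \<noteq> {}"
  shows "(\<lambda>x. \<Sum>k\<in>K. c k * f k x) \<in> V \<and>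
    (AE x in M. T (\<lambda>x. \<Sum>k\<in>K. c k * f k x) x = (\<Sum>k\<in>K. c k * T (f k) x))"
  using assms(1,3,2)
proof (induction K rule: finite_ne_induct)
  case (singleton k)
  then show ?case using V_scale T_scale by auto
next
  case (insert k K)
  have IH: "(\<lambda>x. \<Sum>k\<in>K. c k * f k x) \<in> V"
    "AE x in M. T (\<lambda>x. \<Sum>k\<in>K. c k * f k x) x = (\<Sum>k\<in>K. c k * T (f k) x)"
    using insert by auto
  have k: "(\<lambda>x. c k * f k x) \<in> V" "f k \<in> V" using insert by (auto intro: V_scale)
  have eq: "(\<lambda>x. \<Sum>k\<in>insert k K. c k * f k x) = (\<lambda>x. c k * f k x + (\<Sum>k\<in>K. c k * f k x))"
    using insert by simp
  have "AE x in M. T (\<lambda>x. \<Sum>k\<in>insert k K. c k * f k x) x = (\<Sum>k\<in>insert k K. c k * T (f k) x)"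
    unfolding eq using T_add[OF k(1) IH(1)] T_scale[OF k(2), of "c k"] IH(2)
    by eventually_elim (use insert in auto)
  then show ?case unfolding eq using V_add[OF k(1) IH(1)] by simp
qed

definition piece :: "('a \<Rightarrow> complex) \<Rightarrow> int \<Rightarrow> 'a \<Rightarrow> complex" where
  "piece f k = lmult (\<lambda>j. if j = k then 1 else 0) f"

definition cut :: "int set \<Rightarrow> ('a \<Rightarrow> complex) \<Rightarrow> 'a \<Rightarrow> complex" where
  "cut S f = lmult (indicator S) f"

definition unit_ball :: "('a \<Rightarrow> complex) set" where
  "unit_ball = {f \<in> borel_measurable M. Phi (pdens p w f) \<le> 1}"

lemma unit_ball_meas: "f \<in> unit_ball \<Longrightarrow> f \<in> borel_measurable M"
  by (simp add: unit_ball_def)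

lemma lmult_space0:
  fixes c :: "int \<Rightarrow> real"
  assumes "f \<in> unit_ball" "\<And>k. \<bar>c k\<bar> powr p0 * 2 powr (k + 1) \<le> D"
  shows "lmult c f \<in> mspace p0 w0" "Phi (pdens p0 w0 (lmult c f)) \<le> ennreal D"
proof -
  have [measurable]: "f \<in> borel_measurable M" using assms by (simp add: unit_ball_def)
  have "Phi (pdens p0 w0 (lmult c f)) \<le> Phi (\<lambda>x. ennreal D * pdens p w f x)"
    by (intro Phi_mono AE_I2 lmult_le0 assms) measurable
  also have "\<dots> = ennreal D * Phi (pdens p w f)" by (rule Phi_cmult) measurable
  also have "\<dots> \<le> ennreal D * 1"
    using assms by (intro mult_left_mono) (auto simp: unit_ball_def)
  finally show *: "Phi (pdens p0 w0 (lmult c f)) \<le> ennreal D" by simp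
  then show "lmult c f \<in> mspace p0 w0" by (auto simp: mspace_def intro: le_less_trans)
qed

lemma lmult_space1:
  fixes c :: "int \<Rightarrow> real"
  assumes "f \<in> unit_ball" "\<And>k. \<bar>c k\<bar> powr p1 * 2 powr (- gam * k) \<le> D"
  shows "lmult c f \<in> mspace p1 w1" "Phi (pdens p1 w1 (lmult c f)) \<le> ennreal D"
proof -
  have [measurable]: "f \<in> borel_measurable M" using assms by (simp add: unit_ball_def)
  have "Phi (pdens p1 w1 (lmult c f)) \<le> Phi (\<lambda>x. ennreal D * pdens p w f x)"
    by (intro Phi_mono AE_I2 lmult_le1 assms) measurable
  also have "\<dots> = ennreal D * Phi (pdens p w f)" by (rule Phi_cmult) measurable
  also have "\<dots> \<le> ennreal D * 1"
    using assms by (intro mult_left_mono) (auto simp: unit_ball_def)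
  finally show *: "Phi (pdens p1 w1 (lmult c f)) \<le> ennreal D" by simp
  then show "lmult c f \<in> mspace p1 w1" by (auto simp: mspace_def intro: le_less_trans)
qed

lemma lmult_finite_space:
  assumes f: "f \<in> unit_ball" and K: "finite K" "\<And>k. k \<notin> K \<Longrightarrow> c k = 0"
  shows "lmult c f \<in> mspace p0 w0 \<inter> mspace p1 w1"
proof -
  have "\<bar>c k\<bar> powr p0 * 2 powr (k + 1) \<le> (\<Sum>k\<in>K. \<bar>c k\<bar> powr p0 * 2 powr (k + 1))" for k
    using K by (cases "k \<in> K") (auto intro!: member_le_sum sum_nonneg)
  moreover have "\<bar>c k\<bar> powr p1 * 2 powr (- gam * k) \<le> (\<Sum>k\<in>K. \<bar>c k\<bar> powr p1 * 2 powr (- gam * k))" for k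
    using K by (cases "k \<in> K") (auto intro!: member_le_sum sum_nonneg)
  ultimately show ?thesis using lmult_space0(1)[OF f] lmult_space1(1)[OF f] by blast
qed

lemma piece_space: "f \<in> unit_ball \<Longrightarrow> piece f k \<in> mspace p0 w0 \<inter> mspace p1 w1"
  unfolding piece_def by (rule lmult_finite_space[where K="{k}"]) auto

lemma piece_V: "f \<in> unit_ball \<Longrightarrow> piece f k \<in> V"
  using piece_space V_sub by blast

lemma lmult_eq_sum:
  assumes K: "finite K" "\<And>k. k \<notin> K \<Longrightarrow> c k = 0"
  shows "lmult c f = (\<lambda>x. \<Sum>k\<in>K. complex_of_real (c k) * piece f k x)"
proof
  fix x
  have "(\<Sum>k\<in>K. complex_of_real (c k) * piece f k x)
      = (\<Sum>k\<in>K. if k = lev f x then complex_of_real (c k) * f x else 0)"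
    by (intro sum.cong) (auto simp: piece_def lmult_def)
  also have "\<dots> = lmult c f x"
    using K by (auto simp: sum.delta lmult_def)
  finally show "lmult c f x = (\<Sum>k\<in>K. complex_of_real (c k) * piece f k x)" ..
qed

lemma T_lmult:
  assumes f: "f \<in> unit_ball" and K: "finite K" "K \<noteq> {}" "\<And>k. k \<notin> K \<Longrightarrow> c k = 0"
  shows "AE x in M. T (lmult c f) x = (\<Sum>k\<in>K. complex_of_real (c k) * T (piece f k) x)"
proof -
  have "lmult c f = (\<lambda>x. \<Sum>k\<in>K. complex_of_real (c k) * piece f k x)"
    using K by (intro lmult_eq_sum) auto
  then show ?thesis
    using T_sum[where f="piece f" and c="\<lambda>k. complex_of_real (c k)", OF K(1) piece_V[OF f] K(2)] by simp
qed

text \<open>A choice of signs is the set \<open>S\<close> of levels with sign plus, so the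
  expectation over signs is a finite average over \<open>Pow K\<close>. The factor \<open>e\<close>
  normalises the levels.\<close>

definition scoef :: "int set \<Rightarrow> int set \<Rightarrow> (int \<Rightarrow> real) \<Rightarrow> int \<Rightarrow> real" where
  "scoef K S e k = (if k \<in> K then (if k \<in> S then 1 else -1) * e k else 0)"

lemma T_scoef_meas [measurable]:
  assumes "f \<in> unit_ball" "finite K"
  shows "T (lmult (scoef K S e) f) \<in> borel_measurable M"
proof -
  have "lmult (scoef K S e) f \<in> mspace p0 w0 \<inter> mspace p1 w1"
    by (rule lmult_finite_space[OF assms]) (simp add: scoef_def)
  then show ?thesis using V_sub T_meas by blast
qed

text \<open>By \<open>sum_signs_powr\<close> a single term is at most twice the average of the
  signed sums, whichever term it is; hence one function dominates all levels simultaneously. The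
  expansion of \<open>T\<close> over the pieces holds almost everywhere for each of the finitely
  many choices of signs.\<close>

lemma sign_average:
  assumes f: "f \<in> unit_ball" and K: "finite K" "K \<noteq> {}" and e: "\<And>k. 0 < e k"
    and q: "0 < q" and u: "\<And>x. 0 < u x"
  defines "A \<equiv> \<lambda>x. ennreal (2 / 2 ^ card K) * (\<Sum>S\<in>Pow K. pdens q u (T (lmult (scoef K S e) f)) x)"
  shows "AE x in M. \<forall>k\<in>K. pdens q u (T (piece f k)) x \<le> ennreal (e k powr (- q)) * A x"
proof -
  have "AE x in M. \<forall>S\<in>Pow K. T (lmult (scoef K S e) f) x
      = (\<Sum>k\<in>K. complex_of_real (scoef K S e k) * T (piece f k) x)"
  proof (rule AE_finite_allI)
    show "finite (Pow K)" using K by simp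
    show "AE x in M. T (lmult (scoef K S e) f) x
      = (\<Sum>k\<in>K. complex_of_real (scoef K S e k) * T (piece f k) x)" for S
      by (rule T_lmult[OF f K]) (simp add: scoef_def)
  qed
  then show ?thesis
  proof eventually_elim
    case (elim x)
    show ?case
    proof
      fix j assume j: "j \<in> K"
      define a where "a k = complex_of_real (e k) * T (piece f k) x" for k
      have eq: "T (lmult (scoef K S e) f) x = (\<Sum>k\<in>K. (if k \<in> S then 1 else -1) * a k)"
        if "S \<in> Pow K" for S
        using elim that by (auto simp: scoef_def a_def intro!: sum.cong)
      have sg: "2 ^ card K * norm (a j) powr q
          \<le> 2 * (\<Sum>S\<in>Pow K. norm (T (lmult (scoef K S e) f) x) powr q)"
        using sum_signs_powr[OF K(1) j q, of a] eq by simp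
      define Z where "Z = (\<Sum>S\<in>Pow K. norm (T (lmult (scoef K S e) f) x) powr q * u x)"
      have Z0: "0 \<le> Z" unfolding Z_def using u[of x] by (intro sum_nonneg) auto
      have "2 ^ card K * norm (a j) powr q * u x
          \<le> 2 * (\<Sum>S\<in>Pow K. norm (T (lmult (scoef K S e) f) x) powr q) * u x"
        using sg u[of x] by (intro mult_right_mono) auto
      also have "\<dots> = 2 * Z" by (simp add: Z_def sum_distrib_right mult.assoc)
      finally have "norm (a j) powr q * u x \<le> 2 / 2 ^ card K * Z"
        by (simp add: field_simps)
      moreover have "norm (a j) powr q = e j powr q * norm (T (piece f j) x) powr q"
        using e[of j] by (simp add: a_def norm_mult powr_mult)
      ultimately have "norm (T (piece f j) x) powr q * u x \<le> e j powr (- q) * (2 / 2 ^ card K * Z)"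
        using e[of j] by (simp add: powr_minus field_simps)
      then have "pdens q u (T (piece f j)) x \<le> ennreal (e j powr (- q) * (2 / 2 ^ card K * Z))"
        unfolding pdens_def by (rule ennreal_leI)
      also have "\<dots> = ennreal (e j powr (- q)) * (ennreal (2 / 2 ^ card K) * ennreal Z)"
        using Z0 by (subst ennreal_mult, simp, simp)+ simp
      also have "ennreal Z = (\<Sum>S\<in>Pow K. pdens q u (T (lmult (scoef K S e) f)) x)"
        unfolding Z_def pdens_def using u[of x] by (intro sum_ennreal[symmetric]) auto
      finally show "pdens q u (T (piece f j)) x \<le> ennreal (e j powr (- q)) * A x"
        by (simp add: A_def)
    qed
  qed
qed

text \<open>The normalisation cancels the number of sign patterns up to a factor 2, so the bound is
  independent of \<open>K\<close>.\<close>

lemma Phi_average_le: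
  assumes K: "finite K" and F: "\<And>S. S \<in> Pow K \<Longrightarrow> F S \<in> borel_measurable M"
    "\<And>S. S \<in> Pow K \<Longrightarrow> Phi (F S) \<le> B"
  shows "Phi (\<lambda>x. ennreal (2 / 2 ^ card K) * (\<Sum>S\<in>Pow K. F S x)) \<le> 2 * B"
proof -
  have "Phi (\<lambda>x. ennreal (2 / 2 ^ card K) * (\<Sum>S\<in>Pow K. F S x))
      = ennreal (2 / 2 ^ card K) * Phi (\<lambda>x. \<Sum>S\<in>Pow K. F S x)"
    using F by (intro Phi_cmult) auto
  also have "\<dots> \<le> ennreal (2 / 2 ^ card K) * (\<Sum>S\<in>Pow K. B)"
    using K F by (intro mult_left_mono order_trans[OF Phi_sum] sum_mono) auto
  also have "\<dots> = (ennreal (2 / 2 ^ card K) * of_nat (2 ^ card K)) * B"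
    using K by (simp add: card_Pow mult.assoc)
  also have "ennreal (2 / 2 ^ card K) * of_nat (2 ^ card K) = 2"
    by (simp add: ennreal_of_nat_eq_real_of_nat ennreal_mult[symmetric])
  finally show ?thesis .
qed

end

section \<open>Consequences of compactness at index 1\<close>

context compact_interpolation
begin

text \<open>If the images of the unit ball were unbounded, some sequence of images would have masses
  exceeding \<open>n\<close>. A convergent subsequence contradicts this, as its masses are
  eventually bounded by the mass of the limit and the quasi-triangle inequality.\<close>

lemma T_bound1:
  obtains C1 :: real where "0 \<le> C1"
    "\<And>f. \<lbrakk>f \<in> mspace p1 w1; Phi (pdens p1 w1 f) \<le> 1\<rbrakk> \<Longrightarrow> Phi (pdens p1 w1 (T f)) \<le> ennreal C1"
proof -
  have "\<exists>C1::nat. \<forall>f\<in>mspace p1 w1. Phi (pdens p1 w1 f) \<le> 1 \<longrightarrow> Phi (pdens p1 w1 (T f)) \<le> ennreal (real C1)"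
  proof (rule ccontr)
    assume "\<not> ?thesis"
    then have "\<forall>n::nat. \<exists>f\<in>mspace p1 w1. Phi (pdens p1 w1 f) \<le> 1 \<and> Phi (pdens p1 w1 (T f)) > ennreal (real n)"
      by (auto simp: not_le)
    then obtain s where s: "\<And>n::nat. s n \<in> mspace p1 w1" "\<And>n. Phi (pdens p1 w1 (s n)) \<le> 1"
      "\<And>n. Phi (pdens p1 w1 (T (s n))) > ennreal (real n)" by metis
    obtain g r where g: "g \<in> mspace p1 w1" and r: "strict_mono (r :: nat \<Rightarrow> nat)"
      and lim: "(\<lambda>n. Phi (pdens p1 w1 (\<lambda>x. T (s (r n)) x - g x))) \<longlonglongrightarrow> 0"
      using T_compact1[of s 1] s by auto
    have [measurable]: "g \<in> borel_measurable M" "T (s n) \<in> borel_measurable M" for n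
      using g s(1) T_meas V_sub by (auto simp: mspace_def)
    obtain G where G: "Phi (pdens p1 w1 g) = ennreal G" "0 \<le> G"
      using g by (cases "Phi (pdens p1 w1 g)") (auto simp: mspace_def)
    obtain N where N: "\<And>n. n \<ge> N \<Longrightarrow> Phi (pdens p1 w1 (\<lambda>x. T (s (r n)) x - g x)) < 1"
      using order_tendstoD(2)[OF lim, of 1] by (auto simp: eventually_sequentially)
    define B where "B = 2 powr p1 * (1 + G)"
    have B0: "0 \<le> B" using G by (simp add: B_def)
    define n where "n = max N (nat \<lceil>B\<rceil>)"
    have "ennreal (real (r n)) < Phi (pdens p1 w1 (\<lambda>x. (T (s (r n)) x - g x) + g x))"
      using s(3) by simp
    also have "\<dots> \<le> ennreal (2 powr p1) * (Phi (pdens p1 w1 (\<lambda>x. T (s (r n)) x - g x)) + Phi (pdens p1 w1 g))"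
      using exponents w_pos by (intro Phi_pdens_add_le) auto
    also have "\<dots> \<le> ennreal (2 powr p1) * (1 + ennreal G)"
      using N[of n] unfolding G by (intro mult_left_mono add_mono) (auto simp: n_def)
    also have "\<dots> = ennreal B"
      using G by (simp add: B_def ennreal_mult flip: ennreal_1)
    finally have "real (r n) < B" using B0 by (simp add: ennreal_less_iff)
    moreover have "real n \<ge> B" by (simp add: n_def) linarith
    moreover have "r n \<ge> n" by (rule seq_suble[OF r])
    ultimately show False by linarith
  qed
  then obtain C1 :: nat where "\<forall>f\<in>mspace p1 w1. Phi (pdens p1 w1 f) \<le> 1 \<longrightarrow> Phi (pdens p1 w1 (T f)) \<le> ennreal (real C1)"
    by blast
  then show ?thesis using that[of "real C1"] by auto
qed

lemma T_bound1_scaled: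
  obtains C1 :: real where "0 \<le> C1"
    "\<And>f a. \<lbrakk>f \<in> mspace p1 w1; 0 < a; Phi (pdens p1 w1 f) \<le> ennreal a\<rbrakk>
       \<Longrightarrow> Phi (pdens p1 w1 (T f)) \<le> ennreal (a * C1)"
proof -
  obtain C1 :: real where C1: "0 \<le> C1"
    "\<And>f. \<lbrakk>f \<in> mspace p1 w1; Phi (pdens p1 w1 f) \<le> 1\<rbrakk> \<Longrightarrow> Phi (pdens p1 w1 (T f)) \<le> ennreal C1"
    by (rule T_bound1) blast
  show ?thesis
  proof (rule that[OF C1(1)])
    fix f and a :: real
    assume f: "f \<in> mspace p1 w1" and a: "0 < a" and le: "Phi (pdens p1 w1 f) \<le> ennreal a"
    have [measurable]: "f \<in> borel_measurable M" using f by (rule mspace_meas)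
    define c where "c = a powr (- (1 / p1))"
    have c: "c > 0" "c powr p1 = 1 / a"
      using a exponents(2) unfolding c_def powr_powr by (auto simp: powr_minus_divide)
    define h where "h = (\<lambda>x. complex_of_real c * f x)"
    have Ph: "Phi (pdens p1 w1 h) = ennreal (1 / a) * Phi (pdens p1 w1 f)"
    proof -
      have "pdens p1 w1 h = (\<lambda>x. ennreal (1 / a) * pdens p1 w1 f x)"
        unfolding h_def using c w_pos by (intro ext, subst pdens_cmult) (auto intro: less_imp_le)
      then show ?thesis by (simp add: Phi_cmult)
    qed
    also have "\<dots> \<le> ennreal (1 / a) * ennreal a" by (intro mult_left_mono le) auto
    also have "\<dots> = 1" using a by (simp add: ennreal_mult[symmetric])
    finally have h1: "Phi (pdens p1 w1 h) \<le> 1" .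
    have [measurable]: "h \<in> borel_measurable M" unfolding h_def by measurable
    have h: "h \<in> mspace p1 w1" using h1 by (auto simp: mspace_def intro: le_less_trans)
    have fV: "f \<in> V" "h \<in> V" using f h V_sub by auto
    have [measurable]: "T f \<in> borel_measurable M" "T h \<in> borel_measurable M" using fV T_meas by auto
    have "AE x in M. pdens p1 w1 (T f) x \<le> ennreal a * pdens p1 w1 (T h) x"
      using T_scale[OF fV(1), of "complex_of_real c"]
    proof eventually_elim
      case (elim x)
      then have "T h x = complex_of_real c * T f x" by (simp add: h_def)
      then have "pdens p1 w1 (T h) x = ennreal (1 / a) * pdens p1 w1 (T f) x"
        using c pdens_cmult[of w1 x p1 "complex_of_real c" "T f"] w_pos[of x] by (simp add: pdens_def)
      then have "ennreal a * pdens p1 w1 (T h) x = (ennreal a * ennreal (1 / a)) * pdens p1 w1 (T f) x"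
        by (simp add: mult.assoc)
      then show ?case using a by (simp add: ennreal_mult[symmetric])
    qed
    then have "Phi (pdens p1 w1 (T f)) \<le> Phi (\<lambda>x. ennreal a * pdens p1 w1 (T h) x)"
      by (intro Phi_mono) auto
    also have "\<dots> = ennreal a * Phi (pdens p1 w1 (T h))" by (rule Phi_cmult) measurable
    also have "\<dots> \<le> ennreal a * ennreal C1" by (intro mult_left_mono C1 h h1) auto
    finally show "Phi (pdens p1 w1 (T f)) \<le> ennreal (a * C1)"
      using a C1 by (simp add: ennreal_mult)
  qed
qed

text \<open>By compactness a sequence of images converges in the norm of index \<open>1\<close>; the limit vanishes
  because the images tend to \<open>0\<close> in the norm of index \<open>0\<close>.\<close>

lemma T_small0_imp_small1:
  assumes "0 < \<eta>"
  obtains \<delta> :: real where "0 < \<delta>"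
    "\<And>g. \<lbrakk>g \<in> mspace p0 w0 \<inter> mspace p1 w1; Phi (pdens p1 w1 g) \<le> 1; Phi (pdens p0 w0 g) \<le> ennreal \<delta>\<rbrakk>
      \<Longrightarrow> Phi (pdens p1 w1 (T g)) \<le> ennreal \<eta>"
proof -
  have "\<exists>\<delta>>0. \<forall>g\<in>mspace p0 w0 \<inter> mspace p1 w1. Phi (pdens p1 w1 g) \<le> 1 \<longrightarrow>
      Phi (pdens p0 w0 g) \<le> ennreal \<delta> \<longrightarrow> Phi (pdens p1 w1 (T g)) \<le> ennreal \<eta>"
  proof (rule ccontr)
    assume neg: "\<not> ?thesis"
    have "\<exists>g\<in>mspace p0 w0 \<inter> mspace p1 w1. Phi (pdens p1 w1 g) \<le> 1 \<and>
      Phi (pdens p0 w0 g) \<le> ennreal (1 / real (Suc n)) \<and> Phi (pdens p1 w1 (T g)) > ennreal \<eta>" for n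
    proof -
      have "0 < 1 / real (Suc n)" by simp
      then show ?thesis using neg by (meson not_le)
    qed
    then obtain s where s: "\<And>n::nat. s n \<in> mspace p0 w0 \<inter> mspace p1 w1"
      "\<And>n. Phi (pdens p1 w1 (s n)) \<le> 1" "\<And>n. Phi (pdens p0 w0 (s n)) \<le> ennreal (1 / real (Suc n))"
      "\<And>n. Phi (pdens p1 w1 (T (s n))) > ennreal \<eta>" by metis
    obtain g r where g: "g \<in> mspace p1 w1" and r: "strict_mono (r :: nat \<Rightarrow> nat)"
      and lim: "(\<lambda>n. Phi (pdens p1 w1 (\<lambda>x. T (s (r n)) x - g x))) \<longlonglongrightarrow> 0"
      using T_compact1[of s 1] s by auto
    have [measurable]: "g \<in> borel_measurable M" "T (s n) \<in> borel_measurable M" for n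
      using g s(1) T_meas V_sub by (auto simp: mspace_def)
    obtain r1 where r1: "strict_mono r1"
      "AE x in M. (\<lambda>n. pdens p1 w1 (\<lambda>x. T (s (r (r1 n))) x - g x) x) \<longlonglongrightarrow> 0"
      by (rule Phi_tendsto_zero_AE[OF _ lim]) auto
    have lim0: "(\<lambda>n. Phi (pdens p0 w0 (T (s (r (r1 n)))))) \<longlonglongrightarrow> 0"
    proof (rule tendsto_sandwich[OF _ _ tendsto_const])
      show "\<forall>\<^sub>F n in sequentially. Phi (pdens p0 w0 (T (s (r (r1 n))))) \<le> ennreal (C0 * (1 / real (Suc n)))"
      proof (rule always_eventually, rule allI)
        fix n
        have "n \<le> r (r1 n)" using seq_suble[OF r] seq_suble[OF r1(1)] order_trans by blast
        then have "1 / real (Suc (r (r1 n))) \<le> 1 / real (Suc n)" by (simp add: frac_le)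
        then have "Phi (pdens p0 w0 (s (r (r1 n)))) \<le> ennreal (1 / real (Suc n))"
          using s(3) ennreal_leI order_trans by blast
        then have "ennreal C0 * Phi (pdens p0 w0 (s (r (r1 n)))) \<le> ennreal C0 * ennreal (1 / real (Suc n))"
          by (intro mult_left_mono) auto
        then show "Phi (pdens p0 w0 (T (s (r (r1 n))))) \<le> ennreal (C0 * (1 / real (Suc n)))"
          using T_bound0[of "s (r (r1 n))"] s(1) C0 by (subst ennreal_mult) (auto intro: order_trans)
      qed
      have "(\<lambda>n. C0 * (1 / real (Suc n))) \<longlonglongrightarrow> C0 * 0"
        by (intro tendsto_mult tendsto_const LIMSEQ_Suc[OF lim_1_over_n])
      then have "(\<lambda>n. ennreal (C0 * (1 / real (Suc n)))) \<longlonglongrightarrow> ennreal (C0 * 0)" by (rule tendsto_ennrealI)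
      then show "(\<lambda>n. ennreal (C0 * (1 / real (Suc n)))) \<longlonglongrightarrow> 0" by simp
    qed auto
    obtain r2 where r2: "strict_mono r2"
      "AE x in M. (\<lambda>n. pdens p0 w0 (T (s (r (r1 (r2 n))))) x) \<longlonglongrightarrow> 0"
      by (rule Phi_tendsto_zero_AE[OF _ lim0]) auto
    \<comment> \<open>Along the first subsequence \<open>T (s n) - g\<close> tends to 0 almost
      everywhere, along a further one \<open>T (s n)\<close> itself does; comparing both limits
      leaves \<open>g = 0\<close>.\<close>
    have g0: "AE x in M. g x = 0"
      using r1(2) r2(2)
    proof eventually_elim
      case (elim x)
      have "(\<lambda>n. T (s (r (r1 n))) x - g x) \<longlonglongrightarrow> 0"
        by (rule pdens_tendsto_zero[OF exponents(2) w_pos(2) elim(1)])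
      then have "(\<lambda>n. T (s (r (r1 (r2 n)))) x - g x) \<longlonglongrightarrow> 0"
        using LIMSEQ_subseq_LIMSEQ[OF _ r2(1)] by (force simp: o_def)
      moreover have "(\<lambda>n. T (s (r (r1 (r2 n)))) x) \<longlonglongrightarrow> 0"
        by (rule pdens_tendsto_zero[OF exponents(1) w_pos(1) elim(2)])
      ultimately have "(\<lambda>n. T (s (r (r1 (r2 n)))) x - (T (s (r (r1 (r2 n)))) x - g x)) \<longlonglongrightarrow> 0 - 0"
        by (intro tendsto_diff)
      then show ?case by (simp add: LIMSEQ_const_iff)
    qed
    have "Phi (pdens p1 w1 (\<lambda>x. T (s (r n)) x - g x)) = Phi (pdens p1 w1 (T (s (r n))))" for n
      by (rule Phi_pdens_cong) (use g0 in \<open>auto elim!: eventually_mono\<close>)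
    then have gt: "Phi (pdens p1 w1 (\<lambda>x. T (s (r n)) x - g x)) > ennreal \<eta>" for n using s(4) by simp
    have "\<forall>\<^sub>F n in sequentially. Phi (pdens p1 w1 (\<lambda>x. T (s (r n)) x - g x)) < ennreal \<eta>"
      using lim assms by (intro order_tendstoD(2)) auto
    then show False using gt by (auto simp: eventually_sequentially dest: less_asym)
  qed
  then show ?thesis using that by blast
qed

text \<open>Without a finite net one could choose successively elements with pairwise distant
  images, and compactness forbids such a sequence. The preimages of the centres are taken in both
  endpoint spaces so that the centres themselves have finite mass at index \<open>p\<close>.\<close>

lemma T_finite_net:
  assumes "0 < \<eta>"
  obtains G where "finite G" "G \<subseteq> mspace p0 w0 \<inter> mspace p1 w1"
    "\<And>g. \<lbrakk>g \<in> mspace p0 w0 \<inter> mspace p1 w1; Phi (pdens p1 w1 g) \<le> 1\<rbrakk>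
      \<Longrightarrow> \<exists>g'\<in>G. Phi (pdens p1 w1 (\<lambda>x. T g x - T g' x)) \<le> ennreal \<eta>"
proof -
  define B where "B = {g \<in> mspace p0 w0 \<inter> mspace p1 w1. Phi (pdens p1 w1 g) \<le> 1}"
  define far where "far g g' \<longleftrightarrow> Phi (pdens p1 w1 (\<lambda>x. T g x - T g' x)) > ennreal \<eta>" for g g'
  have "\<exists>G. finite G \<and> G \<subseteq> B \<and> (\<forall>g\<in>B. \<exists>g'\<in>G. \<not> far g g')"
  proof (rule ccontr)
    assume neg: "\<not> ?thesis"
    have ext: "\<exists>g\<in>B. \<forall>g'\<in>set xs. far g g'" if "set xs \<subseteq> B" for xs
      using neg that by (metis List.finite_set)
    obtain xs where xs: "\<And>n::nat. set (xs n) \<subseteq> B"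
      "\<And>n. \<exists>g\<in>B. xs (Suc n) = g # xs n \<and> (\<forall>g'\<in>set (xs n). far g g')"
    proof -
      have "\<exists>f. \<forall>n::nat. set (f n) \<subseteq> B \<and> (\<exists>g\<in>B. f (Suc n) = g # f n \<and> (\<forall>g'\<in>set (f n). far g g'))"
      proof (rule dependent_nat_choice)
        show "\<exists>x. set x \<subseteq> B" by (rule exI[of _ "[]"]) simp
        fix x and n :: nat assume x: "set x \<subseteq> B"
        then obtain g where "g \<in> B" "\<forall>g'\<in>set x. far g g'" using ext by blast
        then show "\<exists>y. set y \<subseteq> B \<and> (\<exists>g\<in>B. y = g # x \<and> (\<forall>g'\<in>set x. far g g'))"
          using x by (intro exI[of _ "g # x"]) auto
      qed
      then show ?thesis using that by blast
    qed
    define s where "s n = hd (xs (Suc n))" for n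
    have s: "s n \<in> B" "xs (Suc n) = s n # xs n" "\<And>g'. g' \<in> set (xs n) \<Longrightarrow> far (s n) g'" for n
      using xs(2)[of n] by (auto simp: s_def)
    have mem: "s m \<in> set (xs n)" if "m < n" for m n
      using that by (induction n) (auto simp: s(2) less_Suc_eq)
    have far: "far (s n) (s m)" if "m < n" for m n using mem[OF that] s(3) by blast
    have sm: "s n \<in> mspace p1 w1" "Phi (pdens p1 w1 (s n)) \<le> ennreal 1" for n using s(1) by (auto simp: B_def)
    obtain g r where g: "g \<in> mspace p1 w1" and r: "strict_mono (r :: nat \<Rightarrow> nat)"
      and lim: "(\<lambda>n. Phi (pdens p1 w1 (\<lambda>x. T (s (r n)) x - g x))) \<longlonglongrightarrow> 0"
      using T_compact1[of s 1] sm by auto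
    have [measurable]: "g \<in> borel_measurable M" "T (s n) \<in> borel_measurable M" for n
      using g sm(1)[of n] T_meas V_sub mspace_meas by blast+
    \<comment> \<open>Two errors \<open>e\<close>, multiplied by the quasi-triangle constant
      \<open>2 powr p1\<close>, add up to \<eta>.\<close>
    define e where "e = \<eta> / (2 * 2 powr p1)"
    have e: "e > 0" using assms by (simp add: e_def)
    obtain N where N: "\<And>n. n \<ge> N \<Longrightarrow> Phi (pdens p1 w1 (\<lambda>x. T (s (r n)) x - g x)) < ennreal e"
      using order_tendstoD(2)[OF lim, of "ennreal e"] e by (auto simp: eventually_sequentially)
    define a b where "a = r (Suc N)" and "b = r N"
    have "b < a" using r by (simp add: a_def b_def strict_mono_def)
    have "Phi (pdens p1 w1 (\<lambda>x. T (s a) x - T (s b) x))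
        = Phi (pdens p1 w1 (\<lambda>x. (T (s a) x - g x) - (T (s b) x - g x)))" by simp
    also have "\<dots> \<le> ennreal (2 powr p1) * (Phi (pdens p1 w1 (\<lambda>x. T (s a) x - g x)) + Phi (pdens p1 w1 (\<lambda>x. T (s b) x - g x)))"
      using exponents w_pos by (intro Phi_pdens_diff_le) auto
    also have "\<dots> \<le> ennreal (2 powr p1) * (ennreal e + ennreal e)"
      using N[of N] N[of "Suc N"] by (intro mult_left_mono add_mono) (auto simp: a_def b_def intro: less_imp_le)
    also have "\<dots> = ennreal \<eta>"
    proof -
      have "ennreal (2 powr p1) * (ennreal e + ennreal e) = ennreal (2 powr p1 * (e + e))"
        using e by (simp add: ennreal_mult flip: ennreal_plus)
      also have "2 powr p1 * (e + e) = \<eta>" by (simp add: e_def)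
      finally show ?thesis .
    qed
    finally show False using far[OF \<open>b < a\<close>] by (simp add: far_def)
  qed
  then obtain G where "finite G" "G \<subseteq> B" "\<forall>g\<in>B. \<exists>g'\<in>G. \<not> far g g'" by blast
  then show ?thesis by (intro that[of G]) (auto simp: B_def far_def not_less)
qed

end

text \<open>For upper tails at points where fixed functions \<open>y g\<close> dominate. At a single
  point all their densities are powers of moduli, so a bound at index \<open>q\<close> by the
  largest modulus \<open>m\<close> transfers to index \<open>p\<close>; the levels beyond
  \<open>N\<close> contribute a geometric series of size \<open>b powr N\<close>.\<close>

lemma pdens_sum_decay:
  fixes h :: "int \<Rightarrow> 'a \<Rightarrow> complex" and D :: real and N :: int
  assumes pos: "0 < q" "0 < p" "0 < u x" "0 < w x" "0 < c" and D: "0 \<le> D"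
    and G: "finite G" and K: "finite K" "K \<subseteq> {N<..}" "K \<noteq> {}"
    and h: "\<And>k. k \<in> K \<Longrightarrow> pdens q u (h k) x \<le> ennreal (2 powr (- c * k)) * (ennreal D * (\<Sum>g\<in>G. pdens q u (y g) x))"
  defines "b \<equiv> 2 powr (- c / q)"
  shows "pdens p w (\<lambda>x. \<Sum>k\<in>K. h k x) x
    \<le> ennreal ((2 / (1 - b) * (D * card G) powr (1/q) * b powr N) powr p) * (\<Sum>g\<in>G. pdens p w (y g) x)"
proof -
  have b: "0 < b" "b < 1" using pos by (auto simp: b_def powr_less_one)
  \<comment> \<open>The inserted 0 covers an empty \<open>G\<close>. If \<open>m\<close> is not 0,
    it is the modulus of one of the functions, so its density is one of the summands on the
    right.\<close>
  define m where "m = Max (insert 0 ((\<lambda>g. norm (y g x)) ` G))"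
  have m: "\<And>g. g \<in> G \<Longrightarrow> norm (y g x) \<le> m" "0 \<le> m" using G by (auto simp: m_def)
  have mG: "m = 0 \<or> (\<exists>g\<in>G. m = norm (y g x))"
    using Max_in[of "insert 0 ((\<lambda>g. norm (y g x)) ` G)"] G by (auto simp: m_def)
  have sumle: "(\<Sum>g\<in>G. pdens q u (y g) x) \<le> ennreal (card G * (m powr q * u x))"
  proof -
    have "(\<Sum>g\<in>G. pdens q u (y g) x) \<le> (\<Sum>g\<in>G. ennreal (m powr q * u x))"
      unfolding pdens_def using m pos by (intro sum_mono ennreal_leI mult_right_mono powr_mono2) auto
    also have "\<dots> = ennreal (card G * (m powr q * u x))"
      using pos by (simp add: ennreal_mult ennreal_of_nat_eq_real_of_nat)
    finally show ?thesis .
  qed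
  define L where "L = (D * card G) powr (1/q)"
  have L0: "0 \<le> L" by (simp add: L_def)
  have hk: "norm (h k x) \<le> L * m * b powr k" if "k \<in> K" for k
  proof -
    have "pdens q u (h k) x \<le> ennreal (2 powr (- c * k)) * (ennreal D * ennreal (card G * (m powr q * u x)))"
      using h[OF that] by (rule order_trans) (intro mult_left_mono sumle, auto)
    also have "\<dots> = ennreal (2 powr (- c * k) * (D * (card G * (m powr q * u x))))"
      using D pos by (simp add: ennreal_mult)
    finally have "norm (h k x) powr q * u x \<le> 2 powr (- c * k) * (D * (card G * (m powr q * u x)))"
      using D pos unfolding pdens_def by (subst (asm) ennreal_le_iff) auto
    then have "norm (h k x) powr q * u x \<le> (2 powr (- c * k) * (D * card G * m powr q)) * u x"
      by (simp only: mult_ac)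
    then have "norm (h k x) powr q \<le> 2 powr (- c * k) * (D * card G * m powr q)"
      using pos by (simp only: mult_le_cancel_right_pos)
    then have "(norm (h k x) powr q) powr (1/q) \<le> (2 powr (- c * k) * (D * card G * m powr q)) powr (1/q)"
      using pos by (intro powr_mono2) auto
    moreover have "(norm (h k x) powr q) powr (1/q) = norm (h k x)" "(m powr q) powr (1/q) = m"
      using pos m by (simp_all add: powr_powr)
    moreover have "(2 powr (- c * k)) powr (1/q) = b powr k" by (simp add: b_def powr_powr)
    ultimately show ?thesis by (simp only: powr_mult L_def mult_ac)
  qed
  have bk: "b powr k = b powr N * b ^ nat \<bar>k - N\<bar>" if "k \<in> K" for k
  proof -
    have "k > N" using that K by auto
    then have "b powr k = b powr (N + real (nat \<bar>k - N\<bar>))" by simp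
    then show ?thesis using b by (simp only: powr_add powr_realpow)
  qed
  have "norm (\<Sum>k\<in>K. h k x) \<le> (\<Sum>k\<in>K. norm (h k x))" by (rule norm_sum)
  also have "\<dots> \<le> (\<Sum>k\<in>K. L * m * b powr N * b ^ nat \<bar>k - N\<bar>)"
    by (intro sum_mono) (use hk bk in \<open>simp add: mult.assoc\<close>)
  also have "\<dots> = L * m * b powr N * (\<Sum>k\<in>K. b ^ nat \<bar>k - N\<bar>)" by (rule sum_distrib_left[symmetric])
  also have "\<dots> \<le> L * m * b powr N * (2 / (1 - b))"
    using b K m L0 by (intro mult_left_mono sum_powr_abs_diff_le) auto
  finally have "norm (\<Sum>k\<in>K. h k x) powr p \<le> (L * m * b powr N * (2 / (1 - b))) powr p"
    using pos by (intro powr_mono2) auto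
  also have "\<dots> = (2 / (1 - b) * L * b powr N) powr p * m powr p"
    by (simp only: powr_mult[symmetric]) (simp only: mult_ac)
  finally have "norm (\<Sum>k\<in>K. h k x) powr p * w x \<le> (2 / (1 - b) * L * b powr N) powr p * m powr p * w x"
    using pos by (intro mult_right_mono) auto
  then have "pdens p w (\<lambda>x. \<Sum>k\<in>K. h k x) x \<le> ennreal ((2 / (1 - b) * L * b powr N) powr p * m powr p * w x)"
    unfolding pdens_def by (rule ennreal_leI)
  also have "\<dots> = ennreal ((2 / (1 - b) * L * b powr N) powr p) * ennreal (m powr p * w x)"
    using pos by (subst ennreal_mult[symmetric]) (auto simp: mult.assoc)
  also have "ennreal (m powr p * w x) \<le> (\<Sum>g\<in>G. pdens p w (y g) x)"
    using mG
  proof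
    assume "\<exists>g\<in>G. m = norm (y g x)"
    then obtain g where g: "g \<in> G" "m = norm (y g x)" by blast
    then show ?thesis using G member_le_sum[of g G "\<lambda>g. pdens p w (y g) x"] by (simp add: pdens_def)
  qed simp
  finally show ?thesis unfolding L_def by (simp add: mult_left_mono)
qed

section \<open>Tails over finite sets of levels\<close>

context compact_interpolation
begin

lemma T_cut:
  assumes "f \<in> unit_ball" "finite K" "K \<noteq> {}"
  shows "AE x in M. T (cut K f) x = (\<Sum>k\<in>K. T (piece f k) x)"
  unfolding cut_def using T_lmult[OF assms, of "indicator K"] by simp

lemma cut_finite_space:
  assumes "f \<in> unit_ball" "finite K"
  shows "cut K f \<in> mspace p0 w0 \<inter> mspace p1 w1"
  unfolding cut_def by (rule lmult_finite_space[OF assms]) simp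

lemma T_cut_meas: "\<lbrakk>f \<in> unit_ball; finite K\<rbrakk> \<Longrightarrow> T (cut K f) \<in> borel_measurable M"
  using cut_finite_space V_sub T_meas by blast

text \<open>Together with \<open>coef1\<close> this normalises every level: after multiplication the
  density of index 0 (respectively 1) is at most the density of \<open>f\<close> of index
  \<open>p\<close>, so all signed sums lie in the unit ball of that endpoint space.\<close>

definition coef0 :: "int \<Rightarrow> real" where "coef0 k = 2 powr (- (k + 1) / p0)"
definition coef1 :: "int \<Rightarrow> real" where "coef1 k = 2 powr (gam * k / p1)"

lemma coef_pos: "0 < coef0 k" "0 < coef1 k" by (simp_all add: coef0_def coef1_def)

lemma coef0_powr: "coef0 k powr (- p0) = 2 powr (k + 1)" "coef0 k powr p0 * 2 powr (k + 1) = 1"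
  using exponents(1) by (simp_all add: coef0_def powr_powr powr_add[symmetric] add.commute)

lemma coef1_powr: "coef1 k powr (- p1) = 2 powr (- gam * k)" "coef1 k powr p1 * 2 powr (- gam * k) = 1"
  using exponents(2) by (simp_all add: coef1_def powr_powr powr_add[symmetric])

lemma scoef_abs_powr: "0 < e k \<Longrightarrow> \<bar>scoef K S e k\<bar> powr q = (if k \<in> K then e k powr q else 0)"
  by (simp add: scoef_def)

text \<open>The majorant of index 0. Both tail estimates take from it only the uniform bound
  \<open>avg0_bound\<close>; smallness always comes from index 1.\<close>

definition avg0 :: "int set \<Rightarrow> ('a \<Rightarrow> complex) \<Rightarrow> 'a \<Rightarrow> ennreal" where
  "avg0 K f x = ennreal (2 / 2 ^ card K) * (\<Sum>S\<in>Pow K. pdens p0 w0 (T (lmult (scoef K S coef0) f)) x)"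

lemma avg0_meas: "\<lbrakk>f \<in> unit_ball; finite K\<rbrakk> \<Longrightarrow> avg0 K f \<in> borel_measurable M"
  unfolding avg0_def[abs_def] using T_scoef_meas[of f K] by measurable

lemma avg0_bound:
  assumes f: "f \<in> unit_ball" and K: "finite K"
  shows "Phi (avg0 K f) \<le> ennreal (2 * C0)"
proof -
  have "Phi (avg0 K f) \<le> 2 * ennreal C0"
    unfolding avg0_def[abs_def]
  proof (rule Phi_average_le[OF K])
    fix S
    show "pdens p0 w0 (T (lmult (scoef K S coef0) f)) \<in> borel_measurable M"
      using T_scoef_meas[OF f K] by measurable
    have *: "\<bar>scoef K S coef0 k\<bar> powr p0 * 2 powr (k + 1) \<le> 1" for k
      using coef0_powr(2)[of k] coef_pos(1)[of k] by (simp add: scoef_abs_powr)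
    have "Phi (pdens p0 w0 (T (lmult (scoef K S coef0) f))) \<le> ennreal C0 * Phi (pdens p0 w0 (lmult (scoef K S coef0) f))"
      by (rule T_bound0[OF lmult_space0(1)[OF f *]])
    also have "\<dots> \<le> ennreal C0 * ennreal 1"
      by (intro mult_left_mono lmult_space0(2)[OF f *]) auto
    finally show "Phi (pdens p0 w0 (T (lmult (scoef K S coef0) f))) \<le> ennreal C0" by simp
  qed
  then show ?thesis using C0 by (simp add: ennreal_mult)
qed

lemma avg0_dominates:
  assumes f: "f \<in> unit_ball" and K: "finite K" "K \<noteq> {}"
  shows "AE x in M. \<forall>k\<in>K. pdens p0 w0 (T (piece f k)) x \<le> ennreal (2 powr (k + 1)) * avg0 K f x"
  using sign_average[where e = coef0 and u = w0, OF f K coef_pos(1) exponents(1) w_pos(1)]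
  unfolding avg0_def coef0_powr by simp

lemma lmult_coef1:
  assumes f: "f \<in> unit_ball" and K: "finite K"
  shows "lmult (scoef K S coef1) f \<in> mspace p0 w0 \<inter> mspace p1 w1"
    "Phi (pdens p1 w1 (lmult (scoef K S coef1) f)) \<le> 1"
proof -
  have *: "\<bar>scoef K S coef1 k\<bar> powr p1 * 2 powr (- gam * k) \<le> 1" for k
    using coef1_powr(2)[of k] coef_pos(2)[of k] by (simp add: scoef_abs_powr)
  show "lmult (scoef K S coef1) f \<in> mspace p0 w0 \<inter> mspace p1 w1"
    by (rule lmult_finite_space[OF f K]) (simp add: scoef_def)
  show "Phi (pdens p1 w1 (lmult (scoef K S coef1) f)) \<le> 1"
    using lmult_space1(2)[OF f *] by simp
qed

text \<open>The order of choice matters: \<open>d\<close> is fixed first, to make the index-0 share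
  small, and only then \<eta>1, which has to compensate the possibly large factor
  \<open>d powr (- gam)\<close>.\<close>

lemma exists_small_split:
  assumes "0 < \<eta>" "0 < C" "0 \<le> A" "0 \<le> B"
  obtains d \<eta>1 :: real where "0 < d" "0 < \<eta>1" "C * (d * A + d powr (- gam) * (B * \<eta>1)) \<le> \<eta>"
proof -
  define d where "d = \<eta> / (2 * C * (A + 1))"
  define \<eta>1 where "\<eta>1 = \<eta> / (2 * C * (B + 1) * d powr (- gam))"
  have d: "0 < d" using assms by (simp add: d_def)
  have e: "0 < \<eta>1" using assms d by (simp add: \<eta>1_def)
  have "C * (d * A) \<le> \<eta> / 2"
  proof -
    define A1 where "A1 = A + 1"
    have "C * (d * A) = \<eta> / 2 * (A / A1)"
      using assms(2) unfolding d_def A1_def[symmetric] by (simp add: field_simps)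
    also have "\<dots> \<le> \<eta> / 2 * 1" using assms by (intro mult_left_mono) (auto simp: A1_def)
    finally show ?thesis by simp
  qed
  moreover have "C * (d powr (- gam) * (B * \<eta>1)) \<le> \<eta> / 2"
  proof -
    define z where "z = d powr (- gam)"
    have z: "z > 0" using d by (simp add: z_def)
    define B1 where "B1 = B + 1"
    have "C * (z * (B * \<eta>1)) = \<eta> / 2 * (B / B1)"
      using assms(2) z unfolding \<eta>1_def z_def[symmetric] B1_def[symmetric] by (simp add: field_simps)
    also have "\<dots> \<le> \<eta> / 2 * 1" using assms by (intro mult_left_mono) (auto simp: B1_def)
    finally show ?thesis by (simp add: z_def)
  qed
  ultimately show ?thesis using that[OF d e] by (simp add: distrib_left)
qed

text \<open>The signed sums normalised at index 1 are small at index 0 when all levels are very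
  negative; \<open>T_small0_imp_small1\<close> then makes the index-1 majorant small, and
  interpolation with the bounded index-0 majorant concludes.\<close>

lemma lower_tail_finite:
  assumes "0 < \<eta>"
  obtains N :: nat where "\<And>f K. \<lbrakk>f \<in> unit_ball; finite K; K \<noteq> {}; K \<subseteq> {..< - int N}\<rbrakk>
    \<Longrightarrow> Phi (pdens p w (T (cut K f))) \<le> ennreal \<eta>"
proof -
  obtain C where C: "0 < C"
    "\<And>d K h x F0 F1. \<lbrakk>0 < d; finite K;
       \<And>k. k \<in> K \<Longrightarrow> pdens p0 w0 (h k) x \<le> ennreal (2 powr (k + 1)) * F0;
       \<And>k. k \<in> K \<Longrightarrow> pdens p1 w1 (h k) x \<le> ennreal (2 powr (- gam * k)) * F1\<rbrakk>
     \<Longrightarrow> pdens p w (\<lambda>x. \<Sum>k\<in>K. h (k::int) x) x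
          \<le> ennreal C * (ennreal d * F0 + ennreal (d powr (- gam)) * F1)"
    by (rule pdens_sum_interpolate) blast
  obtain d \<eta>1 :: real where d: "0 < d" "0 < \<eta>1" "C * (d * (2 * C0) + d powr (- gam) * (2 * \<eta>1)) \<le> \<eta>"
    using exists_small_split[OF assms C(1), of "2 * C0" 2] C0 by auto
  obtain \<delta> :: real where \<delta>: "0 < \<delta>"
    "\<And>g. \<lbrakk>g \<in> mspace p0 w0 \<inter> mspace p1 w1; Phi (pdens p1 w1 g) \<le> 1; Phi (pdens p0 w0 g) \<le> ennreal \<delta>\<rbrakk>
      \<Longrightarrow> Phi (pdens p1 w1 (T g)) \<le> ennreal \<eta>1"
    using T_small0_imp_small1[OF d(2)] by blast
  obtain N :: nat where N: "(1/2::real) ^ N < \<delta>"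
    using real_arch_pow_inv[OF \<delta>(1), of "1/2"] by auto
  show ?thesis
  proof (rule that[of N])
    fix f K assume f: "f \<in> unit_ball" and K: "finite K" "K \<noteq> {}" and KN: "K \<subseteq> {..< - int N}"
    define g where "g S = lmult (scoef K S coef1) f" for S
    note gs = lmult_coef1[OF f K(1), folded g_def]
    have Tg: "Phi (pdens p1 w1 (T (g S))) \<le> ennreal \<eta>1" for S
    proof (rule \<delta>(2)[OF gs])
      have *: "\<bar>scoef K S coef1 k\<bar> powr p0 * 2 powr (k + 1) \<le> (1/2)^N" for k
      proof (cases "k \<in> K")
        case True
        then have k: "k < - int N" using KN by auto
        \<comment> \<open>For negative levels \<open>coef1\<close> is at most 1 and the smallness
          comes from \<open>2 powr (k + 1)\<close>; the strict inequality \<open>k < - N\<close>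
          absorbs the added 1.\<close>
        have "coef1 k powr p0 \<le> 1 powr p0"
        proof (rule powr_mono2)
          have "gam * k / p1 \<le> 0" using k gam_pos exponents(2) by (simp add: divide_nonpos_pos mult_nonneg_nonpos)
          then show "coef1 k \<le> 1" unfolding coef1_def using powr_mono[of _ 0 2] by fastforce
        qed (use exponents coef_pos in \<open>auto intro: less_imp_le\<close>)
        moreover have "2 powr (k + 1) \<le> 2 powr (- real N)"
          using k by (intro powr_mono) auto
        ultimately have "coef1 k powr p0 * 2 powr (k + 1) \<le> 1 * (1/2)^N"
          unfolding two_powr_minus by (intro mult_mono) auto
        then show ?thesis using True coef_pos by (simp add: scoef_abs_powr)
      next
        case False
        then show ?thesis by (simp add: scoef_def)
      qed
      show "Phi (pdens p0 w0 (g S)) \<le> ennreal \<delta>"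
        using lmult_space0(2)[OF f *] N unfolding g_def by (meson ennreal_leI less_imp_le order_trans)
    qed
    have gm [measurable]: "T (g S) \<in> borel_measurable M" for S using gs(1) V_sub T_meas by blast
    define A where "A x = ennreal (2 / 2 ^ card K) * (\<Sum>S\<in>Pow K. pdens p1 w1 (T (g S)) x)" for x
    have [measurable]: "A \<in> borel_measurable M" unfolding A_def by measurable
    have PA: "Phi A \<le> 2 * ennreal \<eta>1"
      unfolding A_def[abs_def] by (rule Phi_average_le[OF K(1) _ Tg]) measurable
    have domA: "AE x in M. \<forall>k\<in>K. pdens p1 w1 (T (piece f k)) x \<le> ennreal (2 powr (- gam * k)) * A x"
      using sign_average[where e = coef1 and u = w1, OF f K coef_pos(2) exponents(2) w_pos(2)]
      unfolding A_def g_def coef1_powr .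
    have [measurable]: "avg0 K f \<in> borel_measurable M" "T (cut K f) \<in> borel_measurable M"
      using avg0_meas T_cut_meas f K by auto
    have "AE x in M. pdens p w (T (cut K f)) x
        \<le> ennreal C * (ennreal d * avg0 K f x + ennreal (d powr (- gam)) * A x)"
      using domA avg0_dominates[OF f K] T_cut[OF f K]
    proof eventually_elim
      case (elim x)
      have "pdens p w (\<lambda>x. \<Sum>k\<in>K. T (piece f k) x) x
          \<le> ennreal C * (ennreal d * avg0 K f x + ennreal (d powr (- gam)) * A x)"
        using elim by (intro C(2) d K) auto
      then show ?case using elim(3) by (simp add: pdens_def)
    qed
    then have "Phi (pdens p w (T (cut K f)))
        \<le> Phi (\<lambda>x. ennreal C * (ennreal d * avg0 K f x + ennreal (d powr (- gam)) * A x))"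
      by (intro Phi_mono) auto
    also have "\<dots> = ennreal C * Phi (\<lambda>x. ennreal d * avg0 K f x + ennreal (d powr (- gam)) * A x)"
      by (rule Phi_cmult) measurable
    also have "\<dots> \<le> ennreal C * (Phi (\<lambda>x. ennreal d * avg0 K f x) + Phi (\<lambda>x. ennreal (d powr (- gam)) * A x))"
      by (intro mult_left_mono Phi_add) auto
    also have "\<dots> = ennreal C * (ennreal d * Phi (avg0 K f) + ennreal (d powr (- gam)) * Phi A)"
      by (subst (1 2) Phi_cmult) auto
    also have "\<dots> \<le> ennreal C * (ennreal d * ennreal (2 * C0) + ennreal (d powr (- gam)) * (2 * ennreal \<eta>1))"
      by (intro mult_left_mono add_mono PA avg0_bound[OF f K(1)]) auto
    also have "\<dots> = ennreal (C * (d * (2 * C0) + d powr (- gam) * (2 * \<eta>1)))"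
      using C d C0 by (simp add: ennreal_mult)
    also have "\<dots> \<le> ennreal \<eta>" using d by (intro ennreal_leI) auto
    finally show "Phi (pdens p w (T (cut K f))) \<le> ennreal \<eta>" .
  qed
qed

lemma upper_tail_finite:
  assumes "0 < \<eta>"
  obtains N :: nat where "\<And>f K. \<lbrakk>f \<in> unit_ball; finite K; K \<noteq> {}; K \<subseteq> {int N<..}\<rbrakk>
    \<Longrightarrow> Phi (pdens p w (T (cut K f))) \<le> ennreal \<eta>"
proof -
  obtain C where C: "0 < C"
    "\<And>d K h x F0 F1. \<lbrakk>0 < d; finite K;
       \<And>k. k \<in> K \<Longrightarrow> pdens p0 w0 (h k) x \<le> ennreal (2 powr (k + 1)) * F0;
       \<And>k. k \<in> K \<Longrightarrow> pdens p1 w1 (h k) x \<le> ennreal (2 powr (- gam * k)) * F1\<rbrakk>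
     \<Longrightarrow> pdens p w (\<lambda>x. \<Sum>k\<in>K. h (k::int) x) x
          \<le> ennreal C * (ennreal d * F0 + ennreal (d powr (- gam)) * F1)"
    by (rule pdens_sum_interpolate) blast
  \<comment> \<open>\<open>2 powr p1\<close> is the quasi-triangle constant, and 3 bounds
    \<open>E + 2 * Y1\<close> by a multiple of the larger of the two.\<close>
  define D where "D = 3 * 2 powr p1"
  have D0: "0 \<le> D" by (simp add: D_def)
  obtain d \<eta>1 :: real where d: "0 < d" "0 < \<eta>1"
    "C * (d * (2 * C0) + d powr (- gam) * (D * 2 * \<eta>1)) \<le> \<eta> / 2"
    using exists_small_split[of "\<eta>/2" C "2 * C0" "D * 2"] assms C(1) C0 D0 by auto
  obtain G where G: "finite G" "G \<subseteq> mspace p0 w0 \<inter> mspace p1 w1"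
    "\<And>g. \<lbrakk>g \<in> mspace p0 w0 \<inter> mspace p1 w1; Phi (pdens p1 w1 g) \<le> 1\<rbrakk>
      \<Longrightarrow> \<exists>g'\<in>G. Phi (pdens p1 w1 (\<lambda>x. T g x - T g' x)) \<le> ennreal \<eta>1"
    using T_finite_net[OF d(2)] by blast
  have TG [measurable]: "g \<in> G \<Longrightarrow> T g \<in> borel_measurable M" for g using G(2) V_sub T_meas by blast
  define Y where "Y x = (\<Sum>g\<in>G. pdens p w (T g) x)" for x
  define Y1 where "Y1 x = (\<Sum>g\<in>G. pdens p1 w1 (T g) x)" for x
  have Ym [measurable]: "Y \<in> borel_measurable M" "Y1 \<in> borel_measurable M"
    unfolding Y_def Y1_def by measurable
  have "Phi (pdens p w (T g)) < \<infinity>" if "g \<in> G" for g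
  proof -
    have g: "T g \<in> mspace p0 w0" "T g \<in> mspace p1 w1" using that G(2) T_space0 T_space1 by auto
    have [measurable]: "T g \<in> borel_measurable M" using TG[OF that] .
    have "Phi (pdens p w (T g)) \<le> Phi (\<lambda>x. pdens p0 w0 (T g) x + pdens p1 w1 (T g) x)"
      using pdens_interpolate[of 1 "T g"] by (intro Phi_mono AE_I2) auto
    also have "\<dots> \<le> Phi (pdens p0 w0 (T g)) + Phi (pdens p1 w1 (T g))"
      by (intro Phi_add) measurable
    also have "\<dots> < \<infinity>" using g by (simp add: mspace_def)
    finally show ?thesis .
  qed
  moreover have "Phi Y \<le> (\<Sum>g\<in>G. Phi (pdens p w (T g)))"
    unfolding Y_def using G(1) by (intro Phi_sum) auto
  ultimately have "Phi Y < \<infinity>"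
    by (intro le_less_trans[of "Phi Y"]) (use G(1) in auto)
  then obtain y where y: "Phi Y = ennreal y" "0 \<le> y" by (cases "Phi Y") auto
  define b where "b = 2 powr (- gam / p1)"
  have b: "0 < b" "b < 1" using gam_pos exponents(2) by (auto simp: b_def powr_less_one)
  define L where "L = 2 / (1 - b) * (D * card G) powr (1/p1)"
  have L0: "0 \<le> L" using b by (simp add: L_def)
  have "(\<lambda>N. (L * b ^ N) powr p * y) \<longlonglongrightarrow> (L * 0) powr p * y"
    using b L0 p_pos
    by (intro tendsto_mult tendsto_const tendsto_powr2 LIMSEQ_power_zero) auto
  then have "\<forall>\<^sub>F N in sequentially. (L * b ^ N) powr p * y < \<eta> / 2"
    using assms by (intro order_tendstoD(2)[where y="(L * 0) powr p * y"]) auto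
  then obtain N where N: "(L * b ^ N) powr p * y < \<eta> / 2" by (auto dest!: eventually_happens)
  define \<epsilon> where "\<epsilon> = (L * b ^ N) powr p"
  show ?thesis
  proof (rule that[of N])
    fix f K assume f: "f \<in> unit_ball" and K: "finite K" "K \<noteq> {}" and KN: "K \<subseteq> {int N<..}"
    define g where "g S = lmult (scoef K S coef1) f" for S
    note gs = lmult_coef1[OF f K(1), folded g_def]
    have gm [measurable]: "T (g S) \<in> borel_measurable M" for S using gs(1) V_sub T_meas by blast
    have "\<forall>S. \<exists>g'\<in>G. Phi (pdens p1 w1 (\<lambda>x. T (g S) x - T g' x)) \<le> ennreal \<eta>1"
      using G(3)[OF gs] by blast
    then obtain j where j: "\<And>S. j S \<in> G" "\<And>S. Phi (pdens p1 w1 (\<lambda>x. T (g S) x - T (j S) x)) \<le> ennreal \<eta>1"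
      by metis
    have jm [measurable]: "T (j S) \<in> borel_measurable M" for S using TG j(1) by blast
    define A where "A x = ennreal (2 / 2 ^ card K) * (\<Sum>S\<in>Pow K. pdens p1 w1 (T (g S)) x)" for x
    define E where "E x = ennreal (2 / 2 ^ card K) * (\<Sum>S\<in>Pow K. pdens p1 w1 (\<lambda>x. T (g S) x - T (j S) x) x)" for x
    have [measurable]: "A \<in> borel_measurable M" "E \<in> borel_measurable M" unfolding A_def E_def by measurable
    have PE: "Phi E \<le> 2 * ennreal \<eta>1"
      unfolding E_def[abs_def] by (rule Phi_average_le[OF K(1) _ j(2)]) measurable
    \<comment> \<open>Each image is its net point plus an error. The errors average to
      \<open>E\<close>; the net points contribute at most \<open>Y1\<close> for every sign pattern,
      hence \<open>2 * Y1\<close> after normalisation.\<close>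
    have AE: "A x \<le> ennreal (2 powr p1) * (E x + 2 * Y1 x)" for x
    proof -
      have "pdens p1 w1 (T (g S)) x \<le> ennreal (2 powr p1) * (pdens p1 w1 (\<lambda>x. T (g S) x - T (j S) x) x + Y1 x)" for S
      proof -
        have "pdens p1 w1 (\<lambda>x. (T (g S) x - T (j S) x) + T (j S) x) x
            \<le> ennreal (2 powr p1) * (pdens p1 w1 (\<lambda>x. T (g S) x - T (j S) x) x + pdens p1 w1 (T (j S)) x)"
          using exponents w_pos[of x] by (intro pdens_add_le) auto
        also have "\<dots> \<le> ennreal (2 powr p1) * (pdens p1 w1 (\<lambda>x. T (g S) x - T (j S) x) x + Y1 x)"
          unfolding Y1_def using G(1) j(1)[of S]
          by (intro mult_left_mono add_left_mono member_le_sum[of _ G "\<lambda>g. pdens p1 w1 (T g) x"]) auto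
        finally show ?thesis by simp
      qed
      then have "A x \<le> ennreal (2 / 2 ^ card K) *
          (\<Sum>S\<in>Pow K. ennreal (2 powr p1) * (pdens p1 w1 (\<lambda>x. T (g S) x - T (j S) x) x + Y1 x))"
        unfolding A_def by (intro mult_left_mono sum_mono) auto
      also have "\<dots> = ennreal (2 powr p1) * (E x + (ennreal (2 / 2 ^ card K) * of_nat (2 ^ card K)) * Y1 x)"
        using K(1) by (simp add: E_def sum_distrib_left[symmetric] sum.distrib card_Pow distrib_left mult_ac)
      also have "ennreal (2 / 2 ^ card K) * of_nat (2 ^ card K) = 2"
        by (simp add: ennreal_of_nat_eq_real_of_nat ennreal_mult[symmetric])
      finally show ?thesis .
    qed
    have domA: "AE x in M. \<forall>k\<in>K. pdens p1 w1 (T (piece f k)) x \<le> ennreal (2 powr (- gam * k)) * A x"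
      using sign_average[where e = coef1 and u = w1, OF f K coef_pos(2) exponents(2) w_pos(2)]
      unfolding A_def g_def coef1_powr .
    have [measurable]: "avg0 K f \<in> borel_measurable M" "T (cut K f) \<in> borel_measurable M"
      using avg0_meas T_cut_meas f K by auto
    have D3: "ennreal (2 powr p1) * (3 * F) = ennreal D * F" for F
      by (simp add: D_def ennreal_mult mult_ac)
    have "AE x in M. pdens p w (T (cut K f)) x
        \<le> ennreal C * (ennreal d * avg0 K f x + ennreal (d powr (- gam)) * (ennreal D * E x)) + ennreal \<epsilon> * Y x"
      using domA avg0_dominates[OF f K] T_cut[OF f K]
    proof eventually_elim
      case (elim x)
      have eq: "pdens p w (T (cut K f)) x = pdens p w (\<lambda>x. \<Sum>k\<in>K. T (piece f k) x) x"
        using elim(3) by (simp add: pdens_def)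
      show ?case
      \<comment> \<open>The distinction is made point by point; adding both outcomes gives one
        majorant valid everywhere.\<close>
      proof (cases "Y1 x \<le> E x")
        case True
        have "A x \<le> ennreal D * E x"
        proof -
          have "A x \<le> ennreal (2 powr p1) * (E x + 2 * E x)"
            using AE[of x] by (rule order_trans) (intro mult_left_mono add_left_mono True, auto)
          also have "E x + 2 * E x = 3 * E x"
            by (metis (no_types, lifting) distrib_right mult_1 numeral_Bit1 numeral_code(2) one_add_one add.commute numeral_One)
          finally show ?thesis by (simp add: D3)
        qed
        then have "pdens p1 w1 (T (piece f k)) x \<le> ennreal (2 powr (- gam * k)) * (ennreal D * E x)" if "k \<in> K" for k
          using elim(1) that by (meson mult_left_mono order_trans zero_le)
        then have "pdens p w (\<lambda>x. \<Sum>k\<in>K. T (piece f k) x) x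
          \<le> ennreal C * (ennreal d * avg0 K f x + ennreal (d powr (- gam)) * (ennreal D * E x))"
          using elim(2) by (intro C(2) d K) auto
        then show ?thesis unfolding eq by (simp add: add_increasing2)
      next
        case False
        have "A x \<le> ennreal D * Y1 x"
        proof -
          have "A x \<le> ennreal (2 powr p1) * (Y1 x + 2 * Y1 x)"
            using AE[of x] by (rule order_trans) (intro mult_left_mono add_right_mono, use False in auto)
          also have "Y1 x + 2 * Y1 x = 3 * Y1 x"
            by (metis (no_types, lifting) distrib_right mult_1 numeral_Bit1 numeral_code(2) one_add_one add.commute numeral_One)
          finally show ?thesis by (simp add: D3)
        qed
        then have "pdens p1 w1 (T (piece f k)) x \<le> ennreal (2 powr (- gam * k)) * (ennreal D * Y1 x)" if "k \<in> K" for k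
          using elim(1) that by (meson mult_left_mono order_trans zero_le)
        then have "pdens p w (\<lambda>x. \<Sum>k\<in>K. T (piece f k) x) x
          \<le> ennreal ((2 / (1 - 2 powr (- gam / p1)) * (D * card G) powr (1/p1) * (2 powr (- gam / p1)) powr int N) powr p)
             * (\<Sum>g\<in>G. pdens p w (T g) x)"
          unfolding Y1_def
          by (rule pdens_sum_decay[where u = w1 and w = w, OF exponents(2) p_pos w_pos(2) wp_pos gam_pos D0 G(1) K(1) KN K(2)])
        also have "\<dots> = ennreal \<epsilon> * Y x"
          unfolding b_def[symmetric] using b by (simp add: \<epsilon>_def L_def Y_def powr_realpow)
        finally show ?thesis unfolding eq by (simp add: add_increasing)
      qed
    qed
    then have "Phi (pdens p w (T (cut K f))) \<le> Phi (\<lambda>x. ennreal C * (ennreal d * avg0 K f x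
        + ennreal (d powr (- gam)) * (ennreal D * E x)) + ennreal \<epsilon> * Y x)"
      by (intro Phi_mono) auto
    also have "\<dots> \<le> Phi (\<lambda>x. ennreal C * (ennreal d * avg0 K f x
        + ennreal (d powr (- gam)) * (ennreal D * E x))) + Phi (\<lambda>x. ennreal \<epsilon> * Y x)"
      by (intro Phi_add) measurable
    also have "\<dots> = ennreal C * Phi (\<lambda>x. ennreal d * avg0 K f x
        + ennreal (d powr (- gam)) * (ennreal D * E x)) + ennreal \<epsilon> * Phi Y"
      by (subst (1 2) Phi_cmult) auto
    also have "\<dots> \<le> ennreal C * (Phi (\<lambda>x. ennreal d * avg0 K f x)
        + Phi (\<lambda>x. ennreal (d powr (- gam)) * (ennreal D * E x))) + ennreal \<epsilon> * Phi Y"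
      by (intro add_right_mono mult_left_mono Phi_add) auto
    also have "\<dots> = ennreal C * (ennreal d * Phi (avg0 K f) + ennreal (d powr (- gam)) * (ennreal D * Phi E)) + ennreal \<epsilon> * Phi Y"
      by (simp add: Phi_cmult)
    also have "\<dots> \<le> ennreal C * (ennreal d * ennreal (2 * C0) + ennreal (d powr (- gam)) * (ennreal D * (2 * ennreal \<eta>1))) + ennreal \<epsilon> * ennreal y"
      unfolding y(1) by (intro add_right_mono mult_left_mono add_mono PE avg0_bound[OF f K(1)]) auto
    also have "\<dots> = ennreal (C * (d * (2 * C0) + d powr (- gam) * (D * 2 * \<eta>1)) + \<epsilon> * y)"
      using C d C0 D0 y by (simp add: ennreal_mult \<epsilon>_def mult_ac)
    also have "\<dots> \<le> ennreal \<eta>"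
      using d(3) N by (intro ennreal_leI) (simp add: \<epsilon>_def)
    finally show "Phi (pdens p w (T (cut K f))) \<le> ennreal \<eta>" .
  qed
qed

end

lemma ennreal_mult_add:
  "\<lbrakk>0 \<le> a; 0 \<le> x; 0 \<le> y\<rbrakk> \<Longrightarrow> ennreal a * (ennreal x + ennreal y) = ennreal (a * (x + y))"
  by (simp add: ennreal_mult)

section \<open>Infinite tails, the middle part and sequential compactness\<close>

context compact_interpolation
begin

lemma cut_meas: "f \<in> unit_ball \<Longrightarrow> cut S f \<in> borel_measurable M"
  unfolding cut_def by (intro lmult_meas unit_ball_meas)

lemma cut_UNIV: "cut UNIV f = f"
  by (auto simp: cut_def lmult_def)

lemma cut_V:
  assumes f: "f \<in> unit_ball"
  shows "cut S f \<in> V"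
proof -
  have [measurable]: "f \<in> borel_measurable M" "cut S f \<in> borel_measurable M"
    using f by (auto intro: unit_ball_meas cut_meas)
  have "pdens p w (cut S f) x \<le> pdens p w f x" for x
    by (auto simp: pdens_def cut_def lmult_def indicator_def)
  then have "Phi (pdens p w (cut S f)) \<le> Phi (pdens p w f)"
    by (intro Phi_mono AE_I2) measurable
  also have "\<dots> \<le> 1" using f by (simp add: unit_ball_def)
  finally have "Phi (pdens p w (cut S f)) < \<infinity>" by (rule le_less_trans) simp
  then have "cut S f \<in> mspace p w" by (simp add: mspace_def)
  then show ?thesis using V_sub by blast
qed

lemma T_cut_Un:
  assumes f: "f \<in> unit_ball" and "S \<inter> R = {}"
  shows "AE x in M. T (cut (S \<union> R) f) x = T (cut S f) x + T (cut R f) x"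
proof -
  have "cut (S \<union> R) f = (\<lambda>x. cut S f x + cut R f x)"
    using assms(2) by (auto simp: cut_def lmult_def indicator_def fun_eq_iff)
  then show ?thesis using T_add[OF cut_V[OF f, of S] cut_V[OF f, of R]] by simp
qed

text \<open>If the image of the part of \<open>S\<close> left out by \<open>K m\<close> vanishes in
  some norm, the images of the finite cuts converge almost everywhere along a subsequence, and a
  uniform bound passes to the limit. The norm given by \<open>q\<close> and \<open>u\<close> may
  differ from the one being estimated, so no convergence in the target space is required.\<close>

lemma tail_limit:
  assumes f: "f \<in> unit_ball" and K: "\<And>m::nat. finite (K m)" "\<And>m. K m \<subseteq> S"
    and q: "0 < q" and u [measurable]: "u \<in> borel_measurable M" "\<And>x. 0 < u x"
    and lim: "(\<lambda>m. Phi (pdens q u (T (cut (S - K m) f)))) \<longlonglongrightarrow> 0"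
    and bnd: "\<And>m. Phi (pdens p w (T (cut (K m) f))) \<le> c"
  shows "Phi (pdens p w (T (cut S f))) \<le> c"
proof -
  have [measurable]: "T (cut S f) \<in> borel_measurable M" for S using cut_V[OF f] T_meas by blast
  obtain r :: "nat \<Rightarrow> nat" where r: "strict_mono r"
    "AE x in M. (\<lambda>m. pdens q u (T (cut (S - K (r m)) f)) x) \<longlonglongrightarrow> 0"
    by (rule Phi_tendsto_zero_AE[OF _ lim]) auto
  have split: "AE x in M. \<forall>m. T (cut S f) x = T (cut (K m) f) x + T (cut (S - K m) f) x"
    unfolding AE_all_countable
  proof
    fix m
    have "K m \<union> (S - K m) = S" using K(2) by blast
    then show "AE x in M. T (cut S f) x = T (cut (K m) f) x + T (cut (S - K m) f) x"
      using T_cut_Un[OF f, of "K m" "S - K m"] by simp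
  qed
  show ?thesis
  proof (rule Phi_limit_le[where F="\<lambda>m. pdens p w (T (cut (K (r m)) f))"])
    show "AE x in M. (\<lambda>m. pdens p w (T (cut (K (r m)) f)) x) \<longlonglongrightarrow> pdens p w (T (cut S f)) x"
      using r(2) split
    proof eventually_elim
      case (elim x)
      have "(\<lambda>m. T (cut (S - K (r m)) f) x) \<longlonglongrightarrow> 0"
        by (rule pdens_tendsto_zero[OF q u(2) elim(1)])
      then have "(\<lambda>m. T (cut S f) x - T (cut (S - K (r m)) f) x) \<longlonglongrightarrow> T (cut S f) x - 0"
        by (intro tendsto_diff tendsto_const)
      moreover have "T (cut S f) x - T (cut (S - K (r m)) f) x = T (cut (K (r m)) f) x" for m
        using elim(2) by (simp add: algebra_simps)
      ultimately have "(\<lambda>m. T (cut (K (r m)) f) x) \<longlonglongrightarrow> T (cut S f) x" by simp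
      then show ?case by (rule pdens_nonneg_tendsto[OF p_pos])
    qed
  qed (auto intro: bnd)
qed

text \<open>Levels below \<open>- (N + m + 1)\<close> carry index-0 mass at most
  \<open>(1/2)^m\<close>, and \<open>T\<close> is bounded at index 0. The \<open>Suc\<close> keeps
  the finite intervals nonempty.\<close>

lemma lower_tail:
  assumes f: "f \<in> unit_ball"
    and fin: "\<And>K. \<lbrakk>finite K; K \<noteq> {}; K \<subseteq> {..< - int N}\<rbrakk> \<Longrightarrow> Phi (pdens p w (T (cut K f))) \<le> c"
  shows "Phi (pdens p w (T (cut {..< - int N} f))) \<le> c"
proof (rule tail_limit[OF f, where K="\<lambda>m. {- int (Suc (N + m))..< - int N}" and q=p0 and u=w0])
  have bound: "Phi (pdens p0 w0 (T (cut ({..< - int N} - {- int (Suc (N + m))..< - int N}) f))) \<le> ennreal (C0 * (1/2)^m)" for m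
  proof -
    have eq: "{..< - int N} - {- int (Suc (N + m))..< - int N} = {..< - int (Suc (N + m))}" by auto
    have *: "\<bar>indicat_real {..< - int (Suc (N + m))} k\<bar> powr p0 * 2 powr (k + 1) \<le> (1/2)^m" for k
    proof (cases "k < - int (Suc (N + m))")
      case True
      then have "2 powr (k + 1) \<le> 2 powr (- real m)" by (intro powr_mono) auto
      then show ?thesis using True unfolding two_powr_minus by simp
    qed simp
    note sp = lmult_space0[OF f *]
    have "Phi (pdens p0 w0 (T (cut {..< - int (Suc (N + m))} f)))
        \<le> ennreal C0 * Phi (pdens p0 w0 (cut {..< - int (Suc (N + m))} f))"
      unfolding cut_def by (rule T_bound0[OF sp(1)])
    also have "\<dots> \<le> ennreal C0 * ennreal ((1/2)^m)"
      unfolding cut_def by (intro mult_left_mono sp) auto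
    finally show ?thesis unfolding eq using C0 by (simp add: ennreal_mult)
  qed
  have "(\<lambda>m. ennreal (C0 * (1/2)^m)) \<longlonglongrightarrow> ennreal (C0 * 0)"
    by (intro tendsto_ennrealI tendsto_mult tendsto_const LIMSEQ_power_zero) auto
  then have lim: "(\<lambda>m. ennreal (C0 * (1/2)^m)) \<longlonglongrightarrow> 0" by simp
  show "(\<lambda>m. Phi (pdens p0 w0 (T (cut ({..< - int N} - {- int (Suc (N + m))..< - int N}) f)))) \<longlonglongrightarrow> 0"
    by (rule tendsto_sandwich[OF _ always_eventually[OF allI[OF bound]] tendsto_const lim]) simp
next
  fix m
  show "Phi (pdens p w (T (cut {- int (Suc (N + m))..< - int N} f))) \<le> c" by (rule fin) auto
qed (use exponents(1) w_pos in auto)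

text \<open>The mirror image at index 1: levels above \<open>N + m + 1\<close> carry mass at most
  \<open>b^m\<close> there, and boundedness comes from \<open>T_bound1_scaled\<close>.\<close>

lemma upper_tail:
  assumes f: "f \<in> unit_ball"
    and fin: "\<And>K. \<lbrakk>finite K; K \<noteq> {}; K \<subseteq> {int N<..}\<rbrakk> \<Longrightarrow> Phi (pdens p w (T (cut K f))) \<le> c"
  shows "Phi (pdens p w (T (cut {int N<..} f))) \<le> c"
proof -
  obtain C1 :: real where C1: "0 \<le> C1"
    "\<And>f a. \<lbrakk>f \<in> mspace p1 w1; 0 < a; Phi (pdens p1 w1 f) \<le> ennreal a\<rbrakk>
       \<Longrightarrow> Phi (pdens p1 w1 (T f)) \<le> ennreal (a * C1)"
    by (rule T_bound1_scaled) blast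
  define b where "b = 2 powr (- gam)"
  have b: "0 < b" "b < 1" using gam_pos by (auto simp: b_def powr_less_one)
  show ?thesis
  proof (rule tail_limit[OF f, where K="\<lambda>m. {int N<..int (Suc (N + m))}" and q=p1 and u=w1])
    have bound: "Phi (pdens p1 w1 (T (cut ({int N<..} - {int N<..int (Suc (N + m))}) f))) \<le> ennreal (b^m * C1)" for m
    proof -
      have eq: "{int N<..} - {int N<..int (Suc (N + m))} = {int (Suc (N + m))<..}" by auto
      have *: "\<bar>indicat_real {int (Suc (N + m))<..} k\<bar> powr p1 * 2 powr (- gam * k) \<le> b^m" for k
      proof (cases "int (Suc (N + m)) < k")
        case True
        then have "real m \<le> real_of_int k" by linarith
        then have "2 powr (- gam * k) \<le> 2 powr (- gam * real m)"
          using gam_pos by (intro powr_mono) auto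
        also have "\<dots> = b ^ m"
          using b unfolding powr_realpow[symmetric, OF b(1)] by (simp add: b_def powr_powr)
        finally show ?thesis using True by simp
      qed (use b in simp)
      note sp = lmult_space1[OF f *]
      show ?thesis unfolding eq cut_def by (rule C1(2)[OF sp(1) _ sp(2)]) (use b in simp)
    qed
    have "(\<lambda>m. ennreal (b^m * C1)) \<longlonglongrightarrow> ennreal (0 * C1)"
      using b by (intro tendsto_ennrealI tendsto_mult tendsto_const LIMSEQ_power_zero) auto
  then have lim: "(\<lambda>m. ennreal (b^m * C1)) \<longlonglongrightarrow> 0" by simp
  show "(\<lambda>m. Phi (pdens p1 w1 (T (cut ({int N<..} - {int N<..int (Suc (N + m))}) f)))) \<longlonglongrightarrow> 0"
    by (rule tendsto_sandwich[OF _ always_eventually[OF allI[OF bound]] tendsto_const lim]) simp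
  next
    fix m
    show "Phi (pdens p w (T (cut {int N<..int (Suc (N + m))} f))) \<le> c" by (rule fin) auto
  qed (use exponents(2) w_pos in auto)
qed

text \<open>Cuts to finitely many levels are bounded in both endpoint spaces. Compactness makes
  differences of images small at index 1, and interpolation with a small \<open>d\<close> pays for
  the merely bounded index-0 part.\<close>

lemma middle_cauchy:
  assumes s: "\<And>n::nat. s n \<in> unit_ball" and K: "finite K" and e: "0 < \<eta>"
  obtains r :: "nat \<Rightarrow> nat" where "strict_mono r"
    "\<And>m n. Phi (pdens p w (\<lambda>x. T (cut K (s (r m))) x - T (cut K (s (r n))) x)) \<le> ennreal \<eta>"
proof -
  define h where "h n = cut K (s n)" for n
  have hm: "h n \<in> mspace p0 w0 \<inter> mspace p1 w1" for n
    unfolding h_def by (rule cut_finite_space[OF s K])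
  have Tm [measurable]: "T (h n) \<in> borel_measurable M" for n using hm V_sub T_meas by blast
  define D0 where "D0 = (\<Sum>k\<in>K. 2 powr (k + 1))"
  define D1 where "D1 = (\<Sum>k\<in>K. 2 powr (- gam * k))"
  have "D0 \<ge> 0" by (simp add: D0_def sum_nonneg)
  have h0: "Phi (pdens p0 w0 (h n)) \<le> ennreal D0" for n
    unfolding h_def cut_def
  proof (rule lmult_space0(2)[OF s])
    fix k show "\<bar>indicat_real K k\<bar> powr p0 * 2 powr (k + 1) \<le> D0"
      using K member_le_sum[of k K "\<lambda>k. 2 powr (k + 1)"] \<open>D0 \<ge> 0\<close> by (cases "k \<in> K") (auto simp: D0_def)
  qed
  have "D1 \<ge> 0" by (simp add: D1_def sum_nonneg)
  have h1: "Phi (pdens p1 w1 (h n)) \<le> ennreal D1" for n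
    unfolding h_def cut_def
  proof (rule lmult_space1(2)[OF s])
    fix k show "\<bar>indicat_real K k\<bar> powr p1 * 2 powr (- gam * k) \<le> D1"
      using K member_le_sum[of k K "\<lambda>k. 2 powr (- gam * k)"] \<open>D1 \<ge> 0\<close> by (cases "k \<in> K") (auto simp: D1_def)
  qed
  have Th0: "Phi (pdens p0 w0 (T (h n))) \<le> ennreal (C0 * D0)" for n
  proof -
    have "Phi (pdens p0 w0 (T (h n))) \<le> ennreal C0 * Phi (pdens p0 w0 (h n))"
      using hm by (intro T_bound0) auto
    also have "\<dots> \<le> ennreal C0 * ennreal D0" by (intro mult_left_mono h0) auto
    finally show ?thesis using C0 \<open>D0 \<ge> 0\<close> by (simp add: ennreal_mult)
  qed
  obtain g r where g: "g \<in> mspace p1 w1" and r: "strict_mono (r :: nat \<Rightarrow> nat)"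
    and lim: "(\<lambda>n. Phi (pdens p1 w1 (\<lambda>x. T (h (r n)) x - g x))) \<longlonglongrightarrow> 0"
    using T_compact1[of h D1] hm h1 by auto
  have gm [measurable]: "g \<in> borel_measurable M" using g by (rule mspace_meas)
  define A where "A = 2 powr p0 * (C0 * D0 + C0 * D0)"
  have A0: "A \<ge> 0" using C0 \<open>D0 \<ge> 0\<close> by (simp add: A_def)
  obtain d \<eta>1 :: real where d: "0 < d" "0 < \<eta>1" "1 * (d * A + d powr (- gam) * (2 powr p1 * 2 * \<eta>1)) \<le> \<eta>"
    using exists_small_split[OF e, of 1 A "2 powr p1 * 2"] A0 by auto
  obtain N where N: "\<And>n. n \<ge> N \<Longrightarrow> Phi (pdens p1 w1 (\<lambda>x. T (h (r n)) x - g x)) < ennreal \<eta>1"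
    using order_tendstoD(2)[OF lim, of "ennreal \<eta>1"] d by (auto simp: eventually_sequentially)
  \<comment> \<open>Dropping the first \<open>N\<close> members makes the bound hold for all pairs,
    a property that further subsequences inherit in the diagonal argument.\<close>
  define r' where "r' n = r (n + N)" for n
  have N': "Phi (pdens p1 w1 (\<lambda>x. T (h (r' n)) x - g x)) \<le> ennreal \<eta>1" for n
    using N[of "n + N"] by (simp add: r'_def)
  show ?thesis
  proof (rule that[of r'])
    show "strict_mono r'" using r by (simp add: strict_mono_def r'_def)
    fix m n
    define D where "D x = T (h (r' m)) x - T (h (r' n)) x" for x
    have [measurable]: "D \<in> borel_measurable M" unfolding D_def by measurable
    have P0: "Phi (pdens p0 w0 D) \<le> ennreal A"
    proof -
      have "Phi (pdens p0 w0 D) \<le> ennreal (2 powr p0) * (Phi (pdens p0 w0 (T (h (r' m)))) + Phi (pdens p0 w0 (T (h (r' n)))))"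
        unfolding D_def using exponents w_pos by (intro Phi_pdens_diff_le) auto
      also have "\<dots> \<le> ennreal (2 powr p0) * (ennreal (C0 * D0) + ennreal (C0 * D0))"
        by (intro mult_left_mono add_mono Th0) auto
      also have "\<dots> = ennreal A"
        unfolding A_def using C0 \<open>D0 \<ge> 0\<close> by (intro ennreal_mult_add) auto
      finally show ?thesis .
    qed
    have P1: "Phi (pdens p1 w1 D) \<le> ennreal (2 powr p1 * 2 * \<eta>1)"
    proof -
      have "Phi (pdens p1 w1 D) = Phi (pdens p1 w1 (\<lambda>x. (T (h (r' m)) x - g x) - (T (h (r' n)) x - g x)))"
        by (simp add: D_def[abs_def])
      also have "\<dots> \<le> ennreal (2 powr p1) * (Phi (pdens p1 w1 (\<lambda>x. T (h (r' m)) x - g x)) + Phi (pdens p1 w1 (\<lambda>x. T (h (r' n)) x - g x)))"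
        using exponents w_pos by (intro Phi_pdens_diff_le) auto
      also have "\<dots> \<le> ennreal (2 powr p1) * (ennreal \<eta>1 + ennreal \<eta>1)"
        by (intro mult_left_mono add_mono N') auto
      also have "\<dots> = ennreal (2 powr p1 * (\<eta>1 + \<eta>1))"
        using d by (intro ennreal_mult_add) auto
      also have "2 powr p1 * (\<eta>1 + \<eta>1) = 2 powr p1 * 2 * \<eta>1" by simp
      finally show ?thesis .
    qed
    have "Phi (pdens p w D) \<le> Phi (\<lambda>x. ennreal d * pdens p0 w0 D x + ennreal (d powr (- gam)) * pdens p1 w1 D x)"
      using pdens_interpolate[OF d(1)] by (intro Phi_mono AE_I2) auto
    also have "\<dots> \<le> Phi (\<lambda>x. ennreal d * pdens p0 w0 D x) + Phi (\<lambda>x. ennreal (d powr (- gam)) * pdens p1 w1 D x)"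
      by (intro Phi_add) measurable
    also have "\<dots> = ennreal d * Phi (pdens p0 w0 D) + ennreal (d powr (- gam)) * Phi (pdens p1 w1 D)"
      by (subst (1 2) Phi_cmult) auto
    also have "\<dots> \<le> ennreal d * ennreal A + ennreal (d powr (- gam)) * ennreal (2 powr p1 * 2 * \<eta>1)"
      by (intro add_mono mult_left_mono P0 P1) auto
    also have "\<dots> = ennreal (d * A + d powr (- gam) * (2 powr p1 * 2 * \<eta>1))"
      using A0 d by (simp add: ennreal_mult)
    also have "\<dots> \<le> ennreal \<eta>" using d by (intro ennreal_leI) simp
    finally show "Phi (pdens p w (\<lambda>x. T (cut K (s (r' m))) x - T (cut K (s (r' n))) x)) \<le> ennreal \<eta>"
      by (simp add: D_def[abs_def] h_def)
  qed
qed

text \<open>Both tails are small uniformly on the unit ball, so only the middle part requires a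
  subsequence.\<close>

lemma subsequence_nearly_constant:
  assumes e: "0 < \<eta>" and s: "\<And>n::nat. s n \<in> unit_ball"
  obtains r :: "nat \<Rightarrow> nat" where "strict_mono r"
    "\<And>m n. Phi (pdens p w (\<lambda>x. T (s (r m)) x - T (s (r n)) x)) \<le> ennreal \<eta>"
proof -
  define c where "c = 2 powr p"
  have c: "c > 0" by (simp add: c_def)
  \<comment> \<open>\<open>c\<close> is the quasi-triangle constant. It occurs once for separating
    the middle part, once for separating the two tails and once for the difference within each tail;
    \<open>c * W\<close> is the resulting total factor.\<close>
  define W where "W = 1 + c * (c * 2 + c * 2)"
  have W: "W > 0" unfolding W_def using c by (intro add_pos_pos) auto
  define \<eta>1 where "\<eta>1 = \<eta> / (c * W)"
  have e1: "\<eta>1 > 0" using e c W by (simp add: \<eta>1_def)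
  have "c * (\<eta>1 + c * (c * (\<eta>1 + \<eta>1) + c * (\<eta>1 + \<eta>1))) = \<eta>1 * (c * W)"
    by (simp add: W_def algebra_simps)
  also have "\<dots> = \<eta>" using c W by (simp add: \<eta>1_def)
  finally have e1': "c * (\<eta>1 + c * (c * (\<eta>1 + \<eta>1) + c * (\<eta>1 + \<eta>1))) = \<eta>" .
  obtain N1 :: nat where N1: "\<And>f K. \<lbrakk>f \<in> unit_ball; finite K; K \<noteq> {}; K \<subseteq> {..< - int N1}\<rbrakk>
    \<Longrightarrow> Phi (pdens p w (T (cut K f))) \<le> ennreal \<eta>1"
    by (rule lower_tail_finite[OF e1]) blast
  obtain N2 :: nat where N2: "\<And>f K. \<lbrakk>f \<in> unit_ball; finite K; K \<noteq> {}; K \<subseteq> {int N2<..}\<rbrakk>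
    \<Longrightarrow> Phi (pdens p w (T (cut K f))) \<le> ennreal \<eta>1"
    by (rule upper_tail_finite[OF e1]) blast
  define L where "L f = T (cut {..< - int N1} f)" for f
  define U where "U f = T (cut {int N2<..} f)" for f
  define Mi where "Mi f = T (cut {- int N1..int N2} f)" for f
  obtain r :: "nat \<Rightarrow> nat" where r: "strict_mono r"
    "\<And>m n. Phi (pdens p w (\<lambda>x. Mi (s (r m)) x - Mi (s (r n)) x)) \<le> ennreal \<eta>1"
    unfolding Mi_def by (rule middle_cauchy[where s = s and K = "{- int N1..int N2}", OF s _ e1]) (simp, blast)
  have meas [measurable]: "L (s n) \<in> borel_measurable M" "U (s n) \<in> borel_measurable M" "Mi (s n) \<in> borel_measurable M"
    "T (s n) \<in> borel_measurable M" for n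
    using T_meas[OF cut_V[OF s[of n]]] T_meas[OF cut_V[OF s[of n], of UNIV]]
    by (simp_all only: L_def U_def Mi_def cut_UNIV)
  have Lb: "Phi (pdens p w (L (s n))) \<le> ennreal \<eta>1" for n
    unfolding L_def by (rule lower_tail[OF s N1[OF s]])
  have Ub: "Phi (pdens p w (U (s n))) \<le> ennreal \<eta>1" for n
    unfolding U_def by (rule upper_tail[OF s N2[OF s]])
  have dec: "AE x in M. T (s n) x = Mi (s n) x + (L (s n) x + U (s n) x)" for n
  proof -
    have e1: "{- int N1..int N2} \<union> ({..< - int N1} \<union> {int N2<..}) = UNIV" by auto
    have d1: "{- int N1..int N2} \<inter> ({..< - int N1} \<union> {int N2<..}) = {}"
      and d2: "{..< - int N1} \<inter> {int N2<..} = {}" by auto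
    show ?thesis
      using T_cut_Un[OF s[of n] d1] T_cut_Un[OF s[of n] d2]
      unfolding e1 cut_UNIV by (eventually_elim) (auto simp: Mi_def L_def U_def)
  qed
  show ?thesis
  proof (rule that[OF r(1)])
    fix m n
    define D where "D F x = F (s (r m)) x - F (s (r n)) x" for F :: "('a \<Rightarrow> complex) \<Rightarrow> 'a \<Rightarrow> complex" and x
    have [measurable]: "D L \<in> borel_measurable M" "D U \<in> borel_measurable M" "D Mi \<in> borel_measurable M" "D T \<in> borel_measurable M"
      unfolding D_def by measurable
    have DL: "Phi (pdens p w (D L)) \<le> ennreal c * (ennreal \<eta>1 + ennreal \<eta>1)"
    proof -
      have "Phi (pdens p w (D L)) \<le> ennreal c * (Phi (pdens p w (L (s (r m)))) + Phi (pdens p w (L (s (r n)))))"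
        unfolding D_def c_def using p_pos wp_pos by (intro Phi_pdens_diff_le) auto
      also have "\<dots> \<le> ennreal c * (ennreal \<eta>1 + ennreal \<eta>1)" by (intro mult_left_mono add_mono Lb) auto
      finally show ?thesis .
    qed
    have DU: "Phi (pdens p w (D U)) \<le> ennreal c * (ennreal \<eta>1 + ennreal \<eta>1)"
    proof -
      have "Phi (pdens p w (D U)) \<le> ennreal c * (Phi (pdens p w (U (s (r m)))) + Phi (pdens p w (U (s (r n)))))"
        unfolding D_def c_def using p_pos wp_pos by (intro Phi_pdens_diff_le) auto
      also have "\<dots> \<le> ennreal c * (ennreal \<eta>1 + ennreal \<eta>1)" by (intro mult_left_mono add_mono Ub) auto
      finally show ?thesis .
    qed
    have DM: "Phi (pdens p w (D Mi)) \<le> ennreal \<eta>1" using r(2) by (simp add: D_def[abs_def])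
    have "Phi (pdens p w (D T)) = Phi (pdens p w (\<lambda>x. D Mi x + (D L x + D U x)))"
    proof (rule Phi_pdens_cong)
      show "AE x in M. D T x = D Mi x + (D L x + D U x)"
        using dec[of "r m"] dec[of "r n"] by eventually_elim (simp add: D_def)
    qed auto
    also have "\<dots> \<le> ennreal c * (Phi (pdens p w (D Mi)) + Phi (pdens p w (\<lambda>x. D L x + D U x)))"
      unfolding c_def using p_pos wp_pos by (intro Phi_pdens_add_le) auto
    also have "\<dots> \<le> ennreal c * (Phi (pdens p w (D Mi)) + ennreal c * (Phi (pdens p w (D L)) + Phi (pdens p w (D U))))"
      unfolding c_def using p_pos wp_pos by (intro mult_left_mono add_left_mono Phi_pdens_add_le) auto
    also have "\<dots> \<le> ennreal c * (ennreal \<eta>1 + ennreal c * (ennreal c * (ennreal \<eta>1 + ennreal \<eta>1) + ennreal c * (ennreal \<eta>1 + ennreal \<eta>1)))"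
      by (intro mult_left_mono add_mono DL DU DM) auto
    also have "\<dots> = ennreal (c * (\<eta>1 + c * (c * (\<eta>1 + \<eta>1) + c * (\<eta>1 + \<eta>1))))"
      using c e1 by (simp only: ennreal_mult_add add_nonneg_nonneg mult_nonneg_nonneg less_imp_le)
    finally show "Phi (pdens p w (\<lambda>x. T (s (r m)) x - T (s (r n)) x)) \<le> ennreal \<eta>"
      unfolding e1' by (simp add: D_def[abs_def])
  qed
qed

text \<open>A diagonal sequence over the tolerances \<open>1 / (n + 1)\<close> is Cauchy, and
  completeness supplies the limit.\<close>

theorem T_compact_unit_ball:
  assumes T_space: "\<And>f. f \<in> mspace p w \<Longrightarrow> T f \<in> mspace p w" and s: "\<And>n::nat. s n \<in> unit_ball"
  shows "\<exists>g\<in>mspace p w. \<exists>r :: nat \<Rightarrow> nat. strict_mono r \<and>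
    (\<lambda>n. Phi (pdens p w (\<lambda>x. T (s (r n)) x - g x))) \<longlonglongrightarrow> 0"
proof -
  define P where "P n r \<longleftrightarrow> (\<forall>i j. Phi (pdens p w (\<lambda>x. T (s (r i)) x - T (s (r j)) x)) \<le> ennreal (1 / real (Suc n)))"
    for n and r :: "nat \<Rightarrow> nat"
  interpret subseqs P
  proof
    fix n and r :: "nat \<Rightarrow> nat" assume "strict_mono r"
    obtain r' :: "nat \<Rightarrow> nat" where "strict_mono r'"
      "\<And>i j. Phi (pdens p w (\<lambda>x. T (s (r (r' i))) x - T (s (r (r' j))) x)) \<le> ennreal (1 / real (Suc n))"
      by (rule subsequence_nearly_constant[of "1 / real (Suc n)" "\<lambda>k. s (r k)"]) (use s in auto)
    then show "\<exists>r'. strict_mono r' \<and> P n (r \<circ> r')" by (auto simp: P_def)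
  qed
  \<comment> \<open>From position \<open>Suc k\<close> on, the diagonal sequence is a subsequence of
    the refinement that satisfies \<open>P k\<close>.\<close>
  have dP: "P k (diagseq \<circ> (+) (Suc k))" for k
    by (rule diagseq_holds) (simp add: P_def)
  have "s n \<in> mspace p w" for n
    using s[of n] by (auto simp: unit_ball_def mspace_def intro: le_less_trans)
  then have Ts: "T (s (diagseq n)) \<in> mspace p w" for n by (intro T_space)
  have "\<exists>g\<in>mspace p w. (\<lambda>n. Phi (pdens p w (\<lambda>x. T (s (diagseq n)) x - g x))) \<longlonglongrightarrow> 0"
  proof (rule mspace_complete[OF p_pos wp_meas wp_pos Ts])
    fix e :: real assume "0 < e"
    then obtain k where k: "1 / real (Suc k) < e" using nat_approx_posE by blast
    show "\<exists>N. \<forall>m\<ge>N. \<forall>n\<ge>N. Phi (pdens p w (\<lambda>x. T (s (diagseq m)) x - T (s (diagseq n)) x)) \<le> ennreal e"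
    proof (intro exI allI impI)
      fix m n assume "m \<ge> Suc k" "n \<ge> Suc k"
      then obtain i j where "m = Suc k + i" "n = Suc k + j" by (metis le_iff_add)
      then have "Phi (pdens p w (\<lambda>x. T (s (diagseq m)) x - T (s (diagseq n)) x)) \<le> ennreal (1 / real (Suc k))"
        using dP[of k] by (simp add: P_def)
      also have "\<dots> \<le> ennreal e" using k by (intro ennreal_leI) auto
      finally show "Phi (pdens p w (\<lambda>x. T (s (diagseq m)) x - T (s (diagseq n)) x)) \<le> ennreal e" .
    qed
  qed
  then show ?thesis using subseq_diagseq by blast
qed

end

section \<open>Dyadic cubes and the good-lambda inequality\<close>

text \<open>Half-open cubes are partitioned exactly by their children. The closed cubes of the
  weight conditions differ from them by null sets, see \<open>AE_cbox_hcube\<close>.\<close>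

definition hcube :: "real ^ 'n \<Rightarrow> real \<Rightarrow> (real ^ 'n) set" where
  "hcube a l = {x. \<forall>i. a $ i \<le> x $ i \<and> x $ i < a $ i + l}"

text \<open>The children are indexed by the set \<open>S\<close> of coordinates in which the upper
  half is taken, so sums over children are sums over \<open>UNIV\<close>.\<close>

definition corner :: "real ^ 'n \<Rightarrow> real \<Rightarrow> 'n set \<Rightarrow> real ^ 'n" where
  "corner a l S = (\<chi> i. a $ i + (if i \<in> S then l / 2 else 0))"

lemma hcube_UN_corner:
  assumes "0 < l"
  shows "hcube a l = (\<Union>S. hcube (corner a l S) (l / 2))"
proof (intro set_eqI iffI)
  fix x assume x: "x \<in> hcube a l"
  define S where "S = {i. a $ i + l / 2 \<le> x $ i}"
  have "a $ i \<le> x $ i" "x $ i < l + a $ i" for i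
    using x by (auto simp: hcube_def add.commute)
  then have "x \<in> hcube (corner a l S) (l / 2)"
    by (auto simp: hcube_def corner_def S_def not_le)
  then show "x \<in> (\<Union>S. hcube (corner a l S) (l / 2))" by blast
next
  fix x assume "x \<in> (\<Union>S. hcube (corner a l S) (l / 2))"
  then obtain S where S: "x \<in> hcube (corner a l S) (l / 2)" by blast
  have "a $ i \<le> x $ i \<and> x $ i < a $ i + l" for i
    using S[unfolded hcube_def corner_def, simplified, rule_format, of i] assms
    by (auto split: if_splits)
  then show "x \<in> hcube a l" by (simp add: hcube_def)
qed

lemma hcube_corner_disjoint:
  assumes "S \<noteq> R"
  shows "hcube (corner a l S) (l / 2) \<inter> hcube (corner a l R) (l / 2) = {}"
proof -
  obtain i where i: "(i \<in> S) \<noteq> (i \<in> R)" using assms by auto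
  have "x \<notin> hcube (corner a l R) (l / 2)" if x: "x \<in> hcube (corner a l S) (l / 2)" for x
    using x[unfolded hcube_def corner_def, simplified, rule_format, of i] i
    by (auto simp: hcube_def corner_def split: if_splits intro!: exI[of _ i])
  then show ?thesis by blast
qed

lemma box_subset_hcube: "box a (\<chi> i. a $ i + l) \<subseteq> hcube a l"
  by (auto simp: hcube_def mem_box_cart less_imp_le)

lemma hcube_subset_cbox: "hcube a l \<subseteq> cbox a (\<chi> i. a $ i + l)"
  by (auto simp: hcube_def mem_box_cart less_imp_le)

lemma hcube_borel: "hcube a l \<in> sets borel"
proof -
  have "hcube a l = (\<Inter>i. {x. a $ i \<le> x $ i} \<inter> {x. x $ i < a $ i + l})"
    by (auto simp: hcube_def)
  also have "\<dots> \<in> sets borel"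
    by (intro sets.countable_INT'' sets.Int borel_closed borel_open closed_Collect_le open_Collect_less
        continuous_intros) auto
  finally show ?thesis .
qed

lemma hcube_lebesgue: "hcube a l \<in> sets lebesgue"
  using hcube_borel by (rule sets_completionI_sets[of _ lborel, simplified])

lemma emeasure_cube:
  fixes a :: "real ^ 'n"
  assumes "0 \<le> l"
  shows "emeasure lebesgue (cbox a (\<chi> i. a $ i + l)) = ennreal (l ^ CARD('n))"
    "emeasure lebesgue (box a (\<chi> i. a $ i + l)) = ennreal (l ^ CARD('n))"
proof -
  have B: "(Basis :: (real ^ 'n) set) = range (\<lambda>i. axis i 1)" by (auto simp: Basis_vec_def)
  have "(\<Prod>b\<in>Basis. ((\<chi> i. a $ i + l) - a) \<bullet> b) = l ^ CARD('n)"
    unfolding B by (subst prod.reindex) (auto simp: inj_on_def axis_eq_axis inner_axis)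
  moreover have "\<forall>b\<in>Basis. a \<bullet> b \<le> (\<chi> i. a $ i + l) \<bullet> b"
    unfolding B using assms by (auto simp: inner_axis)
  ultimately show "emeasure lebesgue (cbox a (\<chi> i. a $ i + l)) = ennreal (l ^ CARD('n))"
    "emeasure lebesgue (box a (\<chi> i. a $ i + l)) = ennreal (l ^ CARD('n))"
    by (auto simp: emeasure_lborel_cbox_eq emeasure_lborel_box_eq)
qed

lemma emeasure_hcube:
  fixes a :: "real ^ 'n"
  assumes "0 \<le> l"
  shows "emeasure lebesgue (hcube a l) = ennreal (l ^ CARD('n))"
proof (rule antisym)
  show "emeasure lebesgue (hcube a l) \<le> ennreal (l ^ CARD('n))"
    unfolding emeasure_cube(1)[OF assms, of a, symmetric]
    by (rule emeasure_mono[OF hcube_subset_cbox]) simp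
  show "ennreal (l ^ CARD('n)) \<le> emeasure lebesgue (hcube a l)"
    unfolding emeasure_cube(2)[OF assms, of a, symmetric]
    by (rule emeasure_mono[OF box_subset_hcube hcube_lebesgue])
qed

lemma dist_hcube:
  fixes a :: "real ^ 'n" and l :: real
  assumes "x \<in> hcube a l" "y \<in> hcube a l"
  shows "dist x y \<le> CARD('n) * l"
proof -
  have "dist x y \<le> (\<Sum>i\<in>UNIV. \<bar>(x - y) $ i\<bar>)" unfolding dist_norm by (rule norm_le_l1_cart)
  also have "\<dots> \<le> (\<Sum>i\<in>(UNIV::'n set). l)"
  proof (rule sum_mono)
    fix i
    show "\<bar>(x - y) $ i\<bar> \<le> l"
      using assms[unfolded hcube_def, simplified] by (simp add: abs_le_iff) (smt (verit))
  qed
  finally show ?thesis by simp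
qed

text \<open>The last assumption is the A-infinity condition in its scale-invariant form;
  \<open>\<beta> < 1\<close> is the source of all geometric decay below.\<close>

locale dyadic_pair =
  fixes N :: "(real ^ 'n) measure" and \<beta> :: real
  assumes sets_N: "sets N = sets lebesgue"
    and N_finite: "\<And>a l. emeasure N (hcube a l) < \<infinity>"
    and beta: "0 < \<beta>" "\<beta> < 1"
    and A_infinity: "\<And>a l E. \<lbrakk>0 < l; E \<in> sets lebesgue; E \<subseteq> hcube a l;
        2 * emeasure lebesgue E \<le> emeasure lebesgue (hcube a l)\<rbrakk>
      \<Longrightarrow> emeasure N E \<le> ennreal \<beta> * emeasure N (hcube a l)"
begin

abbreviation "leb \<equiv> (lebesgue :: (real ^ 'n) measure)"

definition heavy :: "real \<Rightarrow> real ^ 'n \<Rightarrow> real \<Rightarrow> bool" where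
  "heavy t a l \<longleftrightarrow> emeasure N (hcube a l) > ennreal t * emeasure leb (hcube a l)"

text \<open>The union of the dyadic subcubes of generation at most \<open>m\<close> on which the average exceeds \<open>t\<close>.\<close>

primrec Om :: "nat \<Rightarrow> real \<Rightarrow> real ^ 'n \<Rightarrow> real \<Rightarrow> (real ^ 'n) set" where
  "Om 0 t a l = (if heavy t a l then hcube a l else {})"
| "Om (Suc m) t a l = (if heavy t a l then hcube a l else (\<Union>S. Om m t (corner a l S) (l / 2)))"

lemma Om_subset: "0 < l \<Longrightarrow> Om m t a l \<subseteq> hcube a l"
proof (induction m arbitrary: a l)
  case (Suc m)
  then show ?case using hcube_UN_corner[of l a] by (auto split: if_splits) (meson Suc half_gt_zero subsetD)
qed auto

lemma Om_sets: "Om m t a l \<in> sets lebesgue"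
proof (induction m arbitrary: a l)
  case (Suc m)
  then have "(\<Union>S. Om m t (corner a l S) (l / 2)) \<in> sets lebesgue" by (intro sets.finite_UN) auto
  then show ?case by (simp add: hcube_lebesgue)
qed (simp add: hcube_lebesgue)

lemma Om_mono: "0 < l \<Longrightarrow> Om m t a l \<subseteq> Om (Suc m) t a l"
proof (induction m arbitrary: a l)
  case (Suc m)
  have "Om m t (corner a l S) (l / 2) \<subseteq> Om (Suc m) t (corner a l S) (l / 2)" for S
    using Suc by simp
  then show ?case by (simp only: Om.simps(2)[of _ t a l] split: if_splits) blast
qed auto

lemma emeasure_corner_UN:
  fixes a :: "real ^ 'n" and A :: "'n set \<Rightarrow> (real ^ 'n) set"
  assumes "0 < l" "sets P = sets lebesgue" "\<And>S. A S \<in> sets lebesgue"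
    "\<And>S. A S \<subseteq> hcube (corner a l S) (l / 2)"
  shows "emeasure P (\<Union>S. A S) = (\<Sum>S\<in>UNIV. emeasure P (A S))"
proof (rule sum_emeasure[symmetric])
  show "disjoint_family_on A UNIV"
    unfolding disjoint_family_on_def
  proof (intro ballI impI)
    fix S R :: "'n set" assume "S \<noteq> R"
    then have "hcube (corner a l S) (l / 2) \<inter> hcube (corner a l R) (l / 2) = {}"
      by (rule hcube_corner_disjoint)
    then show "A S \<inter> A R = {}" using assms(4)[of S] assms(4)[of R] by blast
  qed
qed (use assms in auto)

lemma emeasure_hcube_sum:
  fixes a :: "real ^ 'n"
  assumes "0 < l" "sets P = sets lebesgue"
  shows "emeasure P (hcube a l) = (\<Sum>S\<in>UNIV. emeasure P (hcube (corner a l S) (l / 2)))"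
  unfolding hcube_UN_corner[OF assms(1), of a]
  by (rule emeasure_corner_UN[where a = a, OF assms hcube_lebesgue]) simp

lemma emeasure_Om_Suc:
  assumes "0 < l" "sets P = sets lebesgue" "\<not> heavy t a l"
  shows "emeasure P (Om (Suc m) t a l) = (\<Sum>S\<in>UNIV. emeasure P (Om m t (corner a l S) (l / 2)))"
proof -
  have "emeasure P (\<Union>S. Om m t (corner a l S) (l / 2)) = (\<Sum>S\<in>UNIV. emeasure P (Om m t (corner a l S) (l / 2)))"
    by (rule emeasure_corner_UN[where a = a, OF assms(1,2) Om_sets Om_subset]) (use assms(1) in auto)
  then show ?thesis using assms(3) by simp
qed

text \<open>The recursion stops at the first heavy cube. The stopped cubes are therefore disjoint,
  and the inequality on each of them can be added up.\<close>

lemma Om_weak_type: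
  "0 < l \<Longrightarrow> ennreal t * emeasure leb (Om m t a l) \<le> emeasure N (hcube a l)"
proof (induction m arbitrary: a l)
  case 0
  then show ?case by (auto simp: heavy_def)
next
  case (Suc m)
  show ?case
  proof (cases "heavy t a l")
    case True
    then show ?thesis by (auto simp: heavy_def)
  next
    case False
    have "ennreal t * emeasure leb (Om (Suc m) t a l)
        = (\<Sum>S\<in>UNIV. ennreal t * emeasure leb (Om m t (corner a l S) (l / 2)))"
      by (simp only: emeasure_Om_Suc[OF Suc.prems refl False] sum_distrib_left)
    also have "\<dots> \<le> (\<Sum>S\<in>UNIV. emeasure N (hcube (corner a l S) (l / 2)))"
      using Suc by (intro sum_mono) auto
    also have "\<dots> = emeasure N (hcube a l)"
      by (rule emeasure_hcube_sum[OF Suc.prems sets_N, symmetric])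
    finally show ?thesis .
  qed
qed

lemma hcube_subset_corner:
  assumes "0 < l" shows "hcube (corner a l S) (l / 2) \<subseteq> hcube a l"
  using hcube_UN_corner[OF assms] by blast

lemma half_measure:
  assumes "0 < l"
  shows "emeasure leb (hcube a l) = ennreal (2 ^ CARD('n)) * emeasure leb (hcube (corner a l S) (l / 2))"
  using assms by (simp add: emeasure_hcube ennreal_mult[symmetric] power_divide)

text \<open>The induction descends to a maximal heavy cube at height \<open>t\<close>. Its parent is
  not heavy, so its own average is at most \<open>2 ^ CARD('n) * t\<close>; this is what the
  hypothesis on the cube records. There the weak type bound at twice that height leaves at most half
  of the volume, and the A-infinity condition applies.\<close>

lemma good_lambda:
  assumes "0 < t"
  shows "\<lbrakk>0 < l; \<not> heavy (2 ^ CARD('n) * t) a l\<rbrakk>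
    \<Longrightarrow> emeasure N (Om m (2 * 2 ^ CARD('n) * t) a l) \<le> ennreal \<beta> * emeasure N (Om m t a l)"
proof (induction m arbitrary: a l)
  have top: "emeasure N (Om m (2 * 2 ^ CARD('n) * t) a l) \<le> ennreal \<beta> * emeasure N (hcube a l)"
    if l: "0 < l" and nh: "\<not> heavy (2 ^ CARD('n) * t) a l" for m a l
  proof (rule A_infinity[OF l Om_sets Om_subset[OF l]])
    define c where "c = 2 ^ CARD('n) * t"
    have c: "c > 0" using assms by (simp add: c_def)
    have "ennreal c * (2 * emeasure leb (Om m (2 * c) a l)) = ennreal (2 * c) * emeasure leb (Om m (2 * c) a l)"
      using c by (simp add: ennreal_mult mult_ac)
    also have "\<dots> \<le> emeasure N (hcube a l)" by (rule Om_weak_type[OF l])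
    also have "\<dots> \<le> ennreal c * emeasure leb (hcube a l)"
      using nh by (simp add: heavy_def c_def not_less)
    finally have "2 * emeasure leb (Om m (2 * c) a l) \<le> emeasure leb (hcube a l)"
      using c by (subst (asm) ennreal_mult_le_mult_iff) auto
    then show "2 * emeasure leb (Om m (2 * 2 ^ CARD('n) * t) a l) \<le> emeasure leb (hcube a l)"
      by (simp add: c_def mult.assoc)
  qed
  {
    case 0
    show ?case
    proof (cases "heavy t a l")
      case True
      then show ?thesis using top[OF 0, of 0] by simp
    next
      case False
      have "1 \<le> 2 * (2::real) ^ CARD('n)" using one_le_power[of "2::real" "CARD('n)"] by linarith
      then have "t \<le> 2 * 2 ^ CARD('n) * t" using assms by simp
      then have "\<not> heavy (2 * 2 ^ CARD('n) * t) a l"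
        using False unfolding heavy_def not_less by (meson ennreal_leI mult_right_mono order_trans zero_le)
      then show ?thesis by simp
    qed
  next
    case (Suc m)
    show ?case
    proof (cases "heavy t a l")
      case True
      then show ?thesis using top[OF Suc.prems, of "Suc m"] by simp
    next
      case False
      have "1 \<le> 2 * (2::real) ^ CARD('n)" using one_le_power[of "2::real" "CARD('n)"] by linarith
      then have "t \<le> 2 * 2 ^ CARD('n) * t" using assms by simp
      then have nh: "\<not> heavy (2 * 2 ^ CARD('n) * t) a l"
        using False unfolding heavy_def not_less by (meson ennreal_leI mult_right_mono order_trans zero_le)
      \<comment> \<open>A child has the fraction \<open>1 / 2 ^ CARD('n)\<close> of the volume, so
        its average is at most that multiple of the parent's.\<close>
      have ch: "\<not> heavy (2 ^ CARD('n) * t) (corner a l S) (l / 2)" for S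
      proof -
        have "emeasure N (hcube (corner a l S) (l / 2)) \<le> emeasure N (hcube a l)"
          using hcube_subset_corner[OF Suc.prems(1)] hcube_lebesgue by (intro emeasure_mono) (auto simp: sets_N)
        also have "\<dots> \<le> ennreal t * emeasure leb (hcube a l)" using False by (simp add: heavy_def not_less)
        also have "\<dots> = ennreal (2 ^ CARD('n) * t) * emeasure leb (hcube (corner a l S) (l / 2))"
          using assms by (simp add: half_measure[OF Suc.prems(1), of a S] ennreal_mult mult_ac)
        finally show ?thesis by (simp add: heavy_def not_less)
      qed
      have "emeasure N (Om (Suc m) (2 * 2 ^ CARD('n) * t) a l)
          = (\<Sum>S\<in>UNIV. emeasure N (Om m (2 * 2 ^ CARD('n) * t) (corner a l S) (l / 2)))"
        by (rule emeasure_Om_Suc[OF Suc.prems(1) sets_N nh])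
      also have "\<dots> \<le> (\<Sum>S\<in>UNIV. ennreal \<beta> * emeasure N (Om m t (corner a l S) (l / 2)))"
        using Suc ch by (intro sum_mono) auto
      also have "\<dots> = ennreal \<beta> * emeasure N (Om (Suc m) t a l)"
        by (simp only: emeasure_Om_Suc[OF Suc.prems(1) sets_N False] sum_distrib_left)
      finally show ?thesis .
    qed
  }
qed

text \<open>The union of the dyadic subcubes of generation exactly \<open>m\<close> that are contained in \<open>G\<close> and on
  which the average is at most \<open>t\<close>.\<close>

primrec light :: "nat \<Rightarrow> real \<Rightarrow> (real ^ 'n) set \<Rightarrow> real ^ 'n \<Rightarrow> real \<Rightarrow> (real ^ 'n) set" where
  "light 0 t G a l = (if \<not> heavy t a l \<and> hcube a l \<subseteq> G then hcube a l else {})"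
| "light (Suc m) t G a l = (\<Union>S. light m t G (corner a l S) (l / 2))"

lemma light_subset: "0 < l \<Longrightarrow> light m t G a l \<subseteq> hcube a l \<inter> G"
proof (induction m arbitrary: a l)
  case (Suc m)
  then have "light m t G (corner a l S) (l / 2) \<subseteq> hcube (corner a l S) (l / 2) \<inter> G" for S by simp
  then show ?case using hcube_UN_corner[OF Suc.prems, of a] by auto
qed auto

lemma light_sets: "light m t G a l \<in> sets lebesgue"
proof (induction m arbitrary: a l)
  case (Suc m)
  then have "(\<Union>S. light m t G (corner a l S) (l / 2)) \<in> sets lebesgue" by (intro sets.finite_UN) auto
  then show ?case by (simp add: hcube_lebesgue)
qed (simp add: hcube_lebesgue)

lemma light_measure: "0 < l \<Longrightarrow> emeasure N (light m t G a l) \<le> ennreal t * emeasure leb (light m t G a l)"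
proof (induction m arbitrary: a l)
  case (Suc m)
  have sum: "emeasure P (light (Suc m) t G a l) = (\<Sum>S\<in>UNIV. emeasure P (light m t G (corner a l S) (l / 2)))"
    if "sets P = sets lebesgue" for P
    unfolding light.simps
  proof (rule emeasure_corner_UN[where a = a, OF Suc.prems that light_sets])
    show "light m t G (corner a l S) (l / 2) \<subseteq> hcube (corner a l S) (l / 2)" for S
      using light_subset[of "l / 2" m t G "corner a l S"] Suc.prems by auto
  qed
  show ?case
    unfolding sum[OF sets_N] sum[OF refl] sum_distrib_left using Suc by (intro sum_mono) auto
qed (auto simp: heavy_def not_less)

text \<open>The cube of generation \<open>m\<close> around \<open>x\<close> has diameter at most
  \<open>CARD('n)\<close> times its side, hence lies in the ball; it is not heavy, since otherwise
  \<open>x\<close> would belong to \<open>Om m t a l\<close>.\<close>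

lemma mem_light:
  "\<lbrakk>0 < l; x \<in> hcube a l; x \<notin> Om m t a l; ball x r \<subseteq> G; CARD('n) * (l / 2 ^ m) < r\<rbrakk>
    \<Longrightarrow> x \<in> light m t G a l"
proof (induction m arbitrary: a l)
  case 0
  have "hcube a l \<subseteq> ball x r"
    using dist_hcube[of x a l] 0 by fastforce
  then show ?case using 0 by (auto split: if_splits)
next
  case (Suc m)
  obtain S where S: "x \<in> hcube (corner a l S) (l / 2)"
    using Suc.prems hcube_UN_corner[of l a] by blast
  have "x \<notin> Om m t (corner a l S) (l / 2)"
    using Suc.prems by (auto split: if_splits)
  then have "x \<in> light m t G (corner a l S) (l / 2)"
    using Suc S by (intro Suc.IH) (auto simp: divide_divide_eq_left)
  then show ?case by auto
qed

text \<open>The level set of the dyadic maximal function of \<open>N\<close>, localised to the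
  cube.\<close>

definition Omega :: "real \<Rightarrow> real ^ 'n \<Rightarrow> real \<Rightarrow> (real ^ 'n) set" where
  "Omega t a l = (\<Union>m. Om m t a l)"

lemma Omega_sets: "Omega t a l \<in> sets lebesgue"
  unfolding Omega_def by (intro sets.countable_UN') (auto intro: Om_sets)

lemma Omega_subset: "0 < l \<Longrightarrow> Omega t a l \<subseteq> hcube a l"
  unfolding Omega_def using Om_subset by blast

lemma Omega_measure: "0 < l \<Longrightarrow> emeasure N (Omega t a l) = (SUP m. emeasure N (Om m t a l))"
  unfolding Omega_def
  by (rule SUP_emeasure_incseq[symmetric]) (auto simp: sets_N Om_sets incseq_Suc_iff Om_mono simp del: Om.simps)

lemma Omega_good_lambda:
  assumes "0 < t" "0 < l" "\<not> heavy (2 ^ CARD('n) * t) a l"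
  shows "emeasure N (Omega (2 * 2 ^ CARD('n) * t) a l) \<le> ennreal \<beta> * emeasure N (Omega t a l)"
  unfolding Omega_measure[OF assms(2)] SUP_mult_left_ennreal
  by (intro SUP_mono) (use good_lambda[OF assms] in blast)

text \<open>The part of Lebesgue's differentiation theorem that is needed: off the dyadic level set
  of height \<open>t\<close> the density is at most \<open>t\<close>.\<close>

lemma measure_off_Omega_le:
  assumes l: "0 < l" and E: "E \<in> sets lebesgue" "E \<subseteq> hcube a l - Omega t a l"
  shows "emeasure N E \<le> ennreal t * emeasure leb E"
proof (cases "emeasure N E = 0")
  case False
  \<comment> \<open>By outer regularity a comparison with open supersets of \<open>E\<close> is
    enough. Small dyadic cubes around points of \<open>E\<close> lie inside \<open>G\<close> and are
    not heavy.\<close>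
  have le: "emeasure N E \<le> ennreal t * emeasure leb G" if G: "open G" "E \<subseteq> G" for G
  proof -
    \<comment> \<open>These sets increase with \<open>k\<close> and cover \<open>E\<close>: by
      \<open>mem_light\<close> each point of \<open>E\<close> is in \<open>light m t G a l\<close>
      for all large \<open>m\<close>.\<close>
    define B where "B k = (\<Inter>m\<in>{k..}. light m t G a l)" for k
    have Bs: "B k \<in> sets lebesgue" for k
      unfolding B_def by (intro sets.countable_INT'') (auto intro: light_sets)
    have "E \<subseteq> (\<Union>k. B k)"
    proof
      fix x assume x: "x \<in> E"
      obtain r where r: "r > 0" "ball x r \<subseteq> G" using G x openE by blast
      have "(\<lambda>m. CARD('n) * (l * (1/2) ^ m)) \<longlonglongrightarrow> CARD('n) * (l * 0)"
        by (intro tendsto_mult tendsto_const LIMSEQ_power_zero) auto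
      then have "\<forall>\<^sub>F m in sequentially. CARD('n) * (l * (1/2) ^ m) < r"
        using r(1) by (intro order_tendstoD(2)) auto
      then obtain k where k: "\<And>m. m \<ge> k \<Longrightarrow> CARD('n) * (l / 2 ^ m) < r"
        by (auto simp: eventually_sequentially power_one_over)
      have "x \<in> B k"
        unfolding B_def using x E(2) r k by (auto simp: Omega_def intro!: mem_light[OF l])
      then show "x \<in> (\<Union>k. B k)" by blast
    qed
    then have "emeasure N E \<le> emeasure N (\<Union>k. B k)"
      using Bs by (intro emeasure_mono) (auto simp: sets_N)
    also have "\<dots> = (SUP k. emeasure N (B k))"
      using Bs by (intro SUP_emeasure_incseq[symmetric]) (auto simp: sets_N incseq_def B_def)
    also have "\<dots> \<le> ennreal t * emeasure leb G"
    proof (rule SUP_least)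
      fix k
      have "emeasure N (B k) \<le> emeasure N (light k t G a l)"
        by (intro emeasure_mono) (auto simp: B_def sets_N light_sets)
      also have "\<dots> \<le> ennreal t * emeasure leb (light k t G a l)" by (rule light_measure[OF l])
      also have "\<dots> \<le> ennreal t * emeasure leb G"
        using light_subset[OF l] G(1) by (intro mult_left_mono emeasure_mono) auto
      finally show "emeasure N (B k) \<le> ennreal t * emeasure leb G" .
    qed
    finally show ?thesis .
  qed
  have Efin: "emeasure leb E < \<infinity>"
  proof -
    have "emeasure leb E \<le> emeasure leb (hcube a l)"
      using E hcube_lebesgue by (intro emeasure_mono) auto
    then show ?thesis using l by (auto simp: emeasure_hcube intro: le_less_trans)
  qed
  show ?thesis
  proof (rule ennreal_le_epsilon)
    fix e :: real assume e: "0 < e"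
    define d where "d = e / (\<bar>t\<bar> + 1)"
    have d: "d > 0" using e by (simp add: d_def add_nonneg_pos)
    obtain G where G: "open G" "E \<subseteq> G" "G - E \<in> lmeasurable" "emeasure leb (G - E) < ennreal d"
      using sets_lebesgue_outer_open[OF E(1) d] by blast
    have "emeasure leb G = emeasure leb (E \<union> (G - E))" using G(2) by (simp add: Un_absorb1)
    also have "\<dots> \<le> emeasure leb E + emeasure leb (G - E)"
      using E(1) G(3) by (intro emeasure_subadditive) (auto simp: fmeasurable_def)
    also have "\<dots> \<le> emeasure leb E + ennreal d" using G(4) by (intro add_left_mono) auto
    finally have "emeasure N E \<le> ennreal t * (emeasure leb E + ennreal d)"
      using le[OF G(1,2)] by (meson mult_left_mono order_trans zero_le)
    also have "\<dots> = ennreal t * emeasure leb E + ennreal t * ennreal d" by (rule distrib_left)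
    also have "ennreal t * ennreal d \<le> ennreal e"
    proof -
      have "ennreal t * ennreal d \<le> ennreal \<bar>t\<bar> * ennreal d" by (intro mult_right_mono ennreal_leI) auto
      also have "\<dots> = ennreal (\<bar>t\<bar> * d)" using d by (simp add: ennreal_mult)
      also have "\<bar>t\<bar> * d \<le> e"
      proof -
        have "\<bar>t\<bar> * d \<le> (\<bar>t\<bar> + 1) * d" using d by (intro mult_right_mono) auto
        also have "\<dots> = e" by (simp add: d_def add_nonneg_pos less_imp_neq[symmetric])
        finally show ?thesis .
      qed
      finally show ?thesis by (simp add: ennreal_leI)
    qed
    finally show "emeasure N E \<le> ennreal t * emeasure leb E + ennreal e" by (simp add: add_left_mono)
  qed
qed simp

end

section \<open>Reverse Hoelder inequality\<close>

lemma sum_geometric_ennreal: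
  assumes "0 \<le> c" "0 \<le> q" "q < 1"
  shows "(\<Sum>k. ennreal (c * q ^ k)) = ennreal (c / (1 - q))"
proof -
  have "(\<lambda>k. c * q ^ k) sums (c * (1 / (1 - q)))"
    using assms by (intro sums_mult geometric_sums) auto
  then show ?thesis using assms by (intro suminf_ennreal_eq) auto
qed

text \<open>The integral is split at the heights \<open>\<Lambda> ^ k * t0\<close>. Iterating the
  good-lambda inequality shrinks the mass of the level sets by \<beta> per step, while the power
  gains \<open>\<Lambda> powr \<epsilon>\<close>; the condition on \<epsilon> makes the series
  converge. In \<open>K\<close> the 1 stands for the points with \<open>U x \<le> t0\<close> and the
  quotient is the geometric sum.\<close>

lemma reverse_hoelder_dyadic:
  fixes U :: "real ^ 'n \<Rightarrow> real"
  assumes U [measurable]: "U \<in> borel_measurable lebesgue" and U0: "\<And>x. 0 \<le> U x"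
    and dp: "dyadic_pair (density lebesgue (\<lambda>x. ennreal (U x))) \<beta>"
    and eps: "0 < \<epsilon>" "(2 * 2 ^ CARD('n)) powr \<epsilon> * \<beta> < 1"
    and l: "0 < l" and t0: "0 < t0"
    and avg: "(\<integral>\<^sup>+x\<in>hcube a l. ennreal (U x) \<partial>lebesgue) \<le> ennreal t0 * emeasure lebesgue (hcube a l)"
  defines "K \<equiv> 1 + (2 * 2 ^ CARD('n)) powr \<epsilon> / (1 - (2 * 2 ^ CARD('n)) powr \<epsilon> * \<beta>)"
  shows "(\<integral>\<^sup>+x\<in>hcube a l. ennreal (U x powr (1 + \<epsilon>)) \<partial>lebesgue)
    \<le> ennreal (K * t0 powr \<epsilon>) * (\<integral>\<^sup>+x\<in>hcube a l. ennreal (U x) \<partial>lebesgue)"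
proof -
  define N where "N = density lebesgue (\<lambda>x. ennreal (U x))"
  interpret dyadic_pair N \<beta> using dp by (simp add: N_def)
  have emN: "emeasure N A = (\<integral>\<^sup>+x\<in>A. ennreal (U x) \<partial>lebesgue)" if "A \<in> sets lebesgue" for A
    unfolding N_def using that by (intro emeasure_density) auto
  define \<Lambda> where "\<Lambda> = 2 * (2::real) ^ CARD('n)"
  have Lam: "\<Lambda> > 1" unfolding \<Lambda>_def using one_le_power[of "2::real" "CARD('n)"] by linarith
  define q where "q = \<Lambda> powr \<epsilon> * \<beta>"
  have q: "0 \<le> q" "q < 1" using eps(2) beta by (auto simp: q_def \<Lambda>_def)
  define tk where "tk k = \<Lambda> ^ k * t0" for k :: nat
  have tk: "tk k > 0" for k using Lam t0 by (simp add: tk_def)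
  have nh0: "\<not> heavy t0 a l" using avg emN[OF hcube_lebesgue] by (simp add: heavy_def not_less)
  have nh: "\<not> heavy (2 ^ CARD('n) * tk k) a l" for k
  proof -
    have "1 \<le> (2::real) ^ CARD('n)" "1 \<le> \<Lambda> ^ k" using Lam by (auto intro: one_le_power)
    then have "1 * t0 \<le> (2 ^ CARD('n) * \<Lambda> ^ k) * t0"
      using t0 by (intro mult_right_mono mult_ge1_I) auto
    then have "ennreal t0 \<le> ennreal (2 ^ CARD('n) * tk k)" by (intro ennreal_leI) (simp add: tk_def mult.assoc)
    then show ?thesis
      using nh0 unfolding heavy_def not_less by (meson mult_right_mono order_trans zero_le)
  qed
  let ?Q = "hcube a l"
  have decay: "emeasure N (Omega (tk k) a l) \<le> ennreal (\<beta> ^ k) * emeasure N ?Q" for k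
  proof (induction k)
    case 0
    show ?case using Omega_subset[OF l] by (simp add: emeasure_mono sets_N hcube_lebesgue)
  next
    case (Suc k)
    have "emeasure N (Omega (2 * 2 ^ CARD('n) * tk k) a l) \<le> ennreal \<beta> * emeasure N (Omega (tk k) a l)"
      by (rule Omega_good_lambda[OF tk l nh])
    also have "\<dots> \<le> ennreal \<beta> * (ennreal (\<beta> ^ k) * emeasure N ?Q)"
      by (intro mult_left_mono Suc.IH) auto
    also have "\<dots> = ennreal (\<beta> ^ Suc k) * emeasure N ?Q"
      using beta by (simp add: ennreal_mult mult.assoc)
    finally show ?case by (simp add: tk_def \<Lambda>_def mult.assoc)
  qed
  \<comment> \<open>Off the level set, the part where \<open>U\<close> exceeds
    \<open>t + 1 / (n + 1)\<close> has mass at least that multiple of its volume, and at most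
    \<open>t\<close> times its volume by \<open>measure_off_Omega_le\<close>; so it is a null
    set.\<close>
  have off: "AE x in lebesgue. x \<in> ?Q \<longrightarrow> x \<notin> Omega t a l \<longrightarrow> U x \<le> t" if t: "t > 0" for t
  proof -
    have "AE x in lebesgue. x \<in> ?Q \<longrightarrow> x \<notin> Omega t a l \<longrightarrow> U x \<le> t + 1 / real (Suc n)" for n
    proof -
      define e where "e = 1 / real (Suc n)"
      have e: "e > 0" by (simp add: e_def)
      define E where "E = (?Q - Omega t a l) \<inter> {x. U x > t + e}"
      have Es: "E \<in> sets lebesgue"
      proof -
        have "{x \<in> space lebesgue. U x > t + e} \<in> sets lebesgue" by measurable
        then show ?thesis unfolding E_def by (intro sets.Int sets.Diff hcube_lebesgue Omega_sets) simp
      qed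
      have fin: "emeasure lebesgue E \<noteq> \<infinity>"
      proof -
        have "emeasure lebesgue E \<le> emeasure lebesgue ?Q"
          by (intro emeasure_mono hcube_lebesgue) (auto simp: E_def)
        then show ?thesis using l by (auto simp: emeasure_hcube top_unique)
      qed
      have "ennreal (t + e) * emeasure lebesgue E = (\<integral>\<^sup>+x\<in>E. ennreal (t + e) \<partial>lebesgue)"
        using Es by (simp add: nn_integral_cmult_indicator)
      also have "\<dots> \<le> (\<integral>\<^sup>+x\<in>E. ennreal (U x) \<partial>lebesgue)"
        by (intro nn_integral_mono) (auto simp: E_def indicator_def intro!: ennreal_leI)
      also have "\<dots> = emeasure N E" by (rule emN[OF Es, symmetric])
      also have "\<dots> \<le> ennreal t * emeasure lebesgue E"
        by (rule measure_off_Omega_le[OF l Es]) (auto simp: E_def)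
      finally have le: "ennreal (t + e) * emeasure lebesgue E \<le> ennreal t * emeasure lebesgue E" .
      obtain m where m: "emeasure lebesgue E = ennreal m" "0 \<le> m" using fin by (cases "emeasure lebesgue E") auto
      have "ennreal ((t + e) * m) \<le> ennreal (t * m)"
        using le t e m(2) unfolding m(1) by (subst (1 2) ennreal_mult) auto
      then have "(t + e) * m \<le> t * m"
        using t m(2) by (subst (asm) ennreal_le_iff) auto
      then have "e * m \<le> 0" by (simp add: algebra_simps)
      then have "m = 0" using e m(2) by (simp add: mult_le_0_iff)
      then have "E \<in> null_sets lebesgue" using Es m by auto
      then have "AE x in lebesgue. x \<notin> E" by (rule AE_not_in)
      then show ?thesis by eventually_elim (auto simp: E_def e_def)
    qed
    then have "AE x in lebesgue. \<forall>n. x \<in> ?Q \<longrightarrow> x \<notin> Omega t a l \<longrightarrow> U x \<le> t + 1 / real (Suc n)"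
      unfolding AE_all_countable by blast
    then show ?thesis
    proof eventually_elim
      case (elim x)
      show ?case
      proof (intro impI, rule field_le_epsilon)
        fix e :: real assume x: "x \<in> ?Q" "x \<notin> Omega t a l" and "0 < e"
        then obtain n where "1 / real (Suc n) < e" using nat_approx_posE by blast
        then show "U x \<le> t + e" using elim[rule_format, of n] x by linarith
      qed
    qed
  qed
  \<comment> \<open>The first term covers \<open>U x \<le> t0\<close>. If \<open>Suc k\<close> is
    the first index with \<open>U x \<le> tk (Suc k)\<close>, then almost surely \<open>x\<close> is
    in the level set of height \<open>tk k\<close>, and the \<open>k\<close>-th term of the series
    is large enough.\<close>
  define g where "g x = ennreal (t0 powr \<epsilon>) * ennreal (U x) * indicator ?Q x
      + (\<Sum>k. ennreal (tk (Suc k) powr \<epsilon>) * (ennreal (U x) * indicator (Omega (tk k) a l) x))" for x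
  have "AE x in lebesgue. \<forall>k. x \<in> ?Q \<longrightarrow> x \<notin> Omega (tk k) a l \<longrightarrow> U x \<le> tk k"
    using off[OF tk] unfolding AE_all_countable by blast
  then have "AE x in lebesgue. ennreal (U x powr (1 + \<epsilon>)) * indicator ?Q x \<le> g x"
  proof eventually_elim
    case (elim x)
    show ?case
    proof (cases "x \<in> ?Q")
      case True
      have split: "ennreal (U x powr (1 + \<epsilon>)) = ennreal (U x powr \<epsilon>) * ennreal (U x)"
        using U0[of x] by (cases "U x = 0") (auto simp: powr_add ennreal_mult[symmetric] mult.commute)
      have "\<exists>k. U x \<le> tk k"
      proof -
        obtain k where "U x / t0 < \<Lambda> ^ k" using real_arch_pow[OF Lam] by blast
        then have "U x \<le> tk k" using t0 by (simp add: tk_def field_simps)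
        then show ?thesis ..
      qed
      then obtain k where k: "U x \<le> tk k" "\<And>j. j < k \<Longrightarrow> \<not> U x \<le> tk j"
        using that[of "LEAST k. U x \<le> tk k"] by (meson LeastI_ex not_less_Least)
      show ?thesis
      proof (cases k)
        case 0
        then have "U x powr \<epsilon> \<le> t0 powr \<epsilon>"
          using k U0[of x] eps by (intro powr_mono2) (auto simp: tk_def)
        then have "ennreal (U x powr \<epsilon>) * ennreal (U x) \<le> ennreal (t0 powr \<epsilon>) * ennreal (U x)"
          by (intro mult_right_mono ennreal_leI) auto
        then show ?thesis unfolding split g_def using True by (simp add: add_increasing2)
      next
        case (Suc j)
        then have xo: "x \<in> Omega (tk j) a l" using k(2)[of j] elim True by auto
        have "U x powr \<epsilon> \<le> tk (Suc j) powr \<epsilon>"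
          using k(1) Suc U0[of x] eps by (intro powr_mono2) auto
        then have "ennreal (U x powr \<epsilon>) * ennreal (U x) \<le> ennreal (tk (Suc j) powr \<epsilon>) * (ennreal (U x) * indicator (Omega (tk j) a l) x)"
          using xo by (auto intro!: mult_right_mono ennreal_leI)
        also have "\<dots> \<le> (\<Sum>k. ennreal (tk (Suc k) powr \<epsilon>) * (ennreal (U x) * indicator (Omega (tk k) a l) x))"
          using sum_le_suminf[of "\<lambda>k. ennreal (tk (Suc k) powr \<epsilon>) * (ennreal (U x) * indicator (Omega (tk k) a l) x)" "{j}"] by simp
        finally show ?thesis unfolding split g_def using True by (simp add: add_increasing)
      qed
    qed simp
  qed
  then have "(\<integral>\<^sup>+x\<in>?Q. ennreal (U x powr (1 + \<epsilon>)) \<partial>lebesgue) \<le> (\<integral>\<^sup>+x. g x \<partial>lebesgue)"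
    by (rule nn_integral_mono_AE)
  also have "\<dots> = ennreal (t0 powr \<epsilon>) * emeasure N ?Q
      + (\<Sum>k. ennreal (tk (Suc k) powr \<epsilon>) * emeasure N (Omega (tk k) a l))"
  proof -
    have [measurable]: "?Q \<in> sets lebesgue" "Omega t a l \<in> sets lebesgue" for t
      by (rule hcube_lebesgue, rule Omega_sets)
    show ?thesis
      unfolding g_def emN[OF hcube_lebesgue] emN[OF Omega_sets]
      by (subst nn_integral_add) (simp_all add: nn_integral_suminf nn_integral_cmult mult.assoc)
  qed
  also have "\<dots> \<le> ennreal (t0 powr \<epsilon>) * emeasure N ?Q
      + (\<Sum>k. ennreal (t0 powr \<epsilon> * \<Lambda> powr \<epsilon> * q ^ k) * emeasure N ?Q)"
  proof (intro add_left_mono suminf_le)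
    fix k
    have "\<Lambda> ^ Suc k = \<Lambda> powr (real (Suc k))" using Lam by (intro powr_realpow[symmetric]) auto
    then have "tk (Suc k) powr \<epsilon> = \<Lambda> powr (\<epsilon> * real (Suc k)) * t0 powr \<epsilon>"
      using Lam t0 unfolding tk_def by (simp only: powr_mult powr_powr mult.commute)
    also have "\<Lambda> powr (\<epsilon> * real (Suc k)) = (\<Lambda> powr \<epsilon>) ^ Suc k"
      using Lam by (simp only: powr_powr[symmetric] powr_realpow[of "\<Lambda> powr \<epsilon>"] powr_gt_zero)
    finally have tke: "tk (Suc k) powr \<epsilon> = t0 powr \<epsilon> * \<Lambda> powr \<epsilon> * (\<Lambda> powr \<epsilon>) ^ k" by simp
    have "ennreal (tk (Suc k) powr \<epsilon>) * emeasure N (Omega (tk k) a l)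
        \<le> ennreal (tk (Suc k) powr \<epsilon>) * (ennreal (\<beta> ^ k) * emeasure N ?Q)"
      by (intro mult_left_mono decay) auto
    also have "\<dots> = ennreal (tk (Suc k) powr \<epsilon> * \<beta> ^ k) * emeasure N ?Q"
      using beta by (simp add: ennreal_mult mult.assoc)
    also have "tk (Suc k) powr \<epsilon> * \<beta> ^ k = t0 powr \<epsilon> * \<Lambda> powr \<epsilon> * q ^ k"
      unfolding tke q_def power_mult_distrib by simp
    finally show "ennreal (tk (Suc k) powr \<epsilon>) * emeasure N (Omega (tk k) a l)
        \<le> ennreal (t0 powr \<epsilon> * \<Lambda> powr \<epsilon> * q ^ k) * emeasure N ?Q" .
  qed auto
  also have "\<dots> = (ennreal (t0 powr \<epsilon>) + ennreal (t0 powr \<epsilon> * \<Lambda> powr \<epsilon> / (1 - q))) * emeasure N ?Q"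
  proof -
    have "(\<Sum>k. ennreal (t0 powr \<epsilon> * \<Lambda> powr \<epsilon> * q ^ k)) = ennreal (t0 powr \<epsilon> * \<Lambda> powr \<epsilon> / (1 - q))"
      using q by (intro sum_geometric_ennreal) auto
    then show ?thesis by (simp only: ennreal_suminf_multc distrib_right)
  qed
  also have "ennreal (t0 powr \<epsilon>) + ennreal (t0 powr \<epsilon> * \<Lambda> powr \<epsilon> / (1 - q)) = ennreal (K * t0 powr \<epsilon>)"
  proof -
    have "K = 1 + \<Lambda> powr \<epsilon> / (1 - q)" by (simp add: K_def \<Lambda>_def q_def)
    then have "t0 powr \<epsilon> + t0 powr \<epsilon> * \<Lambda> powr \<epsilon> / (1 - q) = K * t0 powr \<epsilon>"
      by (simp add: distrib_right)
    then show ?thesis using q by (subst ennreal_plus[symmetric]) auto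
  qed
  finally show ?thesis unfolding emN[OF hcube_lebesgue] .
qed

text \<open>For \<open>e > 0\<close> this bounds the normalised \<open>L\<close>-norm of \<open>f\<close> over \<open>Q\<close> with exponent \<open>1 / e\<close> by \<open>a\<close>;
  \<open>e = 0\<close> encodes the exponent \<open>\<infinity>\<close>.\<close>

definition mean_le :: "(real ^ 'n) set \<Rightarrow> real \<Rightarrow> (real ^ 'n \<Rightarrow> real) \<Rightarrow> real \<Rightarrow> bool" where
  "mean_le Q e f a \<longleftrightarrow>
     (if e = 0 then AE x in lebesgue. x \<in> Q \<longrightarrow> f x \<le> a
      else (\<integral>\<^sup>+x\<in>Q. ennreal (f x powr (1 / e)) \<partial>lebesgue) \<le> ennreal (a powr (1 / e)) * emeasure lebesgue Q)"

text \<open>With reciprocal exponents Hoelder's inequality adds exponents linearly, which reduces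
  the extrapolation of weights to linear algebra. After normalisation by \<open>a\<close> and
  \<open>b\<close> it is Young's inequality, integrated. The endpoint \<open>e2 = 0\<close> is
  included for the limiting weight conditions at \<open>p1 = p_minus\<close> and
  \<open>p1 = p_plus\<close>.\<close>

lemma mean_le_hoelder:
  fixes f g :: "real ^ 'n \<Rightarrow> real"
  assumes f: "mean_le Q e1 f a" and g: "mean_le Q e2 g b"
    and pos: "0 < a" "0 < b" "\<And>z. 0 < f z" "\<And>z. 0 < g z"
    and [measurable]: "f \<in> borel_measurable lebesgue" "g \<in> borel_measurable lebesgue" "Q \<in> sets lebesgue"
    and e: "0 < e1" "0 \<le> e2" "0 < x" "0 \<le> y"
  shows "mean_le Q (x * e1 + y * e2) (\<lambda>z. f z powr x * g z powr y) (a powr x * b powr y)"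
proof -
  define e where "e = x * e1 + y * e2"
  have epos: "e > 0" using e by (auto simp: e_def intro: add_pos_nonneg)
  define A where "A = (a powr x * b powr y) powr (1 / e)"
  define \<theta> where "\<theta> = x * e1 / e"
  have th: "0 < \<theta>" "\<theta> \<le> 1" "1 - \<theta> = y * e2 / e"
    using e epos by (auto simp: \<theta>_def e_def field_simps)
  have A: "A = a powr (x / e) * b powr (y / e)" "A > 0"
    using pos by (auto simp: A_def powr_mult powr_powr)
  have scaled: "(u / c) powr r = c powr (- r) * u powr r" if "0 < c" "0 \<le> u" for u c r :: real
    using that by (simp add: powr_divide powr_minus field_simps)
  have int1: "(\<integral>\<^sup>+z\<in>Q. ennreal ((f z / a) powr (1 / e1)) \<partial>lebesgue) \<le> emeasure lebesgue Q"
  proof -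
    have "(\<integral>\<^sup>+z\<in>Q. ennreal ((f z / a) powr (1 / e1)) \<partial>lebesgue)
        = (\<integral>\<^sup>+z. ennreal (a powr (- (1 / e1))) * (ennreal (f z powr (1 / e1)) * indicator Q z) \<partial>lebesgue)"
      using pos(1) pos(3) by (intro nn_integral_cong) (simp add: scaled less_imp_le ennreal_mult mult.assoc)
    also have "\<dots> = ennreal (a powr (- (1 / e1))) * (\<integral>\<^sup>+z\<in>Q. ennreal (f z powr (1 / e1)) \<partial>lebesgue)"
      by (rule nn_integral_cmult) measurable
    also have "\<dots> \<le> ennreal (a powr (- (1 / e1))) * (ennreal (a powr (1 / e1)) * emeasure lebesgue Q)"
      using f e by (intro mult_left_mono) (auto simp: mean_le_def)
    also have "\<dots> = ennreal (a powr (- (1 / e1)) * a powr (1 / e1)) * emeasure lebesgue Q"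
      by (simp add: ennreal_mult mult.assoc)
    also have "a powr (- (1 / e1)) * a powr (1 / e1) = 1" using pos by (simp add: powr_add[symmetric])
    finally show ?thesis by simp
  qed
  have factor: "(f z powr x * g z powr y) powr (1 / e) = A * ((f z / a) powr (x / e) * (g z / b) powr (y / e))" for z
    using pos(1,2) pos(3,4)[of z] by (simp add: A powr_mult powr_powr powr_divide)
  have X: "(f z / a) powr (x / e) = ((f z / a) powr (1 / e1)) powr \<theta>" for z
    using e by (simp add: powr_powr \<theta>_def)
  have "(\<integral>\<^sup>+z\<in>Q. ennreal ((f z powr x * g z powr y) powr (1 / e)) \<partial>lebesgue) \<le> ennreal A * emeasure lebesgue Q"
  proof (cases "e2 = 0")
    case True
    then have th1: "\<theta> = 1" using th by simp
    have "AE z in lebesgue. ennreal ((f z powr x * g z powr y) powr (1 / e)) * indicator Q z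
        \<le> ennreal A * (ennreal ((f z / a) powr (1 / e1)) * indicator Q z)"
      using g[unfolded mean_le_def] True
    proof simp
      assume "AE z in lebesgue. z \<in> Q \<longrightarrow> g z \<le> b"
      then show ?thesis
      proof eventually_elim
        case (elim z)
        have "(g z / b) powr (y / e) \<le> 1" if "z \<in> Q"
          using elim that pos(2) pos(4)[of z] e epos by (intro powr_le1) auto
        then have "A * ((f z / a) powr (1 / e1) * (g z / b) powr (y / e)) \<le> A * ((f z / a) powr (1 / e1) * 1)" if "z \<in> Q"
          using that A by (intro mult_left_mono) auto
        then show ?case
          unfolding factor X th1 using A(2) by (auto simp: indicator_def ennreal_mult[symmetric] intro!: ennreal_leI)
      qed
    qed
    then have "(\<integral>\<^sup>+z\<in>Q. ennreal ((f z powr x * g z powr y) powr (1 / e)) \<partial>lebesgue)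
        \<le> (\<integral>\<^sup>+z. ennreal A * (ennreal ((f z / a) powr (1 / e1)) * indicator Q z) \<partial>lebesgue)"
      by (rule nn_integral_mono_AE)
    also have "\<dots> = ennreal A * (\<integral>\<^sup>+z\<in>Q. ennreal ((f z / a) powr (1 / e1)) \<partial>lebesgue)"
      by (rule nn_integral_cmult) measurable
    also have "\<dots> \<le> ennreal A * emeasure lebesgue Q" by (intro mult_left_mono int1) auto
    finally show ?thesis .
  next
    case False
    then have e2: "e2 > 0" using e by simp
    have int2: "(\<integral>\<^sup>+z\<in>Q. ennreal ((g z / b) powr (1 / e2)) \<partial>lebesgue) \<le> emeasure lebesgue Q"
    proof -
      have "(\<integral>\<^sup>+z\<in>Q. ennreal ((g z / b) powr (1 / e2)) \<partial>lebesgue)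
          = (\<integral>\<^sup>+z. ennreal (b powr (- (1 / e2))) * (ennreal (g z powr (1 / e2)) * indicator Q z) \<partial>lebesgue)"
        using pos(2) pos(4) by (intro nn_integral_cong) (simp add: scaled less_imp_le ennreal_mult mult.assoc)
      also have "\<dots> = ennreal (b powr (- (1 / e2))) * (\<integral>\<^sup>+z\<in>Q. ennreal (g z powr (1 / e2)) \<partial>lebesgue)"
        by (rule nn_integral_cmult) measurable
      also have "\<dots> \<le> ennreal (b powr (- (1 / e2))) * (ennreal (b powr (1 / e2)) * emeasure lebesgue Q)"
        using g e2 by (intro mult_left_mono) (auto simp: mean_le_def)
      also have "\<dots> = ennreal (b powr (- (1 / e2)) * b powr (1 / e2)) * emeasure lebesgue Q"
        by (simp add: ennreal_mult mult.assoc)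
      also have "b powr (- (1 / e2)) * b powr (1 / e2) = 1" using pos by (simp add: powr_add[symmetric])
      finally show ?thesis by simp
    qed
    have Y: "(g z / b) powr (y / e) = ((g z / b) powr (1 / e2)) powr (1 - \<theta>)" for z
      using e2 by (simp add: powr_powr th(3))
    have young: "(f z powr x * g z powr y) powr (1 / e)
        \<le> A * (\<theta> * (f z / a) powr (1 / e1) + (1 - \<theta>) * (g z / b) powr (1 / e2))" for z
    proof -
      have "((f z / a) powr (1 / e1)) powr \<theta> * ((g z / b) powr (1 / e2)) powr (1 - \<theta>)
          \<le> \<theta> * (f z / a) powr (1 / e1) + (1 - \<theta>) * (g z / b) powr (1 / e2)"
        using th pos(1,2) pos(3,4)[of z] by (intro Youngs_inequality_0) auto
      then show ?thesis unfolding factor X Y using A(2) by (intro mult_left_mono) auto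
    qed
    have "(\<integral>\<^sup>+z\<in>Q. ennreal ((f z powr x * g z powr y) powr (1 / e)) \<partial>lebesgue)
        \<le> (\<integral>\<^sup>+z. ennreal A * (ennreal \<theta> * (ennreal ((f z / a) powr (1 / e1)) * indicator Q z)
            + ennreal (1 - \<theta>) * (ennreal ((g z / b) powr (1 / e2)) * indicator Q z)) \<partial>lebesgue)"
    proof (rule nn_integral_mono)
      fix z
      have "ennreal ((f z powr x * g z powr y) powr (1 / e))
          \<le> ennreal A * (ennreal \<theta> * ennreal ((f z / a) powr (1 / e1)) + ennreal (1 - \<theta>) * ennreal ((g z / b) powr (1 / e2)))"
        using ennreal_leI[OF young[of z]] A(2) th(1,2) by (simp add: ennreal_mult)
      then show "ennreal ((f z powr x * g z powr y) powr (1 / e)) * indicator Q z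
          \<le> ennreal A * (ennreal \<theta> * (ennreal ((f z / a) powr (1 / e1)) * indicator Q z)
            + ennreal (1 - \<theta>) * (ennreal ((g z / b) powr (1 / e2)) * indicator Q z))"
        by (auto simp: indicator_def)
    qed
    also have "\<dots> = ennreal A * (ennreal \<theta> * (\<integral>\<^sup>+z\<in>Q. ennreal ((f z / a) powr (1 / e1)) \<partial>lebesgue)
            + ennreal (1 - \<theta>) * (\<integral>\<^sup>+z\<in>Q. ennreal ((g z / b) powr (1 / e2)) \<partial>lebesgue))"
      by (simp add: nn_integral_cmult nn_integral_add)
    also have "\<dots> \<le> ennreal A * (ennreal \<theta> * emeasure lebesgue Q + ennreal (1 - \<theta>) * emeasure lebesgue Q)"
      by (intro mult_left_mono add_mono int1 int2) auto
    also have "\<dots> = ennreal A * emeasure lebesgue Q"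
    proof -
      have "ennreal \<theta> + ennreal (1 - \<theta>) = 1"
        using th(1,2) by (subst ennreal_plus[symmetric]) auto
      then show ?thesis by (simp only: distrib_right[symmetric] mult_1)
    qed
    finally show ?thesis .
  qed
  then show ?thesis using epos by (simp add: mean_le_def A_def e_def)
qed

lemma cubes_iff: "Q \<in> cubes \<longleftrightarrow> (\<exists>a l. 0 < l \<and> Q = cbox a (\<chi> i. a $ i + l))"
  by (auto simp: cubes_def)

lemma cubes_lebesgue: "Q \<in> cubes \<Longrightarrow> Q \<in> sets lebesgue"
  by (auto simp: cubes_def)

lemma AE_cbox_hcube:
  fixes a :: "real ^ 'n"
  assumes "0 < l"
  shows "AE x in lebesgue. x \<in> cbox a (\<chi> i. a $ i + l) \<longleftrightarrow> x \<in> hcube a l"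
proof -
  let ?Q = "cbox a (\<chi> i. a $ i + l)"
  have "emeasure lebesgue (?Q - hcube a l) = emeasure lebesgue ?Q - emeasure lebesgue (hcube a l)"
    using assms by (intro emeasure_Diff hcube_lebesgue hcube_subset_cbox) (auto simp: emeasure_hcube)
  also have "\<dots> = 0" using assms by (simp add: emeasure_hcube emeasure_cube[simplified])
  finally have "?Q - hcube a l \<in> null_sets lebesgue"
    by (intro null_setsI sets.Diff hcube_lebesgue) auto
  then have "AE x in lebesgue. x \<notin> ?Q - hcube a l" by (rule AE_not_in)
  then show ?thesis
    by eventually_elim (use hcube_subset_cbox[of a l] in blast)
qed

lemma mean_le_AE_cong:
  assumes "AE x in lebesgue. x \<in> Q \<longleftrightarrow> x \<in> R" "Q \<in> sets lebesgue" "R \<in> sets lebesgue"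
  shows "mean_le Q e f \<alpha> = mean_le R e f \<alpha>"
proof -
  have 1: "emeasure lebesgue Q = emeasure lebesgue R"
    using assms by (intro emeasure_eq_AE) auto
  have 2: "(\<integral>\<^sup>+x\<in>Q. F x \<partial>lebesgue) = (\<integral>\<^sup>+x\<in>R. F x \<partial>lebesgue)" for F :: "_ \<Rightarrow> ennreal"
    using assms(1) by (intro nn_integral_cong_AE) (auto elim!: eventually_mono simp: indicator_def)
  have 3: "(AE x in lebesgue. x \<in> Q \<longrightarrow> f x \<le> \<alpha>) = (AE x in lebesgue. x \<in> R \<longrightarrow> f x \<le> \<alpha>)"
  proof
    show "AE x in lebesgue. x \<in> R \<longrightarrow> f x \<le> \<alpha>" if "AE x in lebesgue. x \<in> Q \<longrightarrow> f x \<le> \<alpha>"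
      using that assms(1) by eventually_elim auto
    show "AE x in lebesgue. x \<in> Q \<longrightarrow> f x \<le> \<alpha>" if "AE x in lebesgue. x \<in> R \<longrightarrow> f x \<le> \<alpha>"
      using that assms(1) by eventually_elim auto
  qed
  show ?thesis unfolding mean_le_def 1 2 3 ..
qed

lemma mean_le_cbox_iff:
  fixes a :: "real ^ 'n"
  assumes "0 < l"
  shows "mean_le (cbox a (\<chi> i. a $ i + l)) e f \<alpha> = mean_le (hcube a l) e f \<alpha>"
  by (rule mean_le_AE_cong[OF AE_cbox_hcube[OF assms] _ hcube_lebesgue]) auto

text \<open>With \<open>v = w powr (1 / p)\<close>, \<open>i = 1 / p - 1 / p_plus\<close> and \<open>j = 1 / p_minus - 1 / p\<close> this is the
  condition that \<open>w\<close> is a Muckenhoupt weight of index \<open>p / p_minus\<close> satisfying the reverse Hoelder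
  inequality of index \<open>(p_plus / p)'\<close>. In this form it is logarithmically convex in \<open>(i, j, v)\<close>.\<close>

definition weight_class :: "real \<Rightarrow> real \<Rightarrow> (real ^ 'n \<Rightarrow> real) \<Rightarrow> bool" where
  "weight_class i j v \<longleftrightarrow> (\<exists>C. \<forall>Q\<in>cubes. \<exists>\<alpha>>0. \<exists>\<beta>>0.
     mean_le Q i v \<alpha> \<and> mean_le Q j (\<lambda>x. 1 / v x) \<beta> \<and> \<alpha> * \<beta> \<le> C)"

lemma weight_classE:
  fixes v :: "real ^ 'n \<Rightarrow> real"
  assumes "weight_class i j v"
  obtains C where "1 \<le> C" "\<And>Q. Q \<in> cubes \<Longrightarrow> \<exists>\<alpha>>0. \<exists>\<beta>>0.
     mean_le Q i v \<alpha> \<and> mean_le Q j (\<lambda>x. 1 / v x) \<beta> \<and> \<alpha> * \<beta> \<le> C"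
proof -
  obtain C where "\<forall>Q\<in>cubes. \<exists>\<alpha>>0. \<exists>\<beta>>0. mean_le Q i v \<alpha> \<and> mean_le Q j (\<lambda>x. 1 / v x) \<beta> \<and> \<alpha> * \<beta> \<le> C"
    using assms by (auto simp: weight_class_def)
  then have "\<exists>\<alpha>>0. \<exists>\<beta>>0. mean_le Q i v \<alpha> \<and> mean_le Q j (\<lambda>x. 1 / v x) \<beta> \<and> \<alpha> * \<beta> \<le> max 1 C"
    if "Q \<in> cubes" for Q
    using that by (meson max.coboundedI2)
  then show ?thesis by (intro that[of "max 1 C"]) auto
qed

text \<open>This duality yields the reverse Hoelder inequality for \<open>1 / v\<close> from the one
  for \<open>v\<close>.\<close>

lemma weight_class_swap:
  assumes "weight_class i j v" "\<And>x. 0 < v x"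
  shows "weight_class j i (\<lambda>x. 1 / v x)"
proof -
  obtain C where C: "\<And>Q. Q \<in> cubes \<Longrightarrow> \<exists>\<alpha>>0. \<exists>\<beta>>0.
     mean_le Q i v \<alpha> \<and> mean_le Q j (\<lambda>x. 1 / v x) \<beta> \<and> \<alpha> * \<beta> \<le> C"
    using assms(1) by (auto simp: weight_class_def)
  have "(\<lambda>x. 1 / (1 / v x)) = v" by simp
  with C show ?thesis unfolding weight_class_def by (metis mult.commute)
qed

text \<open>Let \<open>E\<close> fill at most half of a cube and \<open>F\<close> be the rest. The
  mean bound on \<open>1 / v\<close> prevents \<open>v\<close> from being small on most of
  \<open>F\<close>, so \<open>F\<close> carries a fixed share \<open>1 / D\<close> of the mass and
  \<open>E\<close> at most \<open>1 - 1 / D\<close>.\<close>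

lemma dyadic_pair_of_weight_class:
  fixes v :: "real ^ 'n \<Rightarrow> real"
  assumes cl: "weight_class i j v" and v [measurable]: "v \<in> borel_measurable lebesgue" and v0: "\<And>x. 0 < v x"
    and ij: "0 < i" "0 < j"
  shows "\<exists>\<beta>. dyadic_pair (density lebesgue (\<lambda>x. ennreal (v x powr (1 / i)))) \<beta>"
proof -
  obtain C where C: "1 \<le> C" "\<And>Q. Q \<in> cubes \<Longrightarrow> \<exists>\<alpha>>0. \<exists>\<beta>>0.
     mean_le Q i v \<alpha> \<and> mean_le Q j (\<lambda>x. 1 / v x) \<beta> \<and> \<alpha> * \<beta> \<le> C"
    using weight_classE[OF cl] by blast
  define r s where "r = 1 / i" and "s = 1 / j"
  have rs: "r > 0" "s > 0" using ij by (auto simp: r_def s_def)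
  define N where "N = density lebesgue (\<lambda>x. ennreal (v x powr r))"
  have emN: "emeasure N A = (\<integral>\<^sup>+x\<in>A. ennreal (v x powr r) \<partial>lebesgue)" if "A \<in> sets lebesgue" for A
    unfolding N_def using that by (intro emeasure_density) auto
  have sN: "sets N = sets lebesgue" by (simp add: N_def)
  have cond: "\<exists>\<alpha>>0. \<exists>\<beta>>0. emeasure N (hcube a l) \<le> ennreal (\<alpha> powr r) * emeasure lebesgue (hcube a l) \<and>
      (\<integral>\<^sup>+x\<in>hcube a l. ennreal (v x powr (- s)) \<partial>lebesgue) \<le> ennreal (\<beta> powr s) * emeasure lebesgue (hcube a l) \<and>
      \<alpha> * \<beta> \<le> C" if l: "0 < l" for a l
  proof -
    have "cbox a (\<chi> i. a $ i + l) \<in> cubes" using l by (auto simp: cubes_def)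
    from C(2)[OF this] obtain \<alpha> \<beta> where ab: "0 < \<alpha>" "0 < \<beta>" "\<alpha> * \<beta> \<le> C"
      "mean_le (hcube a l) i v \<alpha>" "mean_le (hcube a l) j (\<lambda>x. 1 / v x) \<beta>"
      unfolding mean_le_cbox_iff[OF l] by blast
    have "(1 / v x) powr (1 / j) = v x powr (- s)" for x
      using v0[of x] by (simp add: powr_divide powr_minus s_def field_simps)
    then show ?thesis using ab ij emN[OF hcube_lebesgue, of a l]
      by (auto simp: mean_le_def r_def s_def)
  qed
  \<comment> \<open>The constant \<open>4 * la * \<alpha> powr r\<close> found below, with
    \<open>\<alpha> * \<beta>\<close> replaced by its bound \<open>C\<close>.\<close>
  define D where "D = 4 powr (1 + r / s) * C powr r"
  have D: "D > 1"
  proof -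
    have "1 < 4 powr (1 + r / s)" using powr_less_mono[of 0 "1 + r / s" 4] rs by (simp add: add_pos_pos)
    moreover have "1 \<le> C powr r" using C(1) rs by (simp add: ge_one_powr_ge_zero)
    ultimately have "1 * 1 < 4 powr (1 + r / s) * C powr r" by (intro mult_less_le_imp_less) auto
    then show ?thesis by (simp add: D_def)
  qed
  have "dyadic_pair N (1 - 1 / D)"
  proof
    show "sets N = sets lebesgue" by (rule sN)
    show "0 < 1 - 1 / D" "1 - 1 / D < 1" using D by auto
    show fin: "emeasure N (hcube a l) < \<infinity>" for a l
    proof (cases "0 < l")
      case True
      then obtain \<alpha> where "emeasure N (hcube a l) \<le> ennreal (\<alpha> powr r) * emeasure lebesgue (hcube a l)"
        using cond by blast
      also have "\<dots> < \<infinity>" using True by (simp add: emeasure_hcube ennreal_mult_less_top)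
      finally show ?thesis .
    next
      case False
      have "hcube a l = {}"
      proof (rule equals0I)
        fix x assume "x \<in> hcube a l"
        then have "a $ undefined \<le> x $ undefined \<and> x $ undefined < a $ undefined + l"
          by (simp add: hcube_def)
        then show False using False by linarith
      qed
      then show ?thesis by simp
    qed
    fix a :: "real ^ 'n" and l E
    assume l: "0 < l" and E: "E \<in> sets lebesgue" "E \<subseteq> hcube a l"
      and half: "2 * emeasure lebesgue E \<le> emeasure lebesgue (hcube a l)"
    obtain \<alpha> \<beta> where ab: "0 < \<alpha>" "0 < \<beta>" "\<alpha> * \<beta> \<le> C"
      "emeasure N (hcube a l) \<le> ennreal (\<alpha> powr r) * emeasure lebesgue (hcube a l)"
      "(\<integral>\<^sup>+x\<in>hcube a l. ennreal (v x powr (- s)) \<partial>lebesgue) \<le> ennreal (\<beta> powr s) * emeasure lebesgue (hcube a l)"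
      using cond[OF l] by blast
    define F where "F = hcube a l - E"
    have F: "F \<in> sets lebesgue" unfolding F_def using E(1) hcube_lebesgue by auto
    define m where "m = l ^ CARD('n)"
    have m: "emeasure lebesgue (hcube a l) = ennreal m" "0 < m" using l by (auto simp: emeasure_hcube m_def)
    have subE: "emeasure lebesgue E \<le> ennreal m" unfolding m(1)[symmetric] using E(2) by (intro emeasure_mono hcube_lebesgue)
    then obtain me where me: "emeasure lebesgue E = ennreal me" "0 \<le> me"
      by (cases "emeasure lebesgue E") (auto simp: top_unique)
    have "ennreal (2 * me) \<le> ennreal m" using half unfolding me m(1) using me(2) by (simp add: ennreal_mult)
    then have me2: "2 * me \<le> m" using m(2) by simp
    have mF: "emeasure lebesgue F = ennreal (m - me)"
      unfolding F_def using me E m by (subst emeasure_Diff) (auto simp: hcube_lebesgue ennreal_minus)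
    obtain nQ where nQ: "emeasure N (hcube a l) = ennreal nQ" "0 \<le> nQ"
      using fin[of a l] by (cases "emeasure N (hcube a l)") auto
    have "emeasure N E \<le> ennreal nQ" unfolding nQ(1)[symmetric] using E(2) by (intro emeasure_mono) (auto simp: sN hcube_lebesgue)
    then obtain nE where nE: "emeasure N E = ennreal nE" "0 \<le> nE" "nE \<le> nQ"
      using nQ(2) by (cases "emeasure N E") (auto simp: top_unique)
    have nF: "emeasure N F = ennreal (nQ - nE)"
      unfolding F_def using nE nQ E by (subst emeasure_Diff) (auto simp: hcube_lebesgue sN ennreal_minus)
    \<comment> \<open>Chosen so that the second term of \<open>pw\<close>, integrated over the cube,
      is at most a quarter of its volume and can be absorbed: \<open>F\<close> has at least half of
      it.\<close>
    define la where "la = 4 powr (r / s) * \<beta> powr r"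
    have lam: "la > 0" using ab by (simp add: la_def)
    have pw: "1 \<le> la * v x powr r + la powr (- (s / r)) * v x powr (- s)" for x
    proof (cases "1 \<le> la * v x powr r")
      case True
      then show ?thesis using lam by (simp add: add_increasing2)
    next
      case False
      then have "(la * v x powr r) powr (- (s / r)) \<ge> 1 powr (- (s / r))"
        using lam v0[of x] rs by (intro powr_mono2') auto
      then have "1 \<le> la powr (- (s / r)) * v x powr (- s)"
        using lam v0[of x] rs by (simp add: powr_mult powr_powr)
      then show ?thesis using lam by (simp add: add_increasing)
    qed
    have lams: "la powr (- (s / r)) = 1 / (4 * \<beta> powr s)"
    proof -
      have "la powr (- (s / r)) = 4 powr (r / s * (- (s / r))) * \<beta> powr (r * (- (s / r)))"
        using ab by (simp only: la_def powr_mult powr_powr)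
      also have "r / s * (- (s / r)) = -1" using rs by simp
      also have "r * (- (s / r)) = - s" using rs by simp
      finally show ?thesis by (simp add: powr_minus field_simps)
    qed
    have "ennreal (m - me) = (\<integral>\<^sup>+x\<in>F. 1 \<partial>lebesgue)" using F mF by simp
    also have "\<dots> \<le> (\<integral>\<^sup>+x. ennreal la * (ennreal (v x powr r) * indicator F x)
        + ennreal (1 / (4 * \<beta> powr s)) * (ennreal (v x powr (- s)) * indicator (hcube a l) x) \<partial>lebesgue)"
    proof (rule nn_integral_mono)
      fix x
      have "ennreal 1 \<le> ennreal la * ennreal (v x powr r) + ennreal (1 / (4 * \<beta> powr s)) * ennreal (v x powr (- s))"
        using ennreal_leI[OF pw[of x]] lam by (simp add: lams ennreal_mult[symmetric] ennreal_plus[symmetric] del: ennreal_plus)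
      then show "1 * indicator F x \<le> ennreal la * (ennreal (v x powr r) * indicator F x)
        + ennreal (1 / (4 * \<beta> powr s)) * (ennreal (v x powr (- s)) * indicator (hcube a l) x)"
        by (auto simp: indicator_def F_def)
    qed
    also have "\<dots> = ennreal la * emeasure N F
        + ennreal (1 / (4 * \<beta> powr s)) * (\<integral>\<^sup>+x\<in>hcube a l. ennreal (v x powr (- s)) \<partial>lebesgue)"
    proof -
      have [measurable]: "hcube a l \<in> sets lebesgue" "F \<in> sets lebesgue" by (rule hcube_lebesgue, rule F)
      show ?thesis unfolding emN[OF F]
        by (subst nn_integral_add) (simp_all add: nn_integral_cmult)
    qed
    also have "\<dots> \<le> ennreal la * ennreal (nQ - nE) + ennreal (1 / (4 * \<beta> powr s)) * (ennreal (\<beta> powr s) * ennreal m)"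
      using ab(5) unfolding nF m(1) by (intro add_left_mono mult_left_mono) auto
    also have "\<dots> = ennreal (la * (nQ - nE) + m / 4)"
      using lam nE nQ m(2) ab by (simp add: ennreal_mult[symmetric] ennreal_plus[symmetric] del: ennreal_plus)
    finally have "m - me \<le> la * (nQ - nE) + m / 4"
      using lam nE(3) m(2) by (subst (asm) ennreal_le_iff) (auto intro!: add_nonneg_nonneg mult_nonneg_nonneg)
    then have m4: "m \<le> 4 * la * (nQ - nE)" using me2 by simp
    have "ennreal nQ \<le> ennreal (\<alpha> powr r * m)" using ab(4) m(2) unfolding nQ(1) m(1) by (simp add: ennreal_mult)
    then have "nQ \<le> \<alpha> powr r * m" using m(2) by simp
    also have "\<dots> \<le> \<alpha> powr r * (4 * la * (nQ - nE))" using m4 by (intro mult_left_mono) auto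
    also have "\<dots> = 4 powr (1 + r / s) * (\<alpha> * \<beta>) powr r * (nQ - nE)"
      using ab by (simp add: la_def powr_mult powr_add)
    also have "\<dots> \<le> D * (nQ - nE)"
      unfolding D_def using ab rs nE(3) by (intro mult_right_mono mult_left_mono powr_mono2) auto
    finally have "nE \<le> (1 - 1 / D) * nQ" using D by (simp add: field_simps)
    then show "emeasure N E \<le> ennreal (1 - 1 / D) * emeasure N (hcube a l)"
      unfolding nE(1) nQ(1) using D nQ(2) by (simp add: ennreal_mult[symmetric] ennreal_leI)
  qed
  then show ?thesis unfolding N_def r_def by blast
qed

text \<open>Self-improvement of integrability from the exponent \<open>1 / i\<close> to the larger
  \<open>1 / (i - \<delta>)\<close>, applied to \<open>v powr (1 / i)\<close>.\<close>

lemma reverse_hoelder_weight_class: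
  fixes v :: "real ^ 'n \<Rightarrow> real"
  assumes cl: "weight_class i j v" and v [measurable]: "v \<in> borel_measurable lebesgue" and v0: "\<And>x. 0 < v x"
    and ij: "0 < i" "0 < j"
  obtains \<delta> K where "0 < \<delta>" "\<delta> < i" "0 < K"
    "\<And>Q \<alpha>. \<lbrakk>Q \<in> cubes; 0 < \<alpha>; mean_le Q i v \<alpha>\<rbrakk> \<Longrightarrow> mean_le Q (i - \<delta>) v (K * \<alpha>)"
proof -
  define U where "U x = v x powr (1 / i)" for x
  have U: "U \<in> borel_measurable lebesgue" "\<And>x. 0 \<le> U x" unfolding U_def by auto
  obtain \<beta> where dp: "dyadic_pair (density lebesgue (\<lambda>x. ennreal (U x))) \<beta>"
    using dyadic_pair_of_weight_class[OF assms] unfolding U_def by blast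
  interpret dyadic_pair "density lebesgue (\<lambda>x. ennreal (U x))" \<beta> by (rule dp)
  define \<Lambda> where "\<Lambda> = 2 * (2::real) ^ CARD('n)"
  have Lam: "\<Lambda> > 1" unfolding \<Lambda>_def using one_le_power[of "2::real" "CARD('n)"] by linarith
  obtain \<epsilon> where eps: "0 < \<epsilon>" "\<Lambda> powr \<epsilon> * \<beta> < 1"
  proof -
    \<comment> \<open>Then \<open>\<Lambda> powr \<epsilon> = \<beta> powr (- 1/2)\<close>, so the
      product with \<beta> is its square root.\<close>
    define \<epsilon> where "\<epsilon> = ln (1 / \<beta>) / (2 * ln \<Lambda>)"
    have lb: "ln (1 / \<beta>) > 0" using beta by simp
    have "\<epsilon> > 0" using lb Lam by (simp add: \<epsilon>_def)
    moreover have "\<Lambda> powr \<epsilon> * \<beta> < 1"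
    proof -
      have "\<Lambda> powr \<epsilon> = exp (ln (1 / \<beta>) / 2)" using Lam by (simp add: \<epsilon>_def powr_def)
      also have "\<dots> < exp (ln (1 / \<beta>))" using lb by simp
      also have "\<dots> = 1 / \<beta>" using beta by simp
      finally show ?thesis using beta by (simp add: field_simps)
    qed
    ultimately show ?thesis using that by blast
  qed
  define K where "K = 1 + \<Lambda> powr \<epsilon> / (1 - \<Lambda> powr \<epsilon> * \<beta>)"
  have K: "K > 0" unfolding K_def using eps by (intro add_pos_nonneg) auto
  define \<delta> where "\<delta> = i - i / (1 + \<epsilon>)"
  have id: "i - \<delta> = i / (1 + \<epsilon>)" by (simp add: \<delta>_def)
  have "i / (1 + \<epsilon>) < i" using ij eps by (simp add: field_simps)
  then have d: "0 < \<delta>" "\<delta> < i" using ij eps by (auto simp: \<delta>_def)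
  show ?thesis
  proof (rule that[OF d])
    show "0 < K powr (i / (1 + \<epsilon>))" using K by simp
    fix Q :: "(real ^ 'n) set" and \<alpha> :: real
    assume "Q \<in> cubes" and a: "0 < \<alpha>" and m: "mean_le Q i v \<alpha>"
    then obtain c l where l: "0 < l" and Q: "Q = cbox c (\<chi> i. c $ i + l)" by (auto simp: cubes_iff)
    have avg: "(\<integral>\<^sup>+x\<in>hcube c l. ennreal (U x) \<partial>lebesgue) \<le> ennreal (\<alpha> powr (1 / i)) * emeasure lebesgue (hcube c l)"
      using m ij unfolding Q mean_le_cbox_iff[OF l] by (simp add: mean_le_def U_def)
    have "(\<integral>\<^sup>+x\<in>hcube c l. ennreal (U x powr (1 + \<epsilon>)) \<partial>lebesgue)
        \<le> ennreal (K * (\<alpha> powr (1 / i)) powr \<epsilon>) * (\<integral>\<^sup>+x\<in>hcube c l. ennreal (U x) \<partial>lebesgue)"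
      unfolding K_def \<Lambda>_def
      by (rule reverse_hoelder_dyadic[OF U dp eps(1) eps(2)[unfolded \<Lambda>_def] l _ avg]) (use a in simp)
    also have "\<dots> \<le> ennreal (K * (\<alpha> powr (1 / i)) powr \<epsilon>) * (ennreal (\<alpha> powr (1 / i)) * emeasure lebesgue (hcube c l))"
      by (intro mult_left_mono avg) auto
    also have "\<dots> = ennreal (K * (\<alpha> powr (1 / i)) powr \<epsilon> * \<alpha> powr (1 / i)) * emeasure lebesgue (hcube c l)"
      using K by (simp add: ennreal_mult mult.assoc)
    also have "K * (\<alpha> powr (1 / i)) powr \<epsilon> * \<alpha> powr (1 / i) = (K powr (i / (1 + \<epsilon>)) * \<alpha>) powr (1 / (i - \<delta>))"
    proof -
      have "(K powr (i / (1 + \<epsilon>)) * \<alpha>) powr (1 / (i - \<delta>)) = K powr (i / (1 + \<epsilon>) * ((1 + \<epsilon>) / i)) * \<alpha> powr ((1 + \<epsilon>) / i)"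
        using K a by (simp add: id powr_mult powr_powr)
      also have "i / (1 + \<epsilon>) * ((1 + \<epsilon>) / i) = 1" using ij eps by simp
      also have "\<alpha> powr ((1 + \<epsilon>) / i) = (\<alpha> powr (1 / i)) powr \<epsilon> * \<alpha> powr (1 / i)"
        using a by (simp add: powr_powr powr_add[symmetric] add_divide_distrib add.commute)
      finally show ?thesis using K by simp
    qed
    finally have "(\<integral>\<^sup>+x\<in>hcube c l. ennreal (v x powr (1 / (i - \<delta>))) \<partial>lebesgue)
        \<le> ennreal ((K powr (i / (1 + \<epsilon>)) * \<alpha>) powr (1 / (i - \<delta>))) * emeasure lebesgue (hcube c l)"
      unfolding U_def powr_powr id by simp
    then show "mean_le Q (i - \<delta>) v (K powr (i / (1 + \<epsilon>)) * \<alpha>)"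
      unfolding Q mean_le_cbox_iff[OF l] using d by (simp add: mean_le_def)
  qed
qed

section \<open>Extrapolation of weights\<close>

text \<open>Hoelder's inequality against the constant 1, whose normalised mean is 1 for every
  exponent.\<close>

lemma mean_le_mono_exponent:
  fixes f :: "real ^ 'n \<Rightarrow> real"
  assumes f: "mean_le Q e f a" and e: "0 < e" "e \<le> e'" and a: "0 < a"
    and "\<And>x. 0 < f x" "f \<in> borel_measurable lebesgue" "Q \<in> sets lebesgue"
  shows "mean_le Q e' f a"
proof -
  have one: "mean_le Q (e' - e) (\<lambda>x. 1) 1"
    using assms by (simp add: mean_le_def)
  have "mean_le Q (1 * e + 1 * (e' - e)) (\<lambda>x. f x powr 1 * 1 powr 1) (a powr 1 * 1 powr 1)"
    by (rule mean_le_hoelder[OF f one]) (use assms in auto)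
  moreover have "(\<lambda>x. f x powr 1 * 1 powr 1) = f" using assms(5) by (auto simp: fun_eq_iff less_imp_le)
  ultimately show ?thesis using a by simp
qed

text \<open>The loss in Hoelder's inequality caused by \<open>v1 powr (- \<eta>)\<close> is absorbed by the gain in the
  reverse Hoelder inequalities for \<open>v\<close> and \<open>1 / v\<close>.\<close>

lemma weight_class_extrapolate:
  fixes v v1 :: "real ^ 'n \<Rightarrow> real"
  assumes cl: "weight_class i j v" "weight_class i1 j1 v1"
    and [measurable]: "v \<in> borel_measurable lebesgue" "v1 \<in> borel_measurable lebesgue"
    and pos: "\<And>x. 0 < v x" "\<And>x. 0 < v1 x"
    and ij: "0 < i" "0 < j" "0 \<le> i1" "0 \<le> j1" "i1 + j1 = i + j"
  obtains \<eta> where "0 < \<eta>" "0 < (1 + \<eta>) * i - \<eta> * i1" "0 < (1 + \<eta>) * j - \<eta> * j1"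
    "weight_class ((1 + \<eta>) * i - \<eta> * i1) ((1 + \<eta>) * j - \<eta> * j1) (\<lambda>x. v x powr (1 + \<eta>) * v1 x powr (- \<eta>))"
proof -
  obtain d1 K1 where K1: "0 < d1" "d1 < i" "0 < K1"
    "\<And>Q \<alpha>. \<lbrakk>Q \<in> cubes; 0 < \<alpha>; mean_le Q i v \<alpha>\<rbrakk> \<Longrightarrow> mean_le Q (i - d1) v (K1 * \<alpha>)"
    by (rule reverse_hoelder_weight_class[OF cl(1) _ pos(1) ij(1,2)]) (simp, blast)
  obtain d2 K2 where K2: "0 < d2" "d2 < j" "0 < K2"
    "\<And>Q \<alpha>. \<lbrakk>Q \<in> cubes; 0 < \<alpha>; mean_le Q j (\<lambda>x. 1 / v x) \<alpha>\<rbrakk> \<Longrightarrow> mean_le Q (j - d2) (\<lambda>x. 1 / v x) (K2 * \<alpha>)"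
    by (rule reverse_hoelder_weight_class[OF weight_class_swap[OF cl(1) pos(1)] _ _ ij(2,1)]) (simp, simp add: pos(1), blast)
  define \<delta> where "\<delta> = min d1 d2"
  have d: "0 < \<delta>" "\<delta> \<le> d1" "\<delta> \<le> d2" "\<delta> < i" "\<delta> < j" using K1 K2 by (auto simp: \<delta>_def)
  define \<kappa> where "\<kappa> = i + j"
  \<comment> \<open>Solved from \<open>(1 + \<eta>) * \<delta> = \<eta> * (i1 + j1)\<close>.
    Hoelder's inequality for \<open>v powr (1 + \<eta>) * (1 / v1) powr \<eta>\<close> yields the
    exponent \<open>(1 + \<eta>) * (i - \<delta>) + \<eta> * j1\<close>, and this equation turns it
    into the wanted \<open>(1 + \<eta>) * i - \<eta> * i1\<close>; likewise for
    \<open>j\<close>.\<close>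
  define \<theta> where "\<theta> = \<delta> / \<kappa>"
  have th: "0 < \<theta>" "\<theta> < 1" using d ij by (auto simp: \<theta>_def \<kappa>_def)
  define \<eta> where "\<eta> = \<theta> / (1 - \<theta>)"
  have eta: "0 < \<eta>" using th by (simp add: \<eta>_def)
  have "(1 + \<eta>) = 1 / (1 - \<theta>)" using th by (simp add: \<eta>_def field_simps)
  then have ed: "(1 + \<eta>) * \<delta> = \<eta> * \<kappa>"
    using ij by (simp add: \<eta>_def \<theta>_def \<kappa>_def)
  have ed': "(1 + \<eta>) * \<delta> = \<eta> * i1 + \<eta> * j1"
    unfolding ed \<kappa>_def ij(5)[symmetric] by (rule distrib_left)
  have e1: "(1 + \<eta>) * (i - \<delta>) + \<eta> * j1 = (1 + \<eta>) * i - \<eta> * i1"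
    unfolding right_diff_distrib ed' by simp
  have e2: "(1 + \<eta>) * (j - \<delta>) + \<eta> * i1 = (1 + \<eta>) * j - \<eta> * j1"
    unfolding right_diff_distrib ed' by simp
  show ?thesis
  proof (rule that[OF eta])
    show "0 < (1 + \<eta>) * i - \<eta> * i1" "0 < (1 + \<eta>) * j - \<eta> * j1"
      unfolding e1[symmetric] e2[symmetric] using d eta ij by (auto intro!: add_pos_nonneg)
    obtain C where C: "1 \<le> C" "\<And>Q. Q \<in> cubes \<Longrightarrow> \<exists>\<alpha>>0. \<exists>\<beta>>0.
      mean_le Q i v \<alpha> \<and> mean_le Q j (\<lambda>x. 1 / v x) \<beta> \<and> \<alpha> * \<beta> \<le> C"
      using weight_classE[OF cl(1)] by blast
    obtain C1 where C1: "1 \<le> C1" "\<And>Q. Q \<in> cubes \<Longrightarrow> \<exists>\<alpha>>0. \<exists>\<beta>>0.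
      mean_le Q i1 v1 \<alpha> \<and> mean_le Q j1 (\<lambda>x. 1 / v1 x) \<beta> \<and> \<alpha> * \<beta> \<le> C1"
      using weight_classE[OF cl(2)] by blast
    show "weight_class ((1 + \<eta>) * i - \<eta> * i1) ((1 + \<eta>) * j - \<eta> * j1) (\<lambda>x. v x powr (1 + \<eta>) * v1 x powr (- \<eta>))"
      unfolding weight_class_def
    proof (rule exI[of _ "(K1 * K2 * C) powr (1 + \<eta>) * C1 powr \<eta>"], rule ballI)
      fix Q :: "(real ^ 'n) set" assume Q: "Q \<in> cubes"
      have [measurable]: "Q \<in> sets lebesgue" by (rule cubes_lebesgue[OF Q])
      obtain \<alpha> \<beta> where ab: "0 < \<alpha>" "0 < \<beta>" "mean_le Q i v \<alpha>" "mean_le Q j (\<lambda>x. 1 / v x) \<beta>" "\<alpha> * \<beta> \<le> C"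
        using C(2)[OF Q] by blast
      obtain \<alpha>1 \<beta>1 where ab1: "0 < \<alpha>1" "0 < \<beta>1" "mean_le Q i1 v1 \<alpha>1" "mean_le Q j1 (\<lambda>x. 1 / v1 x) \<beta>1" "\<alpha>1 * \<beta>1 \<le> C1"
        using C1(2)[OF Q] by blast
      have m1: "mean_le Q (i - \<delta>) v (K1 * \<alpha>)"
        by (rule mean_le_mono_exponent[OF K1(4)[OF Q ab(1,3)]]) (use d K1 ab pos in auto)
      have m2: "mean_le Q (j - \<delta>) (\<lambda>x. 1 / v x) (K2 * \<beta>)"
        by (rule mean_le_mono_exponent[OF K2(4)[OF Q ab(2,4)]]) (use d K2 ab pos in auto)
      have f1: "(\<lambda>x. v x powr (1 + \<eta>) * (1 / v1 x) powr \<eta>) = (\<lambda>x. v x powr (1 + \<eta>) * v1 x powr (- \<eta>))"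
        using pos by (auto simp: fun_eq_iff powr_divide powr_minus_divide less_imp_le)
      have f2: "(\<lambda>x. (1 / v x) powr (1 + \<eta>) * v1 x powr \<eta>) = (\<lambda>x. 1 / (v x powr (1 + \<eta>) * v1 x powr (- \<eta>)))"
        using pos by (auto simp: fun_eq_iff powr_divide powr_minus_divide less_imp_le)
      have "mean_le Q ((1 + \<eta>) * (i - \<delta>) + \<eta> * j1) (\<lambda>x. v x powr (1 + \<eta>) * (1 / v1 x) powr \<eta>) ((K1 * \<alpha>) powr (1 + \<eta>) * \<beta>1 powr \<eta>)"
        by (rule mean_le_hoelder[OF m1 ab1(4)]) (use d K1 ab ab1 pos eta ij in auto)
      then have r1: "mean_le Q ((1 + \<eta>) * i - \<eta> * i1) (\<lambda>x. v x powr (1 + \<eta>) * v1 x powr (- \<eta>)) ((K1 * \<alpha>) powr (1 + \<eta>) * \<beta>1 powr \<eta>)"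
        unfolding f1 e1 .
      have "mean_le Q ((1 + \<eta>) * (j - \<delta>) + \<eta> * i1) (\<lambda>x. (1 / v x) powr (1 + \<eta>) * v1 x powr \<eta>) ((K2 * \<beta>) powr (1 + \<eta>) * \<alpha>1 powr \<eta>)"
        by (rule mean_le_hoelder[OF m2 ab1(3)]) (use d K2 ab ab1 pos eta ij in auto)
      then have r2: "mean_le Q ((1 + \<eta>) * j - \<eta> * j1) (\<lambda>x. 1 / (v x powr (1 + \<eta>) * v1 x powr (- \<eta>))) ((K2 * \<beta>) powr (1 + \<eta>) * \<alpha>1 powr \<eta>)"
        unfolding f2 e2 .
      have "(K1 * \<alpha>) powr (1 + \<eta>) * \<beta>1 powr \<eta> * ((K2 * \<beta>) powr (1 + \<eta>) * \<alpha>1 powr \<eta>)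
          = (K1 * K2 * (\<alpha> * \<beta>)) powr (1 + \<eta>) * (\<alpha>1 * \<beta>1) powr \<eta>"
        by (simp only: powr_mult mult_ac)
      also have "\<dots> \<le> (K1 * K2 * C) powr (1 + \<eta>) * C1 powr \<eta>"
        using ab ab1 K1 K2 eta by (intro mult_mono powr_mono2 mult_left_mono) auto
      finally have r3: "(K1 * \<alpha>) powr (1 + \<eta>) * \<beta>1 powr \<eta> * ((K2 * \<beta>) powr (1 + \<eta>) * \<alpha>1 powr \<eta>)
          \<le> (K1 * K2 * C) powr (1 + \<eta>) * C1 powr \<eta>" .
      have r4: "0 < (K1 * \<alpha>) powr (1 + \<eta>) * \<beta>1 powr \<eta>" "0 < (K2 * \<beta>) powr (1 + \<eta>) * \<alpha>1 powr \<eta>"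
        using K1(3) K2(3) ab(1,2) ab1(1,2) by auto
      show "\<exists>\<alpha>>0. \<exists>\<beta>>0. mean_le Q ((1 + \<eta>) * i - \<eta> * i1) (\<lambda>x. v x powr (1 + \<eta>) * v1 x powr (- \<eta>)) \<alpha>
          \<and> mean_le Q ((1 + \<eta>) * j - \<eta> * j1) (\<lambda>x. 1 / (v x powr (1 + \<eta>) * v1 x powr (- \<eta>))) \<beta>
          \<and> \<alpha> * \<beta> \<le> (K1 * K2 * C) powr (1 + \<eta>) * C1 powr \<eta>"
        using r1 r2 r3 r4 by blast
    qed
  qed
qed

section \<open>Muckenhoupt and reverse Hoelder conditions in terms of the weight class\<close>

lemma compact_subset_cube:
  fixes K :: "(real ^ 'n) set"
  assumes "compact K"
  obtains Q where "Q \<in> cubes" "K \<subseteq> Q"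
proof -
  obtain b where b: "\<And>x. x \<in> K \<Longrightarrow> norm x \<le> b" using compact_imp_bounded[OF assms] by (auto simp: bounded_iff)
  define B where "B = \<bar>b\<bar> + 1"
  define a :: "real ^ 'n" where "a = (\<chi> i. - B)"
  have "K \<subseteq> cbox a (\<chi> i. a $ i + 2 * B)"
  proof
    fix x assume "x \<in> K"
    have "\<bar>x $ i\<bar> \<le> B" for i using component_le_norm_cart[of x i] b[OF \<open>x \<in> K\<close>] by (simp add: B_def)
    then have "- B \<le> x $ i \<and> x $ i \<le> B" for i by (simp add: abs_le_iff) (smt (verit))
    then show "x \<in> cbox a (\<chi> i. a $ i + 2 * B)" by (simp add: mem_box_cart a_def)
  qed
  moreover have "cbox a (\<chi> i. a $ i + 2 * B) \<in> cubes" unfolding cubes_iff by (intro exI[of _ a] exI[of _ "2 * B"]) (auto simp: B_def)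
  ultimately show ?thesis using that by blast
qed

lemma cube_measure:
  assumes "Q \<in> cubes"
  obtains m where "0 < m" "emeasure lebesgue Q = ennreal m"
proof -
  obtain a l where "0 < l" "Q = cbox a (\<chi> i. a $ i + l)" using assms by (auto simp: cubes_iff)
  then show ?thesis using that[of "l ^ CARD('a)"] emeasure_cube(1)[of l a] by simp
qed

lemma weight_measurable:
  fixes w :: "real ^ 'n \<Rightarrow> real"
  assumes "weight w"
  shows "w \<in> borel_measurable lebesgue"
proof (rule borel_measurable_LIMSEQ_real)
  fix n :: nat
  have "set_integrable lebesgue (cball 0 (real n)) w" using assms by (simp add: weight_def)
  then show "(\<lambda>x. indicator (cball 0 (real n)) x *\<^sub>R w x) \<in> borel_measurable lebesgue"
    unfolding set_integrable_def by (rule borel_measurable_integrable)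
next
  fix x :: "real ^ 'n"
  obtain N where "norm x \<le> real N" using real_arch_simple by blast
  then have "\<forall>\<^sub>F n in sequentially. indicator (cball 0 (real n)) x *\<^sub>R w x = w x"
    unfolding eventually_sequentially by (intro exI[of _ N]) (auto simp: indicator_def)
  then show "(\<lambda>n. indicator (cball 0 (real n)) x *\<^sub>R w x) \<longlonglongrightarrow> w x"
    by (rule tendsto_eventually)
qed

text \<open>Weights are only positive almost everywhere; this representative is positive everywhere.\<close>

definition positive_part_or_one :: "('a \<Rightarrow> real) \<Rightarrow> 'a \<Rightarrow> real" where
  "positive_part_or_one w x = (if 0 < w x then w x else 1)"

lemma positive_part_or_one_pos: "0 < positive_part_or_one w x"
  by (simp add: positive_part_or_one_def)

lemma positive_part_or_one_measurable [measurable]: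
  assumes [measurable]: "w \<in> borel_measurable M"
  shows "positive_part_or_one w \<in> borel_measurable M"
  unfolding positive_part_or_one_def[abs_def] by measurable

lemma positive_part_or_one_AE:
  assumes "weight w"
  shows "AE x in lebesgue. positive_part_or_one w x = w x"
proof -
  have "AE x in lebesgue. 0 < w x" using assms by (simp add: weight_def)
  then show ?thesis by eventually_elim (simp add: positive_part_or_one_def)
qed

lemma average_le_iff:
  assumes "Q \<in> cubes" "0 \<le> c"
  shows "average Q g \<le> ennreal c \<longleftrightarrow> (\<integral>\<^sup>+x\<in>Q. ennreal (g x) \<partial>lebesgue) \<le> ennreal c * emeasure lebesgue Q"
proof -
  obtain m where m: "0 < m" "emeasure lebesgue Q = ennreal m" using cube_measure[OF assms(1)] .
  show ?thesis
  proof (cases "(\<integral>\<^sup>+x\<in>Q. ennreal (g x) \<partial>lebesgue)")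
    case (real u)
    then show ?thesis
      unfolding average_def m(2) using m(1) assms(2)
      by (simp add: divide_ennreal ennreal_mult[symmetric] pos_divide_le_eq)
  next
    case top
    then show ?thesis
      unfolding average_def m(2) using m(1) assms(2)
      by (simp add: ennreal_top_divide top_unique ennreal_mult[symmetric])
  qed
qed

lemma average_cong_AE:
  assumes "AE x in lebesgue. f x = g x"
  shows "average Q f = average Q g"
  unfolding average_def
  by (intro arg_cong2[where f="(/)"] nn_integral_cong_AE refl) (use assms in \<open>auto elim!: eventually_mono\<close>)

lemma ennreal_powr_le_iff:
  assumes "0 < a" "0 \<le> c"
  shows "ennreal_powr x a \<le> ennreal c \<longleftrightarrow> x \<le> ennreal (c powr (1 / a))"
proof (cases x)
  case (real u)
  have "u powr a \<le> c \<longleftrightarrow> u \<le> c powr (1 / a)"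
  proof
    assume "u powr a \<le> c"
    then have "(u powr a) powr (1 / a) \<le> c powr (1 / a)" using assms by (intro powr_mono2) auto
    then show "u \<le> c powr (1 / a)" using assms real by (simp add: powr_powr)
  next
    assume "u \<le> c powr (1 / a)"
    then have "u powr a \<le> (c powr (1 / a)) powr a" using assms real by (intro powr_mono2) auto
    then show "u powr a \<le> c" using assms by (simp add: powr_powr)
  qed
  then show ?thesis using real assms by (simp add: ennreal_powr_def)
next
  case top
  then show ?thesis by (simp add: ennreal_powr_def top_unique)
qed

lemma average_weight:
  fixes w :: "real ^ 'n \<Rightarrow> real"
  assumes "weight w" "Q \<in> cubes"
  obtains a where "0 < a" "average Q w = ennreal a"
proof -
  obtain m where m: "0 < m" "emeasure lebesgue Q = ennreal m" using cube_measure[OF assms(2)] .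
  have [measurable]: "w \<in> borel_measurable lebesgue" "Q \<in> sets lebesgue"
    using weight_measurable[OF assms(1)] cubes_lebesgue[OF assms(2)] by auto
  have pos: "AE x in lebesgue. 0 < w x" using assms(1) by (simp add: weight_def)
  have "compact Q" using assms(2) by (auto simp: cubes_def)
  then have "integrable lebesgue (\<lambda>x. indicator Q x *\<^sub>R w x)"
    using assms(1) by (simp add: weight_def set_integrable_def)
  then have "(\<integral>\<^sup>+x. ennreal (norm (indicator Q x *\<^sub>R w x)) \<partial>lebesgue) < \<infinity>"
    by (simp add: integrable_iff_bounded)
  moreover have "(\<integral>\<^sup>+x. ennreal (norm (indicator Q x *\<^sub>R w x)) \<partial>lebesgue) = (\<integral>\<^sup>+x\<in>Q. ennreal (w x) \<partial>lebesgue)"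
    using pos by (intro nn_integral_cong_AE) (auto elim!: eventually_mono simp: indicator_def)
  ultimately obtain W where W: "(\<integral>\<^sup>+x\<in>Q. ennreal (w x) \<partial>lebesgue) = ennreal W" "0 \<le> W"
    by (cases "(\<integral>\<^sup>+x\<in>Q. ennreal (w x) \<partial>lebesgue)") auto
  have "W \<noteq> 0"
  proof
    assume "W = 0"
    then have "(\<integral>\<^sup>+x\<in>Q. ennreal (w x) \<partial>lebesgue) = 0" using W by simp
    then have "AE x in lebesgue. ennreal (w x) * indicator Q x = 0"
      by (subst (asm) nn_integral_0_iff_AE) auto
    with pos have "AE x in lebesgue. x \<notin> Q"
      by eventually_elim (auto simp: indicator_def split: if_splits)
    then have "Q \<in> null_sets lebesgue" by (subst (asm) AE_iff_null_sets[symmetric]) auto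
    then show False using m by auto
  qed
  then have "0 < W / m" "average Q w = ennreal (W / m)"
    using W m by (auto simp: average_def divide_ennreal)
  then show ?thesis using that by blast
qed

lemma Linfty_norm_AE:
  assumes "Q \<in> sets lebesgue"
  shows "AE x in lebesgue. x \<in> Q \<longrightarrow> ennreal \<bar>w x\<bar> \<le> Linfty_norm Q w"
proof -
  have "AE x in restrict_space lebesgue Q. ennreal \<bar>w x\<bar> \<le> Linfty_norm Q w"
    unfolding Linfty_norm_def by (rule esssup_AE)
  then show ?thesis using assms by (subst (asm) AE_restrict_space_iff) auto
qed

definition inv_exponent :: "ereal \<Rightarrow> real" where
  "inv_exponent q = (if q = \<infinity> then 0 else 1 / real_of_ereal q)"

lemma conjugate_exponent_ratio:
  assumes "0 < p"
  shows "conjugate_exponent (\<infinity> / ereal p) = 1"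
    and "conjugate_exponent (ereal p / ereal p) = \<infinity>"
    and "p < r \<Longrightarrow> conjugate_exponent (ereal r / ereal p) = ereal (r / (r - p))"
proof -
  show "conjugate_exponent (\<infinity> / ereal p) = 1"
    using assms by (simp add: conjugate_exponent_def)
  show "conjugate_exponent (ereal p / ereal p) = \<infinity>"
    using assms by (simp add: conjugate_exponent_def one_ereal_def)
  assume r: "p < r"
  then have "r / p / (r / p - 1) = r / (r - p)" using assms by (simp add: field_simps)
  then show "conjugate_exponent (ereal r / ereal p) = ereal (r / (r - p))"
    using assms r by (simp add: conjugate_exponent_def one_ereal_def)
qed

text \<open>The average \<open>a\<close> of \<open>w\<close> mediates: the Muckenhoupt condition
  bounds the mean of \<open>1 / v\<close> by \<open>(C1 / a) powr (1 / p)\<close>, the reverse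
  Hoelder condition bounds the mean of \<open>v\<close> by \<open>(C2 * a) powr (1 / p)\<close>, and
  \<open>a\<close> cancels in the product. The endpoints \<open>p = p_minus\<close> and
  \<open>p = p_plus\<close> give the exponent 0, that is, essential bounds.\<close>

lemma weight_class_of_Muckenhoupt_reverse_Hoelder:
  fixes w :: "real ^ 'n \<Rightarrow> real" and p p_minus :: real
  assumes p: "1 \<le> p_minus" "p_minus \<le> p" "ereal p \<le> p_plus"
    and w: "w \<in> Muckenhoupt (p / p_minus)" "w \<in> reverse_Hoelder (conjugate_exponent (p_plus / ereal p))"
  shows "weight_class (1 / p - inv_exponent p_plus) (1 / p_minus - 1 / p)
    (\<lambda>x. positive_part_or_one w x powr (1 / p))"
proof -
  define P where "P = positive_part_or_one w"
  have ww: "weight w" using w(1) by (simp add: Muckenhoupt_def)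
  have wP: "AE x in lebesgue. P x = w x" unfolding P_def by (rule positive_part_or_one_AE[OF ww])
  have P0: "0 < P x" for x by (simp add: P_def positive_part_or_one_pos)
  have p0: "0 < p" "0 < p_minus" using p by auto
  have lower: "\<exists>C\<ge>1. \<forall>Q\<in>cubes. \<forall>a>0. average Q w = ennreal a \<longrightarrow>
      mean_le Q (1 / p_minus - 1 / p) (\<lambda>x. 1 / P x powr (1 / p)) ((C / a) powr (1 / p))"
  proof (cases "p = p_minus")
    case True
    define S where "S = (SUP Q\<in>cubes. average Q w * Linfty_norm Q (\<lambda>x. 1 / w x))"
    have "S < \<infinity>" using w(1) True p0 by (simp add: Muckenhoupt_def S_def)
    then obtain s where s: "S = ennreal s" "0 \<le> s" by (cases S) auto
    show ?thesis
    proof (intro exI[of _ "max 1 s"] conjI ballI allI impI)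
      fix Q :: "(real ^ 'n) set" and a :: real
      assume Q: "Q \<in> cubes" and a: "0 < a" and avg: "average Q w = ennreal a"
      have le: "ennreal a * Linfty_norm Q (\<lambda>x. 1 / w x) \<le> ennreal s"
        unfolding avg[symmetric] s(1)[symmetric] S_def using Q by (rule SUP_upper)
      have "AE x in lebesgue. x \<in> Q \<longrightarrow> 1 / P x powr (1 / p) \<le> (max 1 s / a) powr (1 / p)"
        using Linfty_norm_AE[OF cubes_lebesgue[OF Q], of "\<lambda>x. 1 / w x"] wP
      proof eventually_elim
        case (elim x)
        show ?case
        proof
          assume "x \<in> Q"
          then have "ennreal (1 / P x) \<le> Linfty_norm Q (\<lambda>x. 1 / w x)" using elim P0[of x] by simp
          then have "ennreal a * ennreal (1 / P x) \<le> ennreal s"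
            using le by (meson mult_left_mono order_trans zero_le)
          then have "a * (1 / P x) \<le> s" using a P0[of x] s(2) by (simp add: ennreal_mult[symmetric])
          then have "1 / P x * a \<le> max 1 s" by (simp add: mult.commute)
          then have "1 / P x \<le> max 1 s / a" by (simp only: pos_le_divide_eq[OF a])
          then have "(1 / P x) powr (1 / p) \<le> (max 1 s / a) powr (1 / p)"
            using P0[of x] p0 by (intro powr_mono2) (auto intro: less_imp_le)
          then show "1 / P x powr (1 / p) \<le> (max 1 s / a) powr (1 / p)"
            using P0[of x] by (simp add: powr_divide)
        qed
      qed
      then show "mean_le Q (1 / p_minus - 1 / p) (\<lambda>x. 1 / P x powr (1 / p)) ((max 1 s / a) powr (1 / p))"
        using True by (simp add: mean_le_def)
    qed simp
  next
    case False
    then have pp: "p_minus < p" using p by simp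
    define q where "q = p / p_minus"
    have q: "q > 1" using pp p0 by (simp add: q_def)
    define j where "j = 1 / p_minus - 1 / p"
    have j: "j > 0" using pp p0 by (simp add: j_def frac_less2)
    have qj: "q - 1 = j * p" using p0 by (simp add: q_def j_def field_simps)
    define S where "S = (SUP Q\<in>cubes. average Q w * ennreal_powr (average Q (\<lambda>x. w x powr (- 1 / (q - 1)))) (q - 1))"
    have "S < \<infinity>" using w(1)[folded q_def] q by (simp add: Muckenhoupt_def S_def)
    then obtain s where s: "S = ennreal s" "0 \<le> s" by (cases S) auto
    show ?thesis
    proof (intro exI[of _ "max 1 s"] conjI ballI allI impI)
      fix Q :: "(real ^ 'n) set" and a :: real
      assume Q: "Q \<in> cubes" and a: "0 < a" and avg: "average Q w = ennreal a"
      define X where "X = average Q (\<lambda>x. w x powr (- 1 / (q - 1)))"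
      have le: "ennreal a * ennreal_powr X (q - 1) \<le> ennreal s"
        unfolding avg[symmetric] s(1)[symmetric] S_def X_def using Q by (rule SUP_upper)
      have "ennreal_powr X (q - 1) \<le> ennreal (max 1 s / a)"
      proof (cases "ennreal_powr X (q - 1)")
        case (real u)
        then have "a * u \<le> s" using le a s(2) by (simp add: ennreal_mult[symmetric])
        then have "u * a \<le> max 1 s" by (simp add: mult.commute)
        then have "u \<le> max 1 s / a" by (simp only: pos_le_divide_eq[OF a])
        then show ?thesis using real by (simp add: ennreal_leI)
      next
        case top
        then show ?thesis using le a by (simp add: ennreal_mult_top top_unique)
      qed
      then have "X \<le> ennreal ((max 1 s / a) powr (1 / (q - 1)))"
        using q a by (subst (asm) ennreal_powr_le_iff) auto
      moreover have "X = average Q (\<lambda>x. (1 / P x powr (1 / p)) powr (1 / j))"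
        unfolding X_def
      proof (rule average_cong_AE)
        show "AE x in lebesgue. w x powr (- 1 / (q - 1)) = (1 / P x powr (1 / p)) powr (1 / j)"
          using wP
        proof eventually_elim
          case (elim x)
          have "(1 / P x powr (1 / p)) powr (1 / j) = (P x powr (- (1 / p))) powr (1 / j)"
            by (simp only: powr_minus_divide)
          also have "\<dots> = P x powr (- 1 / (q - 1))"
            unfolding qj powr_powr using j p0 by (simp add: mult.commute)
          finally show ?case using elim by simp
        qed
      qed
      ultimately have "(\<integral>\<^sup>+x\<in>Q. ennreal ((1 / P x powr (1 / p)) powr (1 / j)) \<partial>lebesgue)
          \<le> ennreal ((max 1 s / a) powr (1 / (q - 1))) * emeasure lebesgue Q"
        by (simp add: average_le_iff[OF Q])
      also have "(max 1 s / a) powr (1 / (q - 1)) = ((max 1 s / a) powr (1 / p)) powr (1 / j)"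
        unfolding qj powr_powr by (simp add: mult.commute)
      finally show "mean_le Q (1 / p_minus - 1 / p) (\<lambda>x. 1 / P x powr (1 / p)) ((max 1 s / a) powr (1 / p))"
        unfolding j_def[symmetric] using j by (simp add: mean_le_def)
    qed simp
  qed
  have upper: "\<exists>C\<ge>1. \<forall>Q\<in>cubes. \<forall>a>0. average Q w = ennreal a \<longrightarrow>
      mean_le Q (1 / p - inv_exponent p_plus) (\<lambda>x. P x powr (1 / p)) ((C * a) powr (1 / p))"
  proof (cases p_plus)
    case (real r)
    then have r: "p \<le> r" "inv_exponent p_plus = 1 / r" using p by (auto simp: inv_exponent_def)
    show ?thesis
    proof (cases "p = r")
      case True
      define S where "S = (SUP Q\<in>cubes. Linfty_norm Q w / average Q w)"
      have "S < \<infinity>" using w(2) True p0 real conjugate_exponent_ratio(2)[OF p0(1)]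
        by (simp add: reverse_Hoelder_def S_def one_ereal_def)
      then obtain s where s: "S = ennreal s" "0 \<le> s" by (cases S) auto
      show ?thesis
      proof (intro exI[of _ "max 1 s"] conjI ballI allI impI)
        fix Q :: "(real ^ 'n) set" and a :: real
        assume Q: "Q \<in> cubes" and a: "0 < a" and avg: "average Q w = ennreal a"
        define X where "X = Linfty_norm Q w"
        have le: "X / ennreal a \<le> ennreal s"
          unfolding avg[symmetric] s(1)[symmetric] S_def X_def using Q by (rule SUP_upper)
        have X: "X \<le> ennreal (max 1 s * a)"
        proof (cases X)
          case (real u)
          then have "u / a \<le> s" using le a s(2) by (simp add: divide_ennreal)
          then have "u \<le> s * a" using a by (simp add: field_simps)
          also have "\<dots> \<le> max 1 s * a" using a by (intro mult_right_mono) auto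
          finally show ?thesis using real by (simp add: ennreal_leI)
        next
          case top
          then show ?thesis using le a by (simp add: ennreal_top_divide top_unique)
        qed
        have "AE x in lebesgue. x \<in> Q \<longrightarrow> P x powr (1 / p) \<le> (max 1 s * a) powr (1 / p)"
          using Linfty_norm_AE[OF cubes_lebesgue[OF Q], of w] wP
        proof eventually_elim
          case (elim x)
          show ?case
          proof
            assume "x \<in> Q"
            then have "ennreal (P x) \<le> ennreal (max 1 s * a)" using elim P0[of x] X unfolding X_def by simp
            then have "P x \<le> max 1 s * a" using a by (subst (asm) ennreal_le_iff) auto
            then show "P x powr (1 / p) \<le> (max 1 s * a) powr (1 / p)"
              using P0[of x] p0 by (intro powr_mono2) (auto intro: less_imp_le)
          qed
        qed
        then show "mean_le Q (1 / p - inv_exponent p_plus) (\<lambda>x. P x powr (1 / p)) ((max 1 s * a) powr (1 / p))"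
          using True r by (simp add: mean_le_def)
      qed simp
    next
      case False
      then have pr: "p < r" using r by simp
      define \<sigma> where "\<sigma> = r / (r - p)"
      have sg: "\<sigma> > 1" using pr p0 by (simp add: \<sigma>_def)
      define i where "i = 1 / p - 1 / r"
      have i: "i > 0" using pr p0 by (simp add: i_def frac_less2)
      have ip: "1 / \<sigma> = i * p" using p0 pr by (simp add: i_def \<sigma>_def field_simps)
      have sp: "\<sigma> = 1 / (i * p)" unfolding ip[symmetric] using sg by simp
      define S where "S = (SUP Q\<in>cubes. ennreal_powr (average Q (\<lambda>x. w x powr \<sigma>)) (1 / \<sigma>) / average Q w)"
      have "S < \<infinity>" using w(2) sg real conjugate_exponent_ratio(3)[OF p0(1) pr]
        by (simp add: reverse_Hoelder_def S_def \<sigma>_def[symmetric] one_ereal_def)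
      then obtain s where s: "S = ennreal s" "0 \<le> s" by (cases S) auto
      show ?thesis
      proof (intro exI[of _ "max 1 s"] conjI ballI allI impI)
        fix Q :: "(real ^ 'n) set" and a :: real
        assume Q: "Q \<in> cubes" and a: "0 < a" and avg: "average Q w = ennreal a"
        define X where "X = average Q (\<lambda>x. w x powr \<sigma>)"
        have le: "ennreal_powr X (1 / \<sigma>) / ennreal a \<le> ennreal s"
          unfolding avg[symmetric] s(1)[symmetric] S_def X_def using Q by (rule SUP_upper)
        have "ennreal_powr X (1 / \<sigma>) \<le> ennreal (max 1 s * a)"
        proof (cases "ennreal_powr X (1 / \<sigma>)")
          case (real u)
          then have "u / a \<le> s" using le a s(2) by (simp add: divide_ennreal)
          then have "u \<le> s * a" using a by (simp add: field_simps)
          also have "\<dots> \<le> max 1 s * a" using a by (intro mult_right_mono) auto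
          finally show ?thesis using real by (simp add: ennreal_leI)
        next
          case top
          then show ?thesis using le a by (simp add: ennreal_top_divide top_unique)
        qed
        then have "X \<le> ennreal ((max 1 s * a) powr \<sigma>)"
          using sg a by (subst (asm) ennreal_powr_le_iff) auto
        moreover have "X = average Q (\<lambda>x. (P x powr (1 / p)) powr (1 / i))"
          unfolding X_def
          by (rule average_cong_AE) (use wP in \<open>auto elim!: eventually_mono simp: sp powr_powr mult.commute\<close>)
        ultimately have "(\<integral>\<^sup>+x\<in>Q. ennreal ((P x powr (1 / p)) powr (1 / i)) \<partial>lebesgue)
            \<le> ennreal ((max 1 s * a) powr \<sigma>) * emeasure lebesgue Q"
          by (simp add: average_le_iff[OF Q])
        also have "(max 1 s * a) powr \<sigma> = ((max 1 s * a) powr (1 / p)) powr (1 / i)"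
          unfolding sp powr_powr by (simp add: mult.commute)
        finally show "mean_le Q (1 / p - inv_exponent p_plus) (\<lambda>x. P x powr (1 / p)) ((max 1 s * a) powr (1 / p))"
          unfolding r(2) i_def[symmetric] using i by (simp add: mean_le_def)
      qed simp
    qed
  next
    case PInf
    then have ip: "inv_exponent p_plus = 0" by (simp add: inv_exponent_def)
    show ?thesis
    proof (intro exI[of _ 1] conjI ballI allI impI)
      fix Q :: "(real ^ 'n) set" and a :: real
      assume Q: "Q \<in> cubes" and a: "0 < a" and avg: "average Q w = ennreal a"
      have "average Q P \<le> ennreal a" using average_cong_AE[OF wP, of Q] avg by simp
      then show "mean_le Q (1 / p - inv_exponent p_plus) (\<lambda>x. P x powr (1 / p)) ((1 * a) powr (1 / p))"
        using a p0 P0 average_le_iff[OF Q, of a P] by (simp add: ip mean_le_def powr_powr less_imp_le)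
    qed simp
  next
    case MInf
    then show ?thesis using p by simp
  qed
  obtain C1 where C1: "C1 \<ge> 1" "\<forall>Q\<in>cubes. \<forall>a>0. average Q w = ennreal a \<longrightarrow>
      mean_le Q (1 / p_minus - 1 / p) (\<lambda>x. 1 / P x powr (1 / p)) ((C1 / a) powr (1 / p))"
    using lower by blast
  obtain C2 where C2: "C2 \<ge> 1" "\<forall>Q\<in>cubes. \<forall>a>0. average Q w = ennreal a \<longrightarrow>
      mean_le Q (1 / p - inv_exponent p_plus) (\<lambda>x. P x powr (1 / p)) ((C2 * a) powr (1 / p))"
    using upper by blast
  have "\<forall>Q\<in>cubes. \<exists>\<alpha>>0. \<exists>\<beta>>0. mean_le Q (1 / p - inv_exponent p_plus) (\<lambda>x. P x powr (1 / p)) \<alpha> \<and>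
      mean_le Q (1 / p_minus - 1 / p) (\<lambda>x. 1 / P x powr (1 / p)) \<beta> \<and> \<alpha> * \<beta> \<le> (C1 * C2) powr (1 / p)"
  proof
    fix Q :: "(real ^ 'n) set" assume Q: "Q \<in> cubes"
    obtain a where a: "0 < a" "average Q w = ennreal a" using average_weight[OF ww Q] .
    have "(C2 * a) powr (1 / p) * (C1 / a) powr (1 / p) = (C1 * C2) powr (1 / p)"
      using a C1(1) C2(1) by (simp add: mult.commute flip: powr_mult)
    then have r: "(C2 * a) powr (1 / p) * (C1 / a) powr (1 / p) \<le> (C1 * C2) powr (1 / p)" by simp
    have r': "0 < (C2 * a) powr (1 / p)" "0 < (C1 / a) powr (1 / p)" using a C1(1) C2(1) by auto
    show "\<exists>\<alpha>>0. \<exists>\<beta>>0. mean_le Q (1 / p - inv_exponent p_plus) (\<lambda>x. P x powr (1 / p)) \<alpha> \<and>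
      mean_le Q (1 / p_minus - 1 / p) (\<lambda>x. 1 / P x powr (1 / p)) \<beta> \<and> \<alpha> * \<beta> \<le> (C1 * C2) powr (1 / p)"
      using C1(2) C2(2) Q a r r' by blast
  qed
  then show ?thesis unfolding weight_class_def P_def by blast
qed

text \<open>Converse direction for interior exponents, where the extrapolated space lives. The
  average of \<open>w\<close> is bounded above because \<open>i \<le> 1 / p\<close>.\<close>

lemma Muckenhoupt_reverse_Hoelder_of_weight_class:
  fixes v :: "real ^ 'n \<Rightarrow> real" and p p_minus :: real
  assumes p: "1 \<le> p_minus" "p_minus < p" "ereal p < p_plus"
    and cl: "weight_class (1 / p - inv_exponent p_plus) (1 / p_minus - 1 / p) v"
    and v [measurable]: "v \<in> borel_measurable lebesgue" and v0: "\<And>x. 0 < v x"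
  shows "(\<lambda>x. v x powr p) \<in> Muckenhoupt (p / p_minus) \<inter> reverse_Hoelder (conjugate_exponent (p_plus / ereal p))"
proof -
  define i where "i = 1 / p - inv_exponent p_plus"
  define j where "j = 1 / p_minus - 1 / p"
  define w where "w x = v x powr p" for x
  have wm [measurable]: "w \<in> borel_measurable lebesgue" unfolding w_def by measurable
  have p0: "0 < p" "0 < p_minus" using p by auto
  have j: "j > 0" using p p0 by (simp add: j_def frac_less2)
  have i: "0 < i" "i \<le> 1 / p"
  proof -
    have "0 < i \<and> i \<le> 1 / p"
    proof (cases p_plus)
      case (real r)
      then show ?thesis using p p0 by (simp add: i_def inv_exponent_def frac_less2)
    qed (use p p0 in \<open>auto simp: i_def inv_exponent_def\<close>)
    then show "0 < i" "i \<le> 1 / p" by auto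
  qed
  obtain C where C: "1 \<le> C" "\<And>Q. Q \<in> cubes \<Longrightarrow> \<exists>\<alpha>>0. \<exists>\<beta>>0.
     mean_le Q i v \<alpha> \<and> mean_le Q j (\<lambda>x. 1 / v x) \<beta> \<and> \<alpha> * \<beta> \<le> C"
    using weight_classE[OF cl] unfolding i_def j_def by blast
  have meanp: "mean_le Q (1 / p) v \<alpha>" if "Q \<in> cubes" "0 < \<alpha>" "mean_le Q i v \<alpha>" for Q \<alpha>
    by (rule mean_le_mono_exponent[OF that(3) i that(2) v0 v cubes_lebesgue[OF that(1)]])
  have avgw: "average Q w \<le> ennreal (\<alpha> powr p)" if "Q \<in> cubes" "0 < \<alpha>" "mean_le Q i v \<alpha>" for Q \<alpha>
    using meanp[OF that] p0 average_le_iff[OF that(1), of "\<alpha> powr p" w] by (simp add: mean_le_def w_def)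
  have ww: "weight w"
    unfolding weight_def
  proof (intro conjI allI impI)
    fix K :: "(real ^ 'n) set" assume "compact K"
    then obtain Q where Q: "Q \<in> cubes" "K \<subseteq> Q" by (rule compact_subset_cube)
    obtain \<alpha> where a: "0 < \<alpha>" "mean_le Q i v \<alpha>" using C(2)[OF Q(1)] by blast
    obtain m where m: "emeasure lebesgue Q = ennreal m" using cube_measure[OF Q(1)] .
    have [measurable]: "K \<in> sets lebesgue" using \<open>compact K\<close> by (simp add: borel_compact)
    have "(\<integral>\<^sup>+x. ennreal (norm (indicator K x *\<^sub>R w x)) \<partial>lebesgue) \<le> (\<integral>\<^sup>+x\<in>Q. ennreal (w x) \<partial>lebesgue)"
      using Q(2) by (intro nn_integral_mono) (auto simp: indicator_def w_def)
    also have "\<dots> \<le> ennreal (\<alpha> powr p) * ennreal m"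
      using avgw[OF Q(1) a] average_le_iff[OF Q(1), of "\<alpha> powr p" w] m by simp
    also have "\<dots> < \<infinity>" by (simp add: ennreal_mult_less_top)
    finally show "set_integrable lebesgue K w"
      unfolding set_integrable_def by (intro integrableI_bounded) auto
  next
    have "v x \<noteq> 0" for x using v0[of x] by simp
    then show "AE x in lebesgue. 0 < w x" by (intro AE_I2) (simp add: w_def)
  qed
  have muck: "w \<in> Muckenhoupt (p / p_minus)"
  proof -
    define q where "q = p / p_minus"
    have q: "q > 1" using p p0 by (simp add: q_def)
    have qj: "q - 1 = j * p" using p0 by (simp add: q_def j_def field_simps)
    have "(SUP Q\<in>cubes. average Q w * ennreal_powr (average Q (\<lambda>x. w x powr (- 1 / (q - 1)))) (q - 1)) \<le> ennreal (C powr p)"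
    proof (rule SUP_least)
      fix Q :: "(real ^ 'n) set" assume Q: "Q \<in> cubes"
      obtain \<alpha> \<beta> where ab: "0 < \<alpha>" "0 < \<beta>" "mean_le Q i v \<alpha>" "mean_le Q j (\<lambda>x. 1 / v x) \<beta>" "\<alpha> * \<beta> \<le> C"
        using C(2)[OF Q] by blast
      have eq: "w x powr (- 1 / (q - 1)) = (1 / v x) powr (1 / j)" for x
      proof -
        have "w x powr (- 1 / (q - 1)) = v x powr (- (1 / j))"
          unfolding qj w_def powr_powr using p0 j by simp
        then show ?thesis using v0[of x] by (simp add: powr_divide powr_minus_divide less_imp_le)
      qed
      have "average Q (\<lambda>x. w x powr (- 1 / (q - 1))) \<le> ennreal (\<beta> powr (1 / j))"
        using ab(4) j unfolding eq by (subst average_le_iff[OF Q]) (auto simp: mean_le_def)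
      also have "\<beta> powr (1 / j) = (\<beta> powr p) powr (1 / (q - 1))"
        unfolding qj powr_powr using p0 by simp
      finally have "ennreal_powr (average Q (\<lambda>x. w x powr (- 1 / (q - 1)))) (q - 1) \<le> ennreal (\<beta> powr p)"
        using q by (subst ennreal_powr_le_iff) auto
      then have "average Q w * ennreal_powr (average Q (\<lambda>x. w x powr (- 1 / (q - 1)))) (q - 1)
          \<le> ennreal (\<alpha> powr p) * ennreal (\<beta> powr p)"
        using avgw[OF Q ab(1,3)] by (intro mult_mono) auto
      also have "\<dots> = ennreal ((\<alpha> * \<beta>) powr p)" using ab by (simp add: powr_mult ennreal_mult)
      also have "\<dots> \<le> ennreal (C powr p)" using ab p0 by (intro ennreal_leI powr_mono2) auto
      finally show "average Q w * ennreal_powr (average Q (\<lambda>x. w x powr (- 1 / (q - 1)))) (q - 1) \<le> ennreal (C powr p)" .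
    qed
    then have "(SUP Q\<in>cubes. average Q w * ennreal_powr (average Q (\<lambda>x. w x powr (- 1 / (q - 1)))) (q - 1)) < \<infinity>"
      by (rule le_less_trans) simp
    then show ?thesis unfolding q_def[symmetric] using q ww by (simp add: Muckenhoupt_def)
  qed
  have rh: "w \<in> reverse_Hoelder (conjugate_exponent (p_plus / ereal p))"
  proof (cases p_plus)
    case (real r)
    then have pr: "p < r" using p by simp
    define \<sigma> where "\<sigma> = r / (r - p)"
    have sg: "\<sigma> > 1" using pr p0 by (simp add: \<sigma>_def)
    have ir: "i = 1 / p - 1 / r" using real by (simp add: i_def inv_exponent_def)
    have ip: "1 / \<sigma> = i * p" using p0 pr by (simp add: ir \<sigma>_def field_simps)
    have sp: "\<sigma> = 1 / (i * p)" unfolding ip[symmetric] using sg by simp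
    have "(SUP Q\<in>cubes. ennreal_powr (average Q (\<lambda>x. w x powr \<sigma>)) (1 / \<sigma>) / average Q w) \<le> ennreal (C powr p)"
    proof (rule SUP_least)
      fix Q :: "(real ^ 'n) set" assume Q: "Q \<in> cubes"
      obtain \<alpha> \<beta> where ab: "0 < \<alpha>" "0 < \<beta>" "mean_le Q i v \<alpha>" "mean_le Q j (\<lambda>x. 1 / v x) \<beta>" "\<alpha> * \<beta> \<le> C"
        using C(2)[OF Q] by blast
      obtain a where a: "0 < a" "average Q w = ennreal a" using average_weight[OF ww Q] .
      obtain m where m: "0 < m" "emeasure lebesgue Q = ennreal m" using cube_measure[OF Q] .
      have [measurable]: "Q \<in> sets lebesgue" by (rule cubes_lebesgue[OF Q])
      have eq: "w x powr \<sigma> = v x powr (1 / i)" for x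
        unfolding sp w_def powr_powr using p0 by simp
      have "average Q (\<lambda>x. w x powr \<sigma>) \<le> ennreal (\<alpha> powr (1 / i))"
        using ab(3) i unfolding eq by (subst average_le_iff[OF Q]) (auto simp: mean_le_def)
      also have "\<alpha> powr (1 / i) = (\<alpha> powr p) powr (1 / (1 / \<sigma>))"
        unfolding sp powr_powr using p0 by simp
      finally have top: "ennreal_powr (average Q (\<lambda>x. w x powr \<sigma>)) (1 / \<sigma>) \<le> ennreal (\<alpha> powr p)"
        using sg by (subst ennreal_powr_le_iff) auto
      \<comment> \<open>The reverse Hoelder quotient requires a lower bound for the average of
        \<open>w\<close>; it comes from Hoelder's inequality for the product of \<open>v\<close> and
        \<open>1 / v\<close>, which is 1.\<close>
      have low: "1 \<le> a * \<beta> powr p"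
      proof -
        have ma: "mean_le Q (1 / p) v (a powr (1 / p))"
          using a p0 average_le_iff[OF Q, of a w] by (simp add: mean_le_def w_def powr_powr)
        have "mean_le Q (1 * (1 / p) + 1 * j) (\<lambda>x. v x powr 1 * (1 / v x) powr 1) ((a powr (1 / p)) powr 1 * \<beta> powr 1)"
          by (rule mean_le_hoelder[OF ma ab(4)]) (use a ab v0 p0 j in auto)
        moreover have "(\<lambda>x. v x powr 1 * (1 / v x) powr 1) = (\<lambda>x. 1)"
        proof
          fix x show "v x powr 1 * (1 / v x) powr 1 = 1" using v0[of x] by simp
        qed
        ultimately have me: "mean_le Q (1 / p + j) (\<lambda>x. 1) (a powr (1 / p) * \<beta>)"
          using ab(2) by simp
        have "1 / p + j > 0" using p0 j by (simp add: add_pos_pos)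
        then have "ennreal m \<le> ennreal ((a powr (1 / p) * \<beta>) powr (1 / (1 / p + j))) * ennreal m"
          using me unfolding mean_le_def m(2) by (simp add: m(2)[simplified])
        then have "1 * m \<le> (a powr (1 / p) * \<beta>) powr (1 / (1 / p + j)) * m"
          using m by (simp add: ennreal_mult[symmetric])
        then have "1 \<le> (a powr (1 / p) * \<beta>) powr (1 / (1 / p + j))"
          using m by (simp only: mult_le_cancel_right_pos)
        then have "1 powr (p * (1 / p + j)) \<le> ((a powr (1 / p) * \<beta>) powr (1 / (1 / p + j))) powr (p * (1 / p + j))"
          using p0 \<open>1 / p + j > 0\<close> by (intro powr_mono2) auto
        also have "\<dots> = (a powr (1 / p) * \<beta>) powr p"
          using \<open>1 / p + j > 0\<close> unfolding powr_powr by simp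
        also have "\<dots> = a * \<beta> powr p" using a p0 by (simp add: powr_mult powr_powr)
        finally show ?thesis by simp
      qed
      have "\<alpha> powr p \<le> \<alpha> powr p * (a * \<beta> powr p)" using mult_left_mono[OF low, of "\<alpha> powr p"] by simp
      also have "\<dots> = (\<alpha> * \<beta>) powr p * a" by (simp add: powr_mult)
      also have "\<dots> \<le> C powr p * a" using ab a p0 by (intro mult_right_mono powr_mono2) auto
      finally have "\<alpha> powr p / a \<le> C powr p" using a by (simp add: pos_divide_le_eq)
      have "ennreal_powr (average Q (\<lambda>x. w x powr \<sigma>)) (1 / \<sigma>) / average Q w \<le> ennreal (\<alpha> powr p) / ennreal a"
        unfolding a(2) by (rule divide_right_mono_ennreal[OF top])
      also have "\<dots> = ennreal (\<alpha> powr p / a)" using a by (simp add: divide_ennreal)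
      also have "\<dots> \<le> ennreal (C powr p)" by (rule ennreal_leI) fact
      finally show "ennreal_powr (average Q (\<lambda>x. w x powr \<sigma>)) (1 / \<sigma>) / average Q w \<le> ennreal (C powr p)" .
    qed
    then have "(SUP Q\<in>cubes. ennreal_powr (average Q (\<lambda>x. w x powr \<sigma>)) (1 / \<sigma>) / average Q w) < \<infinity>"
      by (rule le_less_trans) simp
    then show ?thesis
      using ww sg conjugate_exponent_ratio(3)[OF p0(1) pr] real
      by (simp add: reverse_Hoelder_def \<sigma>_def[symmetric] one_ereal_def)
  next
    case PInf
    then show ?thesis using ww conjugate_exponent_ratio(1)[OF p0(1)] by (simp add: reverse_Hoelder_def)
  qed (use p in simp)
  show ?thesis using muck rh by (simp add: w_def[abs_def])
qed

section \<open>Weighted Morrey spaces\<close>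

lemma mult_liminf_le:
  fixes f :: "nat \<Rightarrow> ennreal"
  shows "c * liminf f \<le> liminf (\<lambda>n. c * f n)"
  unfolding liminf_SUP_INF SUP_mult_left_ennreal
  by (intro SUP_mono) (auto intro!: INF_greatest mult_left_mono INF_lower)

text \<open>The \<open>p\<close>-th power of the Morrey norm as a function of the density. The power
  of the measure becomes \<open>\<mu> / CARD('n)\<close>, independent of \<open>p\<close>, so one
  functional serves all exponents.\<close>

definition Morrey_mass :: "real \<Rightarrow> (real ^ 'n \<Rightarrow> ennreal) \<Rightarrow> ennreal" where
  "Morrey_mass \<mu> F = (SUP Q\<in>cubes.
     ennreal (measure lebesgue Q powr (- (\<mu> / CARD('n)))) * (\<integral>\<^sup>+x\<in>Q. F x \<partial>lebesgue))"

lemma measure_cube_pos: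
  assumes "Q \<in> cubes" shows "0 < measure lebesgue Q"
proof -
  obtain m where "0 < m" "emeasure lebesgue Q = ennreal m" using cube_measure[OF assms] .
  then show ?thesis by (simp add: measure_def)
qed

lemma integral_cube_finite:
  fixes F :: "real ^ 'n \<Rightarrow> ennreal"
  assumes "Morrey_mass \<mu> F < \<infinity>" "Q \<in> cubes"
  shows "(\<integral>\<^sup>+x\<in>Q. F x \<partial>lebesgue) < \<infinity>"
proof -
  define k where "k = measure lebesgue Q powr (- (\<mu> / CARD('n)))"
  have k: "k > 0" using measure_cube_pos[OF assms(2)] by (simp add: k_def)
  have "ennreal k * (\<integral>\<^sup>+x\<in>Q. F x \<partial>lebesgue) \<le> Morrey_mass \<mu> F"
    unfolding Morrey_mass_def k_def by (rule SUP_upper[OF assms(2)])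
  then have "ennreal k * (\<integral>\<^sup>+x\<in>Q. F x \<partial>lebesgue) < \<infinity>" using assms(1) by (rule le_less_trans)
  then show ?thesis using k by (auto simp: ennreal_mult_less_top)
qed

lemma fatou_norm_Morrey_mass: "fatou_norm (lebesgue :: (real ^ 'n) measure) (Morrey_mass \<mu>)"
proof
  fix F G :: "real ^ 'n \<Rightarrow> ennreal"
  assume FG [measurable]: "F \<in> borel_measurable lebesgue" "G \<in> borel_measurable lebesgue"
  show "Morrey_mass \<mu> F \<le> Morrey_mass \<mu> G" if "AE x in lebesgue. F x \<le> G x"
    unfolding Morrey_mass_def
  proof (rule SUP_mono')
    fix Q :: "(real ^ 'n) set"
    show "ennreal (measure lebesgue Q powr (- (\<mu> / CARD('n)))) * (\<integral>\<^sup>+x\<in>Q. F x \<partial>lebesgue)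
      \<le> ennreal (measure lebesgue Q powr (- (\<mu> / CARD('n)))) * (\<integral>\<^sup>+x\<in>Q. G x \<partial>lebesgue)"
      using that by (intro mult_left_mono nn_integral_mono_AE) (auto elim!: eventually_mono intro: mult_right_mono)
  qed
  show "Morrey_mass \<mu> (\<lambda>x. F x + G x) \<le> Morrey_mass \<mu> F + Morrey_mass \<mu> G"
    unfolding Morrey_mass_def
  proof (rule SUP_least)
    fix Q :: "(real ^ 'n) set" assume Q: "Q \<in> cubes"
    have [measurable]: "Q \<in> sets lebesgue" by (rule cubes_lebesgue[OF Q])
    define k where "k = ennreal (measure lebesgue Q powr (- (\<mu> / CARD('n))))"
    have "k * (\<integral>\<^sup>+x\<in>Q. F x + G x \<partial>lebesgue) = k * (\<integral>\<^sup>+x\<in>Q. F x \<partial>lebesgue) + k * (\<integral>\<^sup>+x\<in>Q. G x \<partial>lebesgue)"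
      unfolding distrib_right by (subst nn_integral_add) (auto simp: distrib_left)
    also have "\<dots> \<le> (SUP Q\<in>cubes. ennreal (measure lebesgue Q powr (- (\<mu> / CARD('n)))) * (\<integral>\<^sup>+x\<in>Q. F x \<partial>lebesgue))
       + (SUP Q\<in>cubes. ennreal (measure lebesgue Q powr (- (\<mu> / CARD('n)))) * (\<integral>\<^sup>+x\<in>Q. G x \<partial>lebesgue))"
      unfolding k_def by (intro add_mono SUP_upper Q)
    finally show "ennreal (measure lebesgue Q powr (- (\<mu> / CARD('n)))) * (\<integral>\<^sup>+x\<in>Q. F x + G x \<partial>lebesgue)
      \<le> (SUP Q\<in>cubes. ennreal (measure lebesgue Q powr (- (\<mu> / CARD('n)))) * (\<integral>\<^sup>+x\<in>Q. F x \<partial>lebesgue))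
       + (SUP Q\<in>cubes. ennreal (measure lebesgue Q powr (- (\<mu> / CARD('n)))) * (\<integral>\<^sup>+x\<in>Q. G x \<partial>lebesgue))"
      unfolding k_def .
  qed
  show "Morrey_mass \<mu> (\<lambda>x. c * F x) = c * Morrey_mass \<mu> F" for c
    unfolding Morrey_mass_def SUP_mult_left_ennreal
  proof (rule SUP_cong[OF refl])
    fix Q :: "(real ^ 'n) set" assume Q: "Q \<in> cubes"
    have [measurable]: "Q \<in> sets lebesgue" by (rule cubes_lebesgue[OF Q])
    have "(\<integral>\<^sup>+x\<in>Q. c * F x \<partial>lebesgue) = c * (\<integral>\<^sup>+x\<in>Q. F x \<partial>lebesgue)"
      unfolding mult.assoc by (rule nn_integral_cmult) measurable
    then show "ennreal (measure lebesgue Q powr (- (\<mu> / CARD('n)))) * (\<integral>\<^sup>+x\<in>Q. c * F x \<partial>lebesgue)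
      = c * (ennreal (measure lebesgue Q powr (- (\<mu> / CARD('n)))) * (\<integral>\<^sup>+x\<in>Q. F x \<partial>lebesgue))"
      by (simp add: mult_ac)
  qed
  show "AE x in lebesgue. F x < \<infinity>" if fin: "Morrey_mass \<mu> F < \<infinity>"
  proof -
    define Q :: "nat \<Rightarrow> (real ^ 'n) set" where "Q n = cbox (\<chi> i. - real (Suc n)) (\<chi> i. real (Suc n))" for n
    have Qc: "Q n \<in> cubes" for n
      unfolding Q_def cubes_iff
      by (intro exI[of _ "\<chi> i. - real (Suc n)"] exI[of _ "2 * real (Suc n)"]) (simp add: vec_eq_iff)
    have "AE x in lebesgue. x \<in> Q n \<longrightarrow> F x < \<infinity>" for n
    proof -
      have [measurable]: "Q n \<in> sets lebesgue" by (rule cubes_lebesgue[OF Qc])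
      have "(\<integral>\<^sup>+x\<in>Q n. F x \<partial>lebesgue) \<noteq> \<infinity>" using integral_cube_finite[OF fin Qc] by (simp add: less_top)
      then have "AE x in lebesgue. F x * indicator (Q n) x \<noteq> \<infinity>" by (intro nn_integral_PInf_AE) auto
      then show ?thesis by eventually_elim (auto simp: less_top)
    qed
    then have "AE x in lebesgue. \<forall>n. x \<in> Q n \<longrightarrow> F x < \<infinity>" unfolding AE_all_countable by blast
    then show ?thesis
    proof eventually_elim
      case (elim x)
      obtain n where n: "norm x \<le> real n" using real_arch_simple by blast
      have "\<bar>x $ i\<bar> \<le> real (Suc n)" for i using component_le_norm_cart[of x i] n by simp
      then have "x \<in> Q n" by (simp add: Q_def mem_box_cart abs_le_iff) (smt (verit))
      then show ?case using elim by blast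
    qed
  qed
next
  fix F :: "nat \<Rightarrow> real ^ 'n \<Rightarrow> ennreal"
  assume F [measurable]: "\<And>n. F n \<in> borel_measurable lebesgue"
  show "Morrey_mass \<mu> (\<lambda>x. liminf (\<lambda>n. F n x)) \<le> liminf (\<lambda>n. Morrey_mass \<mu> (F n))"
    unfolding Morrey_mass_def[of \<mu> "\<lambda>x. liminf (\<lambda>n. F n x)"]
  proof (rule SUP_least)
    fix Q :: "(real ^ 'n) set" assume Q: "Q \<in> cubes"
    have [measurable]: "Q \<in> sets lebesgue" by (rule cubes_lebesgue[OF Q])
    define k where "k = ennreal (measure lebesgue Q powr (- (\<mu> / CARD('n))))"
    have "(\<integral>\<^sup>+x\<in>Q. liminf (\<lambda>n. F n x) \<partial>lebesgue) = (\<integral>\<^sup>+x. liminf (\<lambda>n. F n x * indicator Q x) \<partial>lebesgue)"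
      by (intro nn_integral_cong) (auto simp: indicator_def Liminf_const)
    also have "\<dots> \<le> liminf (\<lambda>n. \<integral>\<^sup>+x\<in>Q. F n x \<partial>lebesgue)" by (rule nn_integral_liminf) measurable
    finally have "k * (\<integral>\<^sup>+x\<in>Q. liminf (\<lambda>n. F n x) \<partial>lebesgue) \<le> k * liminf (\<lambda>n. \<integral>\<^sup>+x\<in>Q. F n x \<partial>lebesgue)"
      by (rule mult_left_mono) simp
    also have "\<dots> \<le> liminf (\<lambda>n. k * (\<integral>\<^sup>+x\<in>Q. F n x \<partial>lebesgue))" by (rule mult_liminf_le)
    also have "\<dots> \<le> liminf (\<lambda>n. Morrey_mass \<mu> (F n))"
      unfolding Morrey_mass_def k_def by (intro Liminf_mono always_eventually allI SUP_upper Q)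
    finally show "ennreal (measure lebesgue Q powr (- (\<mu> / CARD('n)))) * (\<integral>\<^sup>+x\<in>Q. liminf (\<lambda>n. F n x) \<partial>lebesgue)
      \<le> liminf (\<lambda>n. Morrey_mass \<mu> (F n))" unfolding k_def .
  qed
qed

lemma Morrey_norm_le_iff:
  fixes w :: "real ^ 'n \<Rightarrow> real"
  assumes p: "0 < p" and c: "0 \<le> c"
  shows "Morrey_norm p \<mu> w f \<le> ennreal c \<longleftrightarrow> Morrey_mass \<mu> (pdens p w f) \<le> ennreal (c powr p)"
proof -
  have "ennreal (measure lebesgue Q powr (- (\<mu> / (real CARD('n) * p)))) *
      ennreal_powr (\<integral>\<^sup>+x\<in>Q. ennreal (norm (f x) powr p * w x) \<partial>lebesgue) (1 / p) \<le> ennreal c \<longleftrightarrow>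
      ennreal (measure lebesgue Q powr (- (\<mu> / CARD('n)))) * (\<integral>\<^sup>+x\<in>Q. pdens p w f x \<partial>lebesgue) \<le> ennreal (c powr p)"
    if Q: "Q \<in> cubes" for Q :: "(real ^ 'n) set"
  proof -
    define k where "k = measure lebesgue Q powr (- (\<mu> / (real CARD('n) * p)))"
    have k: "k > 0" using measure_cube_pos[OF Q] by (simp add: k_def)
    have kp: "measure lebesgue Q powr (- (\<mu> / CARD('n))) = k powr p"
      using p by (simp add: k_def powr_powr)
    define I where "I = (\<integral>\<^sup>+x\<in>Q. ennreal (norm (f x) powr p * w x) \<partial>lebesgue)"
    have I': "(\<integral>\<^sup>+x\<in>Q. pdens p w f x \<partial>lebesgue) = I" by (simp add: I_def pdens_def)
    have "ennreal k * ennreal_powr I (1 / p) \<le> ennreal c \<longleftrightarrow> ennreal_powr I (1 / p) \<le> ennreal (c / k)"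
    proof (cases "ennreal_powr I (1 / p)")
      case (real u)
      then show ?thesis using k c by (simp add: ennreal_mult[symmetric] pos_le_divide_eq mult.commute)
    next
      case top
      then show ?thesis using k c by (simp add: ennreal_mult_top top_unique)
    qed
    also have "\<dots> \<longleftrightarrow> I \<le> ennreal ((c / k) powr p)"
      using p k c by (subst ennreal_powr_le_iff) auto
    also have "(c / k) powr p = c powr p / k powr p" using k c by (simp add: powr_divide)
    also have "I \<le> ennreal (c powr p / k powr p) \<longleftrightarrow> ennreal (k powr p) * I \<le> ennreal (c powr p)"
    proof (cases I)
      case (real u)
      then show ?thesis using k by (simp add: ennreal_mult[symmetric] pos_le_divide_eq mult.commute)
    next
      case top
      then show ?thesis using k by (simp add: ennreal_mult_top top_unique)
    qed
    finally show ?thesis unfolding I' kp I_def k_def .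
  qed
  then show ?thesis unfolding Morrey_norm_def Morrey_mass_def SUP_le_iff by blast
qed

lemma Morrey_norm_finite_iff:
  assumes "0 < p"
  shows "Morrey_norm p \<mu> w f < \<infinity> \<longleftrightarrow> Morrey_mass \<mu> (pdens p w f) < \<infinity>"
proof
  assume "Morrey_norm p \<mu> w f < \<infinity>"
  then obtain c where "Morrey_norm p \<mu> w f = ennreal c" "0 \<le> c" by (cases "Morrey_norm p \<mu> w f") auto
  then have "Morrey_mass \<mu> (pdens p w f) \<le> ennreal (c powr p)"
    using Morrey_norm_le_iff[OF assms, of c \<mu> w f] by simp
  then show "Morrey_mass \<mu> (pdens p w f) < \<infinity>" by (rule le_less_trans) simp
next
  assume "Morrey_mass \<mu> (pdens p w f) < \<infinity>"
  then obtain c where c: "Morrey_mass \<mu> (pdens p w f) = ennreal c" "0 \<le> c" by (cases "Morrey_mass \<mu> (pdens p w f)") auto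
  then have "Morrey_norm p \<mu> w f \<le> ennreal (c powr (1 / p))"
    using Morrey_norm_le_iff[OF assms, of "c powr (1 / p)" \<mu> w f] assms by (simp add: powr_powr)
  then show "Morrey_norm p \<mu> w f < \<infinity>" by (rule le_less_trans) simp
qed

lemma Morrey_norm_tendsto_zero_iff:
  assumes "0 < p"
  shows "(\<lambda>n. Morrey_norm p \<mu> w (f n)) \<longlonglongrightarrow> 0 \<longleftrightarrow> (\<lambda>n. Morrey_mass \<mu> (pdens p w (f n))) \<longlonglongrightarrow> 0"
proof -
  have zero: "X \<longlonglongrightarrow> 0 \<longleftrightarrow> (\<forall>e>0. \<forall>\<^sub>F n in sequentially. X n \<le> ennreal e)" for X :: "nat \<Rightarrow> ennreal"
  proof
    assume lim: "X \<longlonglongrightarrow> 0"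
    show "\<forall>e>0. \<forall>\<^sub>F n in sequentially. X n \<le> ennreal e"
    proof (intro allI impI)
      fix e :: real assume "0 < e"
      then have "\<forall>\<^sub>F n in sequentially. X n < ennreal e" by (intro order_tendstoD(2)[OF lim]) simp
      then show "\<forall>\<^sub>F n in sequentially. X n \<le> ennreal e" by (rule eventually_mono) simp
    qed
  next
    assume *: "\<forall>e>0. \<forall>\<^sub>F n in sequentially. X n \<le> ennreal e"
    show "X \<longlonglongrightarrow> 0"
    proof (rule order_tendstoI)
      fix a :: ennreal assume "0 < a"
      then obtain e where e: "0 < e" "ennreal e < a"
        using dense[of 0 a] by (metis ennreal_cases ennreal_less_zero_iff less_top_ennreal not_less_iff_gr_or_eq order.strict_trans)
      then show "\<forall>\<^sub>F n in sequentially. X n < a"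
        using *[rule_format, OF e(1)] by (auto elim!: eventually_mono)
    qed simp
  qed
  show ?thesis
  proof
    assume L: "(\<lambda>n. Morrey_norm p \<mu> w (f n)) \<longlonglongrightarrow> 0"
    show "(\<lambda>n. Morrey_mass \<mu> (pdens p w (f n))) \<longlonglongrightarrow> 0"
      unfolding zero
    proof (intro allI impI)
      fix e :: real assume e: "0 < e"
      have "\<forall>\<^sub>F n in sequentially. Morrey_norm p \<mu> w (f n) \<le> ennreal (e powr (1 / p))"
        using L e unfolding zero by simp
      then show "\<forall>\<^sub>F n in sequentially. Morrey_mass \<mu> (pdens p w (f n)) \<le> ennreal e"
        using e assms by (auto elim!: eventually_mono simp: Morrey_norm_le_iff powr_powr)
    qed
  next
    assume L: "(\<lambda>n. Morrey_mass \<mu> (pdens p w (f n))) \<longlonglongrightarrow> 0"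
    show "(\<lambda>n. Morrey_norm p \<mu> w (f n)) \<longlonglongrightarrow> 0"
      unfolding zero
    proof (intro allI impI)
      fix e :: real assume e: "0 < e"
      have "\<forall>\<^sub>F n in sequentially. Morrey_mass \<mu> (pdens p w (f n)) \<le> ennreal (e powr p)"
        using L e unfolding zero by simp
      then show "\<forall>\<^sub>F n in sequentially. Morrey_norm p \<mu> w (f n) \<le> ennreal e"
        using e assms by (auto elim!: eventually_mono simp: Morrey_norm_le_iff)
    qed
  qed
qed

lemma Morrey_mass_cong_weight:
  assumes "AE x in lebesgue. u x = w x"
  shows "Morrey_mass \<mu> (pdens p u f) = Morrey_mass \<mu> (pdens p w f)"
proof -
  have "(\<integral>\<^sup>+x\<in>Q. pdens p u f x \<partial>lebesgue) = (\<integral>\<^sup>+x\<in>Q. pdens p w f x \<partial>lebesgue)" for Q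
    by (intro nn_integral_cong_AE) (use assms in \<open>auto elim!: eventually_mono simp: pdens_def\<close>)
  then show ?thesis by (simp add: Morrey_mass_def)
qed

interpretation Morrey: fatou_norm lebesgue "Morrey_mass \<mu>" for \<mu>
  by (rule fatou_norm_Morrey_mass)

text \<open>Every compact set lies in a cube, so finite mass already implies local integrability.
  The positive representative \<open>u\<close> gives the same space as \<open>w\<close>.\<close>

lemma Morrey_eq_mspace:
  fixes u w :: "real ^ 'n \<Rightarrow> real"
  assumes "0 < p" "AE x in lebesgue. u x = w x"
  shows "Morrey p \<mu> w = Morrey.mspace \<mu> p u"
proof -
  have "f \<in> Lp_loc p w" if f: "f \<in> borel_measurable lebesgue" "Morrey_mass \<mu> (pdens p w f) < \<infinity>" for f
    unfolding Lp_loc_def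
  proof (intro CollectI conjI allI impI f(1))
    fix K :: "(real ^ 'n) set" assume "compact K"
    then obtain Q where Q: "Q \<in> cubes" "K \<subseteq> Q" by (rule compact_subset_cube)
    have "(\<integral>\<^sup>+x\<in>K. ennreal (norm (f x) powr p * w x) \<partial>lebesgue) \<le> (\<integral>\<^sup>+x\<in>Q. pdens p w f x \<partial>lebesgue)"
      using Q(2) by (intro nn_integral_mono) (auto simp: pdens_def indicator_def)
    also have "\<dots> < \<infinity>" by (rule integral_cube_finite[OF f(2) Q(1)])
    finally show "(\<integral>\<^sup>+x\<in>K. ennreal (norm (f x) powr p * w x) \<partial>lebesgue) < \<infinity>" .
  qed
  moreover have "f \<in> borel_measurable lebesgue" if "f \<in> Lp_loc p w" for f
    using that by (simp add: Lp_loc_def)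
  ultimately show ?thesis
    unfolding Morrey_def Morrey.mspace_def Morrey_norm_finite_iff[OF assms(1)]
      Morrey_mass_cong_weight[OF assms(2)] by blast
qed

text \<open>For \<open>v = w powr (1 / p)\<close>, and likewise \<open>v0\<close> and
  \<open>v1\<close>, the extrapolation reads
  \<open>v0 = v powr (1 + \<eta>) * v1 powr (- \<eta>)\<close>. Solving for \<open>w\<close> as a
  product of powers of \<open>w0\<close> and \<open>w1\<close> determines \<open>t\<close>; the last
  two equations are the comparison of exponents.\<close>

lemma convex_exponent_data:
  fixes p p1 \<eta> :: real
  assumes p: "0 < p" "0 < p1" and \<eta>: "0 < \<eta>" and p0: "1 / p0 = (1 + \<eta>) / p - \<eta> / p1" "0 < p0"
  defines "t \<equiv> p * \<eta> / ((1 + \<eta>) * p1)"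
  shows "0 < t" "t < 1" "p = (1 - t) * p0 + t * p1" "p0 * (1 - t) * (1 + \<eta>) = p"
    "p0 * (1 - t) * \<eta> = t * p1"
proof -
  show "0 < t" using assms by (simp add: t_def)
  have tp: "t * p1 = p * (\<eta> / (1 + \<eta>))" using p by (simp add: t_def)
  have "1 - t = p / (1 + \<eta>) * ((1 + \<eta>) / p - \<eta> / p1)"
    using p \<eta> by (simp add: t_def right_diff_distrib mult.commute)
  also have "\<dots> = p / (1 + \<eta>) * (1 / p0)" by (simp only: p0(1))
  finally have s: "p0 * (1 - t) = p / (1 + \<eta>)" using p0(2) by simp
  have "p0 * (1 - t) > 0" unfolding s using p \<eta> by simp
  then show "t < 1" using p0(2) by (simp add: zero_less_mult_iff)
  show 4: "p0 * (1 - t) * (1 + \<eta>) = p" unfolding s using \<eta> by simp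
  show 5: "p0 * (1 - t) * \<eta> = t * p1" unfolding s tp by simp
  show "p = (1 - t) * p0 + t * p1"
    unfolding 5[symmetric] 4[symmetric, simplified] using 4 by (simp add: algebra_simps)
qed

theorem theorem1p8:
  fixes \<mu> p_minus p1 :: real and p_plus :: ereal
    and w1 :: "real ^ 'n \<Rightarrow> real"
    and V :: "(real ^ 'n \<Rightarrow> complex) set"
    and T :: "(real ^ 'n \<Rightarrow> complex) \<Rightarrow> (real ^ 'n \<Rightarrow> complex)"
  assumes "0 < \<mu>" and "\<mu> < real CARD('n)"
    and "1 \<le> p_minus" and "ereal p_minus < p_plus"
    and "p_minus \<le> p1" and "ereal p1 \<le> p_plus"
    and "w1 \<in> Muckenhoupt (p1 / p_minus) \<inter>
               reverse_Hoelder (conjugate_exponent (p_plus / ereal p1))"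
    and "linear_operator_on V T"
    and "\<forall>p w. p_minus < p \<and> ereal p < p_plus \<and>
               w \<in> Muckenhoupt (p / p_minus) \<inter>
                    reverse_Hoelder (conjugate_exponent (p_plus / ereal p)) \<longrightarrow>
               Morrey p \<mu> w \<subseteq> V \<and>
               bounded_operator_on (Morrey p \<mu> w) (Morrey_norm p \<mu> w) T"
    and "Morrey p1 \<mu> w1 \<subseteq> V"
    and "compact_operator_on (Morrey p1 \<mu> w1) (Morrey_norm p1 \<mu> w1) T"
  shows "\<forall>p w. p_minus < p \<and> ereal p < p_plus \<and>
               w \<in> Muckenhoupt (p / p_minus) \<inter>
                    reverse_Hoelder (conjugate_exponent (p_plus / ereal p)) \<longrightarrow>
               compact_operator_on (Morrey p \<mu> w) (Morrey_norm p \<mu> w) T"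
proof (intro allI impI)
  fix p :: real and w :: "real ^ 'n \<Rightarrow> real"
  assume pw: "p_minus < p \<and> ereal p < p_plus \<and> w \<in> Muckenhoupt (p / p_minus) \<inter>
    reverse_Hoelder (conjugate_exponent (p_plus / ereal p))"
  then have bndp: "Morrey p \<mu> w \<subseteq> V" "bounded_operator_on (Morrey p \<mu> w) (Morrey_norm p \<mu> w) T"
    using assms(9) by blast+
  have pos: "0 < p_minus" "0 < p" "0 < p1" using assms pw by auto
  have wts: "weight w" "weight w1" using pw assms(7) by (auto simp: Muckenhoupt_def)
  define P where "P = positive_part_or_one w"
  define P1 where "P1 = positive_part_or_one w1"
  have Pw: "AE x in lebesgue. P x = w x" "AE x in lebesgue. P1 x = w1 x"
    unfolding P_def P1_def using wts by (auto intro: positive_part_or_one_AE)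
  have P0: "0 < P x" "0 < P1 x" for x by (simp_all add: P_def P1_def positive_part_or_one_pos)
  have Pm [measurable]: "P \<in> borel_measurable lebesgue" "P1 \<in> borel_measurable lebesgue"
    unfolding P_def P1_def using wts weight_measurable by (auto intro: positive_part_or_one_measurable)
  define i where "i = 1 / p - inv_exponent p_plus"
  define j where "j = 1 / p_minus - 1 / p"
  define i1 where "i1 = 1 / p1 - inv_exponent p_plus"
  define j1 where "j1 = 1 / p_minus - 1 / p1"
  have cl: "weight_class i j (\<lambda>x. P x powr (1 / p))"
    unfolding i_def j_def P_def
    using pw assms by (intro weight_class_of_Muckenhoupt_reverse_Hoelder) auto
  have cl1: "weight_class i1 j1 (\<lambda>x. P1 x powr (1 / p1))"
    unfolding i1_def j1_def P1_def
    using assms by (intro weight_class_of_Muckenhoupt_reverse_Hoelder) auto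
  have ij: "0 < i" "0 < j" "0 \<le> i1" "0 \<le> j1" "i1 + j1 = i + j" "0 \<le> inv_exponent p_plus"
  proof -
    show "0 < j" using pos pw by (simp add: j_def frac_less2)
    show "0 \<le> j1" using pos assms(5) by (simp add: j1_def frac_le)
    show "i1 + j1 = i + j" by (simp add: i_def j_def i1_def j1_def)
    have "0 < i \<and> 0 \<le> i1 \<and> 0 \<le> inv_exponent p_plus"
    proof (cases p_plus)
      case (real r)
      then show ?thesis using pos pw assms(6)
        by (simp add: i_def i1_def inv_exponent_def frac_less2 frac_le)
    next
      case PInf
      then show ?thesis using pos by (simp add: i_def i1_def inv_exponent_def)
    qed (use pw in auto)
    then show "0 < i" "0 \<le> i1" "0 \<le> inv_exponent p_plus" by auto
  qed
  define v0 where "v0 \<eta> x = (P x powr (1 / p)) powr (1 + \<eta>) * (P1 x powr (1 / p1)) powr (- \<eta>)" for \<eta> x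
  obtain \<eta> where \<eta>: "0 < \<eta>" "0 < (1 + \<eta>) * i - \<eta> * i1" "0 < (1 + \<eta>) * j - \<eta> * j1"
    "weight_class ((1 + \<eta>) * i - \<eta> * i1) ((1 + \<eta>) * j - \<eta> * j1) (v0 \<eta>)"
    unfolding v0_def[abs_def]
    by (rule weight_class_extrapolate[OF cl cl1 _ _ _ _ ij(1-5)]) (use P0 in \<open>auto simp: less_imp_neq[symmetric]\<close>)
  \<comment> \<open>Reciprocal exponents follow the same affine rule as \<open>i\<close> and
    \<open>j\<close>, so the extrapolated class is the one belonging to \<open>p0\<close>.\<close>
  define p0 where "p0 = 1 / ((1 + \<eta>) / p - \<eta> / p1)"
  have i0: "(1 + \<eta>) * i - \<eta> * i1 = 1 / p0 - inv_exponent p_plus"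
    by (simp add: i_def i1_def p0_def algebra_simps)
  have j0: "(1 + \<eta>) * j - \<eta> * j1 = 1 / p_minus - 1 / p0"
    by (simp add: j_def j1_def p0_def algebra_simps add_divide_distrib)
  \<comment> \<open>Positivity of the two extrapolated exponents says exactly that \<open>p0\<close>
    is interior, so \<open>T\<close> is bounded on the extrapolated space by hypothesis.\<close>
  have ip0: "inv_exponent p_plus < 1 / p0" "1 / p0 < 1 / p_minus" using \<eta>(2,3) unfolding i0 j0 by auto
  then have p0: "0 < p0" using ij(6) by (smt (verit) zero_less_divide_1_iff)
  have p0m: "p_minus < p0" using ip0(2) p0 pos(1) by (simp add: frac_less2 divide_less_cancel field_simps)
  have p0p: "ereal p0 < p_plus"
  proof (cases p_plus)
    case (real r)
    then have "0 < r" using pw pos by auto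
    then show ?thesis using ip0(1) p0 real by (simp add: inv_exponent_def field_simps)
  qed (use pw in auto)
  define w0 where "w0 x = v0 \<eta> x powr p0" for x
  have v0m [measurable]: "v0 \<eta> \<in> borel_measurable lebesgue" unfolding v0_def[abs_def] by measurable
  have v0p: "0 < v0 \<eta> x" for x using P0[of x] by (simp add: v0_def)
  have w0p: "0 < w0 x" for x using v0p[of x] by (simp add: w0_def)
  have w0m [measurable]: "w0 \<in> borel_measurable lebesgue" unfolding w0_def[abs_def] by measurable
  have "w0 \<in> Muckenhoupt (p0 / p_minus) \<inter> reverse_Hoelder (conjugate_exponent (p_plus / ereal p0))"
    unfolding w0_def[abs_def]
    by (rule Muckenhoupt_reverse_Hoelder_of_weight_class[OF assms(3) p0m p0p _ v0m v0p])
       (use \<eta>(4) in \<open>simp add: i0 j0\<close>)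
  then have bnd0: "Morrey p0 \<mu> w0 \<subseteq> V" "bounded_operator_on (Morrey p0 \<mu> w0) (Morrey_norm p0 \<mu> w0) T"
    using assms(9) p0m p0p by blast+
  define t where "t = p * \<eta> / ((1 + \<eta>) * p1)"
  have "1 / p0 = (1 + \<eta>) / p - \<eta> / p1" by (simp add: p0_def)
  note t = convex_exponent_data[OF pos(2,3) \<eta>(1) this p0, folded t_def]
  have P_eq: "P = (\<lambda>x. w0 x powr (1 - t) * P1 x powr t)"
  proof
    fix x
    have "w0 x powr (1 - t) = P x powr (1 / p * (p0 * (1 - t) * (1 + \<eta>))) * P1 x powr (- (1 / p1 * (p0 * (1 - t) * \<eta>)))"
      by (simp add: w0_def v0_def powr_mult powr_powr mult_ac)
    also have "\<dots> = P x * P1 x powr (- t)"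
      unfolding t(4,5) using P0[of x] pos by simp
    finally show "P x = w0 x powr (1 - t) * P1 x powr t"
      using P0[of x] by (simp add: mult.assoc powr_add[symmetric])
  qed
  have M0: "Morrey p0 \<mu> w0 = Morrey.mspace \<mu> p0 w0" by (rule Morrey_eq_mspace[OF p0]) simp
  have M1: "Morrey p1 \<mu> w1 = Morrey.mspace \<mu> p1 P1" by (rule Morrey_eq_mspace[OF pos(3) Pw(2)])
  have Mp: "Morrey p \<mu> w = Morrey.mspace \<mu> p P" by (rule Morrey_eq_mspace[OF pos(2) Pw(1)])
  note lin = assms(8)[unfolded linear_operator_on_def measurable_function_space_def]
  obtain C where C: "\<And>f. f \<in> Morrey p0 \<mu> w0 \<Longrightarrow> Morrey_norm p0 \<mu> w0 (T f) \<le> ennreal C * Morrey_norm p0 \<mu> w0 f"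
    using bnd0(2) by (auto simp: bounded_operator_on_def)
  \<comment> \<open>\<open>ennreal\<close> sends a negative \<open>C\<close> to 0, so the bound
    persists, and the \<open>p0\<close>-th power is the constant for the mass.\<close>
  define C' where "C' = max C 0"
  interpret ci: compact_interpolation lebesgue "Morrey_mass \<mu>" p0 p1 p t w0 P1 P V T "C' powr p0"
  proof
    show "0 < p0" "0 < p1" "0 < t" "t < 1" "p = (1 - t) * p0 + t * p1" using p0 pos t by auto
    show "w0 \<in> borel_measurable lebesgue" "P1 \<in> borel_measurable lebesgue" by measurable
    show "0 < w0 x" "0 < P1 x" for x by (rule w0p, rule P0)
    show "P = (\<lambda>x. w0 x powr (1 - t) * P1 x powr t)" by (rule P_eq)
    show "Morrey.mspace \<mu> p0 w0 \<subseteq> V" "Morrey.mspace \<mu> p1 P1 \<subseteq> V" "Morrey.mspace \<mu> p P \<subseteq> V"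
      using bnd0(1) assms(10) bndp(1) unfolding M0 M1 Mp by auto
    show "(\<lambda>x. f x + g x) \<in> V" if "f \<in> V" "g \<in> V" for f g using lin that by blast
    show "(\<lambda>x. c * f x) \<in> V" if "f \<in> V" for c f using lin that by blast
    show "T f \<in> borel_measurable lebesgue" if "f \<in> V" for f using lin that by blast
    show "AE x in lebesgue. T (\<lambda>y. f y + g y) x = T f x + T g x" if "f \<in> V" "g \<in> V" for f g
      using lin that by blast
    show "AE x in lebesgue. T (\<lambda>y. c * f y) x = c * T f x" if "f \<in> V" for c f using lin that by blast
    show "T f \<in> Morrey.mspace \<mu> p1 P1" if "f \<in> Morrey.mspace \<mu> p1 P1" for f
      using assms(11) that unfolding compact_operator_on_def M1 by blast
    show "0 \<le> C' powr p0" by simp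
    show "Morrey_mass \<mu> (pdens p0 w0 (T f)) \<le> ennreal (C' powr p0) * Morrey_mass \<mu> (pdens p0 w0 f)"
      if f: "f \<in> Morrey.mspace \<mu> p0 w0" for f
    proof -
      obtain y where y: "Morrey_mass \<mu> (pdens p0 w0 f) = ennreal y" "0 \<le> y"
        using f by (cases "Morrey_mass \<mu> (pdens p0 w0 f)") (auto simp: Morrey.mspace_def)
      have "Morrey_norm p0 \<mu> w0 f \<le> ennreal (y powr (1 / p0))"
        using y p0 by (subst Morrey_norm_le_iff) (auto simp: powr_powr)
      then have "ennreal C * Morrey_norm p0 \<mu> w0 f \<le> ennreal C' * ennreal (y powr (1 / p0))"
        by (intro mult_mono ennreal_leI) (auto simp: C'_def)
      then have "Morrey_norm p0 \<mu> w0 (T f) \<le> ennreal (C' * y powr (1 / p0))"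
        using C[of f] f unfolding M0 by (simp add: ennreal_mult C'_def)
      then have "Morrey_mass \<mu> (pdens p0 w0 (T f)) \<le> ennreal ((C' * y powr (1 / p0)) powr p0)"
        using p0 by (subst (asm) Morrey_norm_le_iff) (auto simp: C'_def)
      also have "(C' * y powr (1 / p0)) powr p0 = C' powr p0 * y"
        using y p0 by (simp add: powr_mult powr_powr)
      finally show ?thesis using y by (simp add: ennreal_mult)
    qed
    show "\<exists>g\<in>Morrey.mspace \<mu> p1 P1. \<exists>r :: nat \<Rightarrow> nat. strict_mono r \<and>
        (\<lambda>n. Morrey_mass \<mu> (pdens p1 P1 (\<lambda>x. T (s (r n)) x - g x))) \<longlonglongrightarrow> 0"
      if s: "\<And>n::nat. s n \<in> Morrey.mspace \<mu> p1 P1" "\<And>n. Morrey_mass \<mu> (pdens p1 P1 (s n)) \<le> ennreal C" for s C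
    proof -
      have "Morrey_norm p1 \<mu> w1 (s n) \<le> ennreal (max C 0 powr (1 / p1))" for n
      proof -
        have "Morrey_mass \<mu> (pdens p1 w1 (s n)) \<le> ennreal (max C 0)"
          using s(2)[of n] unfolding Morrey_mass_cong_weight[OF Pw(2)] by (rule order_trans) (simp add: ennreal_leI)
        then show ?thesis using pos by (subst Morrey_norm_le_iff) (auto simp: powr_powr)
      qed
      then have bnd: "\<exists>C::real. \<forall>f\<in>range s. Morrey_norm p1 \<mu> w1 f \<le> ennreal C" by auto
      have "range s \<subseteq> Morrey p1 \<mu> w1" using s(1) unfolding M1 by blast
      with bnd have rel: "relatively_compact_in (Morrey p1 \<mu> w1) (Morrey_norm p1 \<mu> w1) (T ` range s)"
        by (intro assms(11)[unfolded compact_operator_on_def, THEN conjunct2, rule_format])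
      have "range (\<lambda>n. T (s n)) \<subseteq> T ` range s" by auto
      then have "\<exists>g\<in>Morrey p1 \<mu> w1. \<exists>r :: nat \<Rightarrow> nat. strict_mono r \<and>
          (\<lambda>n. Morrey_norm p1 \<mu> w1 (\<lambda>x. T (s (r n)) x - g x)) \<longlonglongrightarrow> 0"
        using rel[unfolded relatively_compact_in_def, THEN conjunct2, THEN spec, of "\<lambda>n. T (s n)"] by simp
      then show ?thesis
        unfolding M1 Morrey_norm_tendsto_zero_iff[OF pos(3)] Morrey_mass_cong_weight[OF Pw(2)] by blast
    qed
  qed
  have TM: "T f \<in> Morrey.mspace \<mu> p P" if "f \<in> Morrey.mspace \<mu> p P" for f
    using bndp(2) that unfolding bounded_operator_on_def Mp by blast
  show "compact_operator_on (Morrey p \<mu> w) (Morrey_norm p \<mu> w) T"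
    unfolding compact_operator_on_def
  proof (intro conjI ballI allI impI)
    show "T f \<in> Morrey p \<mu> w" if "f \<in> Morrey p \<mu> w" for f using TM that unfolding Mp by blast
    fix B assume B: "B \<subseteq> Morrey p \<mu> w" and "\<exists>C::real. \<forall>f\<in>B. Morrey_norm p \<mu> w f \<le> ennreal C"
    then obtain C where C: "\<And>f. f \<in> B \<Longrightarrow> Morrey_norm p \<mu> w f \<le> ennreal C" by blast
    define D where "D = max C 1"
    have D: "D \<ge> 1" by (simp add: D_def)
    show "relatively_compact_in (Morrey p \<mu> w) (Morrey_norm p \<mu> w) (T ` B)"
      unfolding relatively_compact_in_def
    proof (intro conjI allI impI)
      show "T ` B \<subseteq> Morrey p \<mu> w" using B TM unfolding Mp by blast
      fix s :: "nat \<Rightarrow> real ^ 'n \<Rightarrow> complex" assume "range s \<subseteq> T ` B"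
      then have "\<forall>n. \<exists>f. f \<in> B \<and> s n = T f" by blast
      then obtain f where f: "\<And>n. f n \<in> B" "\<And>n. s n = T (f n)" by metis
      \<comment> \<open>Division by \<open>D\<close> moves the bounded set into the unit ball; the
        limit is multiplied by \<open>D\<close> afterwards.\<close>
      define h where "h n = (\<lambda>x. complex_of_real (1 / D) * f n x)" for n
      have fM: "f n \<in> Morrey.mspace \<mu> p P" for n using f(1) B unfolding Mp by blast
      have fm [measurable]: "f n \<in> borel_measurable lebesgue" for n using fM Morrey.mspace_meas by blast
      have hb: "h n \<in> ci.unit_ball" for n
      proof -
        have "Morrey_norm p \<mu> w (f n) \<le> ennreal D"
          using C[OF f(1)] by (rule order_trans) (simp add: D_def ennreal_leI)
        then have le: "Morrey_mass \<mu> (pdens p P (f n)) \<le> ennreal (D powr p)"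
          using D pos by (subst (asm) Morrey_norm_le_iff) (auto simp: Morrey_mass_cong_weight[OF Pw(1)])
        have "pdens p P (h n) = (\<lambda>x. ennreal ((1 / D) powr p) * pdens p P (f n) x)"
        proof
          fix x show "pdens p P (h n) x = ennreal ((1 / D) powr p) * pdens p P (f n) x"
            unfolding h_def using D P0[of x] by (subst pdens_cmult) (auto simp: norm_divide)
        qed
        then have "Morrey_mass \<mu> (pdens p P (h n)) = ennreal ((1 / D) powr p) * Morrey_mass \<mu> (pdens p P (f n))"
          by (simp add: Morrey.Phi_cmult)
        also have "\<dots> \<le> ennreal ((1 / D) powr p) * ennreal (D powr p)" by (intro mult_left_mono le) simp
        also have "\<dots> = 1" using D by (simp add: ennreal_mult[symmetric] powr_mult[symmetric])
        finally show ?thesis unfolding ci.unit_ball_def h_def by simp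
      qed
      have "\<exists>g\<in>Morrey.mspace \<mu> p P. \<exists>r :: nat \<Rightarrow> nat. strict_mono r \<and>
          (\<lambda>n. Morrey_mass \<mu> (pdens p P (\<lambda>x. T (h (r n)) x - g x))) \<longlonglongrightarrow> 0"
        by (rule ci.T_compact_unit_ball[OF TM hb])
      then obtain g' r where g': "g' \<in> Morrey.mspace \<mu> p P" "strict_mono (r :: nat \<Rightarrow> nat)"
        "(\<lambda>n. Morrey_mass \<mu> (pdens p P (\<lambda>x. T (h (r n)) x - g' x))) \<longlonglongrightarrow> 0"
        by (elim bexE exE conjE) (rule that)
      have [measurable]: "g' \<in> borel_measurable lebesgue" using g'(1) by (rule Morrey.mspace_meas)
      define g where "g = (\<lambda>x. complex_of_real D * g' x)"
      have sc: "Morrey_mass \<mu> (pdens p P (\<lambda>x. complex_of_real D * q x)) = ennreal (D powr p) * Morrey_mass \<mu> (pdens p P q)"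
        if [measurable]: "q \<in> borel_measurable lebesgue" for q
      proof -
        have "pdens p P (\<lambda>x. complex_of_real D * q x) = (\<lambda>x. ennreal (D powr p) * pdens p P q x)"
        proof
          fix x show "pdens p P (\<lambda>x. complex_of_real D * q x) x = ennreal (D powr p) * pdens p P q x"
            using D P0[of x] by (subst pdens_cmult) auto
        qed
        then show ?thesis by (simp add: Morrey.Phi_cmult)
      qed
      have "g \<in> Morrey.mspace \<mu> p P"
        using g'(1) sc[of g'] by (auto simp: Morrey.mspace_def g_def ennreal_mult_less_top)
      moreover have "(\<lambda>n. Morrey_mass \<mu> (pdens p P (\<lambda>x. s (r n) x - g x))) \<longlonglongrightarrow> 0"
      proof -
        have "Morrey_mass \<mu> (pdens p P (\<lambda>x. s (r n) x - g x))
            = ennreal (D powr p) * Morrey_mass \<mu> (pdens p P (\<lambda>x. T (h (r n)) x - g' x))" for n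
        proof -
          have fV: "f (r n) \<in> V" using fM bndp(1) unfolding Mp by blast
          have hV: "h (r n) \<in> V" using lin fV unfolding h_def by blast
          have [measurable]: "T (f (r n)) \<in> borel_measurable lebesgue" "T (h (r n)) \<in> borel_measurable lebesgue"
            using lin fV hV by blast+
          have "AE x in lebesgue. T (h (r n)) x = complex_of_real (1 / D) * T (f (r n)) x"
            unfolding h_def using lin fV by blast
          then have "AE x in lebesgue. s (r n) x - g x = complex_of_real D * (T (h (r n)) x - g' x)"
            by eventually_elim (use D in \<open>simp add: f(2) g_def right_diff_distrib\<close>)
          then have "Morrey_mass \<mu> (pdens p P (\<lambda>x. s (r n) x - g x))
              = Morrey_mass \<mu> (pdens p P (\<lambda>x. complex_of_real D * (T (h (r n)) x - g' x)))"
            unfolding f(2) g_def by (intro Morrey.Phi_pdens_cong) auto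
          then show ?thesis by (simp add: sc)
        qed
        moreover have "(\<lambda>n. ennreal (D powr p) * Morrey_mass \<mu> (pdens p P (\<lambda>x. T (h (r n)) x - g' x))) \<longlonglongrightarrow> ennreal (D powr p) * 0"
          by (intro ennreal_tendsto_cmult g'(3)) simp
        ultimately show ?thesis by simp
      qed
      ultimately show "\<exists>g\<in>Morrey p \<mu> w. \<exists>r :: nat \<Rightarrow> nat. strict_mono r \<and>
          (\<lambda>n. Morrey_norm p \<mu> w (\<lambda>x. s (r n) x - g x)) \<longlonglongrightarrow> 0"
        unfolding Mp Morrey_norm_tendsto_zero_iff[OF pos(2)] Morrey_mass_cong_weight[OF Pw(1), symmetric]
        using g'(2) by (intro bexI[of _ g] exI[of _ r] conjI)
    qed
  qed
qed

end
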